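(* Let $M\in\{-1,0,1\}$ and $N\ge-1$ be integers with $M+N\ge1$. Then the vectors $\{\tau^{(M,N)}(\mathbf a,\mathbf b):(\mathbf a,\mathbf b)\in\mathcal C^{M,N}\}$ (their images) form a basis of $W^{M,N}$, and $\dim W^{M,N}=2^{M+N-1}$.
   Context: Let $\mathcal H$ be the Lie algebra with basis $\bar e_i,\bar h_i,\bar f_i$ ($i\in\mathbb Z$) and brackets $[\bar e_i,\bar f_j]=\bar h_{i+j}$, all other brackets between basis elements zero. Let $\mathcal H^-$ be spanned by the basis elements with index $\le0$, and $M_{\mathcal H}=U(\mathcal H)\otimes_{U(\mathcal H^-)}\mathbb C\bar v$ the module induced from the trivial one-dimensional $\mathcal H^-$-module. With $\bar e(z)=\sum_i\bar e_iz^i$ etc., $W$ is the quotient of $M_{\mathcal H}$ by the span of all $z$-coefficients of $\bar e(z)^2u,\bar f(z)^2u,\bar e(z)\bar h(z)u,\bar f(z)\bar h(z)u,\bar h(z)^2u$, $u\in M_{\mathcal H}$. For integers $M,N\ge-1$ with $(M,N)\ne(-1,-1)$ let $\mathfrak g(M,N)\subset\mathcal H$ be the subalgebra generated by $\bar e_i$ ($i\ge M$) and $\bar f_j$ ($j\ge N$), and $\overline W^{M,N}=W/\mathfrak g(M,N)W$; set $W^{M,N}=\overline W^{M,N}$ if $M,N\ge0$ and $W^{M,N}=\overline W^{M,N}/\mathbb C\bar v$ if $M=-1$ or $N=-1$. Sets of $0/1$ sequences: in all conditions below, entries whose index is outside the given range are read as $0$. "Triangle relations": $b_{i+1}+a_{i+1}+a_i\le1$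 and $b_{i+1}+b_i+a_i\le1$ for all $i$. "Right neighbour condition": for each $i$ with $b_i\ne0$ there is $j>i$ with $a_j\ne0$ and $b_s=0$ for $i+1\le s\le j$. $\mathcal C^{0,N}$ is the set of $(a_{N-1},\dots,a_0;b_{N-1},\dots,b_1)\in\{0,1\}^{2N-1}$ satisfying the triangle relations, the right neighbour condition and $a_0=0$; $\tau^{(0,N)}(\mathbf a,\mathbf b)=\bar f_{N-1}^{a_{N-1}}\bar h_{N-1}^{b_{N-1}}\cdots\bar f_1^{a_1}\bar h_1^{b_1}\bar v$. $\mathcal C^{1,N}$ is the set of $(a_N,\dots,a_0;b_N,\dots,b_1)\in\{0,1\}^{2N+1}$ satisfying the triangle relations, the right neighbour condition, and: there is $j$ with $a_j\ne0$ and $b_s=0$ for all $s\le j$; $\tau^{(1,N)}(\mathbf a,\mathbf b)=\bar h_N^{b_N}\bar f_{N-1}^{a_N}\bar h_{N-1}^{b_{N-1}}\cdots\bar f_1^{a_2}\bar h_1^{b_1}\bar f_0^{a_1}\bar e_1^{1-a_0}\bar v$. $\mathcal C^{-1,N}=\mathcal C^{1,N-2}$, and for $(a_{N-2},\dots,a_0;b_{N-2},\dots,b_1)\in\mathcal C^{-1,N}$, $\tau^{(-1,N)}(\mathbf a,\mathbf b)=\bar f_{N-1}^{a_{N-2}}\bar f_{N-2}^{a_{N-3}}\bar h_{N-2}^{b_{N-2}}\cdots\bar f_2^{a_1}\bar h_2^{b_2}\bar f_1^{a_0}\bar h_1^{b_1}\bar v$. *)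

theory Defs
  imports Complex_Main "HOL-Library.Function_Algebras"
begin

datatype gen = Ee int | Hh int | Ff int

fun gidx :: "gen \<Rightarrow> int" where
  "gidx (Ee i) = i" | "gidx (Hh i) = i" | "gidx (Ff i) = i"

definition fins :: "('a \<Rightarrow> complex) \<Rightarrow> bool" where
  "fins p \<longleftrightarrow> finite {w. p w \<noteq> 0}"

definition bv :: "'a \<Rightarrow> 'a \<Rightarrow> complex" where
  "bv x = (\<lambda>y. if y = x then 1 else 0)"

definition sc :: "complex \<Rightarrow> ('a \<Rightarrow> complex) \<Rightarrow> 'a \<Rightarrow> complex" where
  "sc c p = (\<lambda>w. c * p w)"

inductive_set lspan :: "('a \<Rightarrow> complex) set \<Rightarrow> ('a \<Rightarrow> complex) set" for S where
  lspan_zero: "0 \<in> lspan S"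
| lspan_base: "x \<in> S \<Longrightarrow> x \<in> lspan S"
| lspan_add: "x \<in> lspan S \<Longrightarrow> y \<in> lspan S \<Longrightarrow> x + y \<in> lspan S"
| lspan_scale: "x \<in> lspan S \<Longrightarrow> sc c x \<in> lspan S"

fun bbr :: "gen \<Rightarrow> gen \<Rightarrow> gen \<Rightarrow> complex" where
  "bbr (Ee i) (Ff j) g = (if g = Hh (i + j) then 1 else 0)"
| "bbr (Ff j) (Ee i) g = (if g = Hh (i + j) then -1 else 0)"
| "bbr _ _ _ = 0"

text \<open>Elements of H are finitely supported functions gen => complex; bilinear bracket.\<close>
definition lbr :: "(gen \<Rightarrow> complex) \<Rightarrow> (gen \<Rightarrow> complex) \<Rightarrow> gen \<Rightarrow> complex" where
  "lbr x y = (\<lambda>g. \<Sum>a\<in>{a. x a \<noteq> 0}. \<Sum>b\<in>{b. y b \<noteq> 0}. x a * y b * bbr a b g)"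

definition Hminus :: "(gen \<Rightarrow> complex) set" where
  "Hminus = {x. fins x \<and> (\<forall>g. x g \<noteq> 0 \<longrightarrow> gidx g \<le> 0)}"

inductive_set gsub :: "int \<Rightarrow> int \<Rightarrow> (gen \<Rightarrow> complex) set" for M N where
  gsub_e: "M \<le> i \<Longrightarrow> bv (Ee i) \<in> gsub M N"
| gsub_f: "N \<le> j \<Longrightarrow> bv (Ff j) \<in> gsub M N"
| gsub_zero: "0 \<in> gsub M N"
| gsub_add: "x \<in> gsub M N \<Longrightarrow> y \<in> gsub M N \<Longrightarrow> x + y \<in> gsub M N"
| gsub_scale: "x \<in> gsub M N \<Longrightarrow> sc c x \<in> gsub M N"
| gsub_br: "x \<in> gsub M N \<Longrightarrow> y \<in> gsub M N \<Longrightarrow> lbr x y \<in> gsub M N"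

text \<open>Elements of T(H): finitely supported functions on words of basis labels;
  multiplication is concatenation.\<close>
definition tmul :: "(gen list \<Rightarrow> complex) \<Rightarrow> (gen list \<Rightarrow> complex) \<Rightarrow> gen list \<Rightarrow> complex" where
  "tmul p q = (\<lambda>w. \<Sum>k\<in>{0..length w}. p (take k w) * q (drop k w))"

definition iota :: "(gen \<Rightarrow> complex) \<Rightarrow> gen list \<Rightarrow> complex" where
  "iota x = (\<lambda>w. case w of [a] \<Rightarrow> x a | _ \<Rightarrow> 0)"

definition urel :: "(gen list \<Rightarrow> complex) set" where
  "urel = {tmul (iota x) (iota y) - tmul (iota y) (iota x) - iota (lbr x y) | x y. fins x \<and> fins y}"

text \<open>LM: kernel of T(H) -> M_H = U(H) (x)_{U(H^-)} C v, i.e. (two-sided ideal of U(H)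
  relations) + T(H) H^-.  The class of a word w is  w . v.\<close>
definition LM :: "(gen list \<Rightarrow> complex) set" where
  "LM = lspan ({tmul (tmul a r) b | a r b. fins a \<and> r \<in> urel \<and> fins b}
             \<union> {tmul a (iota x) | a x. fins a \<and> x \<in> Hminus})"

text \<open>Relations: pairs (X,Y) for e(z)^2, f(z)^2, e(z)h(z), f(z)h(z), h(z)^2.\<close>
definition rpairs :: "((int \<Rightarrow> gen) \<times> (int \<Rightarrow> gen)) set" where
  "rpairs = {(Ee, Ee), (Ff, Ff), (Ee, Hh), (Ff, Hh), (Hh, Hh)}"

definition psum :: "(int \<Rightarrow> gen) \<Rightarrow> (int \<Rightarrow> gen) \<Rightarrow> int \<Rightarrow> (gen list \<Rightarrow> complex) \<Rightarrow> nat
    \<Rightarrow> gen list \<Rightarrow> complex" where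
  "psum X Y n t K = (\<Sum>i\<in>{- int K..int K}. tmul (bv [X i, Y (n - i)]) t)"

text \<open>Representatives c of z^n-coefficients  sum_{i+j=n} X_i Y_j u  (u = class of t in M_H);
  the sum is finite in M_H, i.e. its symmetric partial sums are eventually constant mod LM.\<close>
definition Rco :: "(gen list \<Rightarrow> complex) set" where
  "Rco = {c. fins c \<and> (\<exists>(X, Y)\<in>rpairs. \<exists>n t. fins t \<and>
                 (\<exists>K0. \<forall>K\<ge>K0. psum X Y n t K - c \<in> LM))}"

text \<open>Kernel of T(H) -> W.\<close>
definition JW :: "(gen list \<Rightarrow> complex) set" where
  "JW = lspan (LM \<union> Rco)"

text \<open>Kernel of T(H) -> overline W^{M,N} = W / g(M,N) W.\<close>
definition Jbar :: "int \<Rightarrow> int \<Rightarrow> (gen list \<Rightarrow> complex) set" where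
  "Jbar M N = lspan (JW \<union> {tmul (iota x) t | x t. x \<in> gsub M N \<and> fins t})"

text \<open>Kernel of T(H) -> W^{M,N}.\<close>
definition JMN :: "int \<Rightarrow> int \<Rightarrow> (gen list \<Rightarrow> complex) set" where
  "JMN M N = (if M = -1 \<or> N = -1 then lspan (Jbar M N \<union> {bv []}) else Jbar M N)"

definition indep_mod :: "(gen list \<Rightarrow> complex) set \<Rightarrow> ('i \<Rightarrow> gen list \<Rightarrow> complex) \<Rightarrow> 'i set \<Rightarrow> bool" where
  "indep_mod J f S \<longleftrightarrow> (\<forall>c S'. S' \<subseteq> S \<and> finite S' \<and> (\<Sum>s\<in>S'. sc (c s) (f s)) \<in> J
                          \<longrightarrow> (\<forall>s\<in>S'. c s = 0))"

definition spans_mod :: "(gen list \<Rightarrow> complex) set \<Rightarrow> ('i \<Rightarrow> gen list \<Rightarrow> complex) \<Rightarrow> 'i set \<Rightarrow> bool" where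
  "spans_mod J f S \<longleftrightarrow> (\<forall>t. fins t \<longrightarrow>
       (\<exists>S' c. S' \<subseteq> S \<and> finite S' \<and> t - (\<Sum>s\<in>S'. sc (c s) (f s)) \<in> J))"

definition qdim :: "(gen list \<Rightarrow> complex) set \<Rightarrow> nat" where
  "qdim J = (LEAST n. \<exists>B. finite B \<and> card B = n \<and> (\<forall>b\<in>B. fins b)
                          \<and> (\<forall>t. fins t \<longrightarrow> t \<in> lspan (B \<union> J)))"

text \<open>Sequences are functions int => nat, zero outside the given index range.\<close>
definition triangle :: "(int \<Rightarrow> nat) \<Rightarrow> (int \<Rightarrow> nat) \<Rightarrow> bool" where
  "triangle a b \<longleftrightarrow> (\<forall>i. b (i+1) + a (i+1) + a i \<le> 1 \<and> b (i+1) + b i + a i \<le> 1)"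

definition rightnb :: "(int \<Rightarrow> nat) \<Rightarrow> (int \<Rightarrow> nat) \<Rightarrow> bool" where
  "rightnb a b \<longleftrightarrow> (\<forall>i. b i \<noteq> 0 \<longrightarrow>
      (\<exists>j>i. a j \<noteq> 0 \<and> (\<forall>s. i + 1 \<le> s \<and> s \<le> j \<longrightarrow> b s = 0)))"

definition C0 :: "int \<Rightarrow> ((int \<Rightarrow> nat) \<times> (int \<Rightarrow> nat)) set" where
  "C0 N = {(a, b). (\<forall>i. a i \<le> 1 \<and> b i \<le> 1)
     \<and> (\<forall>i. (i < 0 \<or> N - 1 < i) \<longrightarrow> a i = 0)
     \<and> (\<forall>i. (i < 1 \<or> N - 1 < i) \<longrightarrow> b i = 0)
     \<and> triangle a b \<and> rightnb a b \<and> a 0 = 0}"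

definition C1 :: "int \<Rightarrow> ((int \<Rightarrow> nat) \<times> (int \<Rightarrow> nat)) set" where
  "C1 N = {(a, b). (\<forall>i. a i \<le> 1 \<and> b i \<le> 1)
     \<and> (\<forall>i. (i < 0 \<or> N < i) \<longrightarrow> a i = 0)
     \<and> (\<forall>i. (i < 1 \<or> N < i) \<longrightarrow> b i = 0)
     \<and> triangle a b \<and> rightnb a b
     \<and> (\<exists>j. a j \<noteq> 0 \<and> (\<forall>s\<le>j. b s = 0))}"

definition Cset :: "int \<Rightarrow> int \<Rightarrow> ((int \<Rightarrow> nat) \<times> (int \<Rightarrow> nat)) set" where
  "Cset M N = (if M = 0 then C0 N else if M = 1 then C1 N else C1 (N - 2))"

text \<open>Words (read left to right, acting on v) of tau^{(0,N)}, tau^{(1,N)}, tau^{(-1,N)}.\<close>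
definition tw0 :: "int \<Rightarrow> (int \<Rightarrow> nat) \<Rightarrow> (int \<Rightarrow> nat) \<Rightarrow> gen list" where
  "tw0 N a b = concat (map (\<lambda>k. replicate (a k) (Ff k) @ replicate (b k) (Hh k)) (rev [1..N-1]))"

definition tw1 :: "int \<Rightarrow> (int \<Rightarrow> nat) \<Rightarrow> (int \<Rightarrow> nat) \<Rightarrow> gen list" where
  "tw1 N a b = concat (map (\<lambda>k. replicate (b k) (Hh k) @ replicate (a k) (Ff (k - 1))) (rev [1..N]))
               @ replicate (1 - a 0) (Ee 1)"

definition twm :: "int \<Rightarrow> (int \<Rightarrow> nat) \<Rightarrow> (int \<Rightarrow> nat) \<Rightarrow> gen list" where
  "twm N a b = concat (map (\<lambda>k. replicate (a (k - 1)) (Ff k) @ replicate (b k) (Hh k)) (rev [1..N-1]))"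

definition tau :: "int \<Rightarrow> int \<Rightarrow> (int \<Rightarrow> nat) \<times> (int \<Rightarrow> nat) \<Rightarrow> gen list \<Rightarrow> complex" where
  "tau M N ab = bv (case ab of (a, b) \<Rightarrow>
      (if M = 0 then tw0 N a b else if M = 1 then tw1 N a b else twm N a b))"

end

theory Submission
  imports Defs "HOL-Library.List_Lexorder" "HOL-Library.Product_Lexorder"
begin

text \<open>
  Upper bound: multiplication by \<open>f\<^bsub>N-1\<^esub>\<close> maps the coinvariants for \<open>(M + 1, N - 2)\<close> onto the kernel
  of the projection from those for \<open>(M, N)\<close> to those for \<open>(M, N - 1)\<close>, because the relation
  \<open>f(z)\<^sup>2 = 0\<close> expresses \<open>f\<^bsub>N-1\<^esub>f\<^bsub>N-1\<^esub>\<close> and \<open>f\<^bsub>N-1\<^esub>f\<^bsub>N-2\<^esub>\<close> through products with a generator of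
  \<open>g(M, N)\<close>; the same holds with \<open>e\<^bsub>M-1\<^esub>\<close>. Induction on \<open>M + N\<close> bounds the dimension by
  \<open>2\<^bsup>M+N-1\<^esup>\<close>, and the configurations in \<open>C\<^bsup>M,N\<^esup>\<close> are at least that many.

  Independence: on the Fock space of three free fermions put \<open>e = \<psi>\<^sub>1\<psi>\<^sub>2\<^sup>*\<close>, \<open>f = \<psi>\<^sub>2\<psi>\<^sub>3\<^sup>*\<close>,
  \<open>h = \<psi>\<^sub>1\<psi>\<^sub>3\<^sup>*\<close>; all relations of \<open>W\<close> hold because fermions square to zero. The coefficients of
  suitable basis states vanish on \<open>g(M, N)W\<close>, and with respect to them the vectors \<open>\<tau>\<close> are
  triangular: such a coefficient peels off the first letter of a word, since only one hop of a
  fermion can lead to the state.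
\<close>

section \<open>Finitely supported functions\<close>

declare plus_fun_apply [simp del] zero_fun_apply [simp del] minus_apply [simp del]
lemmas pointwise = plus_fun_apply zero_fun_apply minus_apply

lemma sc_apply: "sc c p w = c * p w"
  by (simp add: sc_def)

lemma sum_fun_apply: "sum f I x = (\<Sum>i\<in>I. f i x)" for f :: "'i \<Rightarrow> 'a \<Rightarrow> complex"
  by (induct I rule: infinite_finite_induct) (simp_all add: pointwise)

interpretation vec: vector_space "sc :: complex \<Rightarrow> ('a \<Rightarrow> complex) \<Rightarrow> 'a \<Rightarrow> complex"
  by unfold_locales (auto simp: sc_def fun_eq_iff algebra_simps pointwise)

lemma lspan_eq_span: "lspan S = vec.span S"
proof
  show "lspan S \<subseteq> vec.span S"
  proof
    fix x assume "x \<in> lspan S"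
    then show "x \<in> vec.span S"
      by induction (auto intro: vec.span_zero vec.span_base vec.span_add vec.span_scale)
  qed
  show "vec.span S \<subseteq> lspan S"
    by (rule vec.span_minimal)
      (auto simp: vec.subspace_def intro: lspan_zero lspan_base lspan_add lspan_scale)
qed

lemma subspace_diff_iff:
  assumes "vec.subspace J" "a - b \<in> J" shows "a \<in> J \<longleftrightarrow> b \<in> J"
  using vec.subspace_add[OF assms(1,2), of b] vec.subspace_diff[OF assms(1) _ assms(2), of a]
  by auto

lemma fins_zero [simp]: "fins 0"
  by (simp add: fins_def pointwise)

lemma fins_bv [simp]: "fins (bv w)"
  by (simp add: fins_def bv_def)

lemma fins_add [simp]: "fins p \<Longrightarrow> fins q \<Longrightarrow> fins (p + q)"
  unfolding fins_def
  by (rule finite_subset[of _ "{w. p w \<noteq> 0} \<union> {w. q w \<noteq> 0}"]) (auto simp: pointwise)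

lemma fins_sc [simp]: "fins p \<Longrightarrow> fins (sc c p)"
  unfolding fins_def by (rule finite_subset[of _ "{w. p w \<noteq> 0}"]) (auto simp: sc_def)

lemma subspace_fins: "vec.subspace (Collect fins)"
  by (auto simp: vec.subspace_def)

lemma fins_diff [simp]: "fins p \<Longrightarrow> fins q \<Longrightarrow> fins (p - q)"
  using vec.subspace_diff[OF subspace_fins] by auto

lemma fins_sum: "(\<And>i. i \<in> I \<Longrightarrow> fins (p i)) \<Longrightarrow> fins (sum p I)"
  using vec.subspace_sum[OF subspace_fins] by auto

lemma fins_expand:
  assumes "fins p" shows "p = (\<Sum>w | p w \<noteq> 0. sc (p w) (bv w))"
proof
  fix x
  have "(\<Sum>w | p w \<noteq> 0. sc (p w) (bv w)) x = (\<Sum>w | p w \<noteq> 0. if w = x then p w else 0)"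
    unfolding sum_fun_apply by (rule sum.cong) (auto simp: bv_def sc_def)
  also have "\<dots> = p x" using assms by (auto simp: fins_def)
  finally show "p x = (\<Sum>w | p w \<noteq> 0. sc (p w) (bv w)) x" by simp
qed

lemma fins_iff_span: "fins p \<longleftrightarrow> p \<in> vec.span (range bv)"
proof
  assume "fins p"
  then have "p = (\<Sum>w | p w \<noteq> 0. sc (p w) (bv w))" by (rule fins_expand)
  also have "\<dots> \<in> vec.span (range bv)"
    by (intro vec.span_sum vec.span_scale vec.span_base) auto
  finally show "p \<in> vec.span (range bv)" .
next
  have "vec.span (range bv) \<subseteq> Collect fins" by (rule vec.span_minimal[OF _ subspace_fins]) auto
  then show "p \<in> vec.span (range bv) \<Longrightarrow> fins p" by auto
qed

lemma fins_induct [consumes 1, case_names zero bv add scale]: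
  assumes "fins p" "P 0" "\<And>w. P (bv w)" "\<And>p q. fins p \<Longrightarrow> fins q \<Longrightarrow> P p \<Longrightarrow> P q \<Longrightarrow> P (p + q)"
    "\<And>c p. fins p \<Longrightarrow> P p \<Longrightarrow> P (sc c p)"
  shows "P p"
proof -
  have "vec.subspace {p. fins p \<and> P p}" using assms(2,4,5) by (simp add: vec.subspace_def)
  then have "vec.span (range bv) \<subseteq> {p. fins p \<and> P p}"
    using assms(3) by (intro vec.span_minimal) auto
  then show ?thesis using assms(1) by (auto simp: fins_iff_span)
qed

section \<open>The tensor algebra\<close>

lemma tmul_zero [simp]: "tmul 0 q = 0" "tmul p 0 = 0"
  and tmul_add: "tmul (p + p') q = tmul p q + tmul p' q" "tmul p (q + q') = tmul p q + tmul p q'"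
  and tmul_diff: "tmul (p - p') q = tmul p q - tmul p' q" "tmul p (q - q') = tmul p q - tmul p q'"
  and tmul_sc: "tmul (sc c p) q = sc c (tmul p q)" "tmul p (sc c q) = sc c (tmul p q)"
  by (auto simp: tmul_def sc_def fun_eq_iff pointwise sum.distrib sum_subtractf algebra_simps
      sum_distrib_left)

lemma tmul_sum: "tmul (sum p I) r = (\<Sum>i\<in>I. tmul (p i) r)" "tmul r (sum p I) = (\<Sum>i\<in>I. tmul r (p i))"
  for p :: "'i \<Rightarrow> gen list \<Rightarrow> complex"
  by (induct I rule: infinite_finite_induct; simp add: tmul_add)+

lemma tmul_bv_bv [simp]: "tmul (bv u) (bv v) = bv (u @ v)"
proof
  fix w
  have "bv u (take k w) * bv v (drop k w) = (if k = length u then bv (u @ v) w else 0)"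
    if "k \<in> {0..length w}" for k
  proof (cases "take k w = u \<and> drop k w = v")
    case True
    then have "w = u @ v" by (metis append_take_drop_id)
    moreover have "k = length u"
      using True that by (metis atLeastAtMost_iff length_take min.absorb2)
    ultimately show ?thesis by (simp add: bv_def)
  next
    case False
    then have "\<not> (k = length u \<and> w = u @ v)" by auto
    with False show ?thesis by (auto simp: bv_def)
  qed
  then have "tmul (bv u) (bv v) w = (\<Sum>k\<in>{0..length w}. if k = length u then bv (u @ v) w else 0)"
    unfolding tmul_def by (rule sum.cong[OF refl])
  also have "\<dots> = bv (u @ v) w" by (auto simp: bv_def)
  finally show "tmul (bv u) (bv v) w = bv (u @ v) w" .
qed

lemma fins_tmul [simp]: "fins p \<Longrightarrow> fins q \<Longrightarrow> fins (tmul p q)"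
proof (induct p rule: fins_induct)
  case (bv w)
  then show ?case by (induct q rule: fins_induct) (auto simp: tmul_add tmul_sc)
qed (auto simp: tmul_add tmul_sc)

lemma tmul_assoc: "fins p \<Longrightarrow> fins q \<Longrightarrow> fins r \<Longrightarrow> tmul (tmul p q) r = tmul p (tmul q r)"
proof (induct p rule: fins_induct)
  case (bv u)
  from bv(1) show ?case
  proof (induct q rule: fins_induct)
    case (bv v)
    from \<open>fins r\<close> show ?case by (induct r rule: fins_induct) (auto simp: tmul_add tmul_sc)
  qed (auto simp: tmul_add tmul_sc)
qed (auto simp: tmul_add tmul_sc)

lemma tmul_bv_Nil [simp]: "fins t \<Longrightarrow> tmul (bv []) t = t" "fins t \<Longrightarrow> tmul t (bv []) = t"
  by (induct t rule: fins_induct; simp add: tmul_add tmul_sc)+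

lemma tmul_bv_Cons: "fins t \<Longrightarrow> tmul (bv (g # h # w)) t = tmul (bv [g]) (tmul (bv (h # w)) t)"
  by (simp flip: tmul_assoc)

lemma tmul_mem_if_span:
  assumes "x \<in> vec.span A" "vec.subspace J" "\<And>a. a \<in> A \<Longrightarrow> tmul p a \<in> J"
  shows "tmul p x \<in> J"
proof -
  have "vec.subspace {x. tmul p x \<in> J}"
    using assms(2) by (simp add: vec.subspace_def tmul_add tmul_sc)
  then have "vec.span A \<subseteq> {x. tmul p x \<in> J}" using assms(3) by (intro vec.span_minimal) auto
  then show ?thesis using assms(1) by blast
qed

lemma iota_bv [simp]: "iota (bv g) = bv [g]"
  by (auto simp: iota_def bv_def fun_eq_iff split: list.splits)

lemma iota_zero [simp]: "iota 0 = 0"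
  and iota_add: "iota (x + y) = iota x + iota y"
  and iota_sc: "iota (sc c x) = sc c (iota x)"
  by (auto simp: iota_def sc_def fun_eq_iff pointwise split: list.splits)

lemma iota_sum: "iota (sum f I) = (\<Sum>i\<in>I. iota (f i))" for f :: "'i \<Rightarrow> gen \<Rightarrow> complex"
  by (induct I rule: infinite_finite_induct) (simp_all add: iota_add)

lemma iota_expand: "fins x \<Longrightarrow> iota x = (\<Sum>g | x g \<noteq> 0. sc (x g) (bv [g]))"
  by (subst fins_expand) (simp_all add: iota_sum iota_sc)

lemma fins_iota [simp]: "fins x \<Longrightarrow> fins (iota x)"
  by (induct x rule: fins_induct) (auto simp: iota_add iota_sc)

lemma bbr_cases:
  obtains "bbr x y = 0" | "bbr x y = bv (Hh (gidx x + gidx y))"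
  | "bbr x y = sc (-1) (bv (Hh (gidx x + gidx y)))"
  by (cases x; cases y; fastforce simp: fun_eq_iff bv_def sc_def pointwise add.commute)

lemma bbr_Ee_Ff: "bbr (Ee i) (Ff j) = bv (Hh (i + j))"
  and bbr_Ff_Ee: "bbr (Ff j) (Ee i) = sc (-1) (bv (Hh (i + j)))"
  by (auto simp: bv_def sc_def fun_eq_iff)

lemma bbr_commuting [simp]:
  "bbr (Ee i) (Ee j) = 0" "bbr (Ff i) (Ff j) = 0" "bbr (Hh i) g = 0" "bbr g (Hh i) = 0"
  by (cases g; auto simp: fun_eq_iff pointwise)+

lemma fins_bbr [simp]: "fins (bbr x y)"
  by (cases x y rule: bbr_cases) (simp_all only: fins_zero fins_bv fins_sc)

lemma lbr_expand: "lbr x y = (\<Sum>a | x a \<noteq> 0. \<Sum>b | y b \<noteq> 0. sc (x a * y b) (bbr a b))"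
  by (simp add: fun_eq_iff lbr_def sum_fun_apply sc_apply)

lemma fins_lbr [simp]: "fins (lbr x y)"
  by (simp add: lbr_expand fins_sum)

lemma lbr_bv [simp]: "lbr (bv a) (bv b) = bbr a b"
proof -
  have "{x. bv a x \<noteq> 0} = {a}" for a :: gen by (auto simp: bv_def)
  then show ?thesis by (simp add: lbr_expand bv_def)
qed

section \<open>The induced module\<close>

lemma subspace_LM: "vec.subspace LM"
  and subspace_JW: "vec.subspace JW"
  and subspace_Jbar: "vec.subspace (Jbar M N)"
  by (simp_all add: LM_def JW_def Jbar_def lspan_eq_span)

lemma subspace_JMN: "vec.subspace (JMN M N)"
  by (simp add: JMN_def subspace_Jbar lspan_eq_span)

lemma fins_urel: "r \<in> urel \<Longrightarrow> fins r"
  by (auto simp: urel_def)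

lemma LM_urel: "fins a \<Longrightarrow> r \<in> urel \<Longrightarrow> fins b \<Longrightarrow> tmul (tmul a r) b \<in> LM"
  and LM_Hminus: "fins a \<Longrightarrow> x \<in> Hminus \<Longrightarrow> tmul a (iota x) \<in> LM"
  unfolding LM_def by (rule lspan_base, blast)+

lemma LM_left_ideal:
  assumes "t \<in> LM" "fins p" shows "tmul p t \<in> LM"
proof (rule tmul_mem_if_span[OF assms(1)[unfolded LM_def lspan_eq_span] subspace_LM])
  fix x assume "x \<in> {tmul (tmul a r) b |a r b. fins a \<and> r \<in> urel \<and> fins b}
    \<union> {tmul a (iota x) |a x. fins a \<and> x \<in> Hminus}"
  then consider (urel) a r b where "x = tmul (tmul a r) b" "fins a" "r \<in> urel" "fins b"
    | (Hminus) a y where "x = tmul a (iota y)" "fins a" "y \<in> Hminus" by blast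
  then show "tmul p x \<in> LM"
  proof cases
    case urel
    then have "tmul p x = tmul (tmul (tmul p a) r) b"
      using assms(2) by (simp add: tmul_assoc fins_urel)
    then show ?thesis using urel assms(2) by (simp add: LM_urel)
  next
    case Hminus
    then have "tmul p x = tmul (tmul p a) (iota y)"
      using assms(2) by (simp add: tmul_assoc Hminus_def)
    then show ?thesis using Hminus assms(2) by (simp add: LM_Hminus)
  qed
qed

lemma commutator_LM:
  assumes "fins x" "fins y" "fins t"
  shows "tmul (iota x) (tmul (iota y) t) - tmul (iota y) (tmul (iota x) t)
    - tmul (iota (lbr x y)) t \<in> LM"
proof -
  let ?r = "tmul (iota x) (iota y) - tmul (iota y) (iota x) - iota (lbr x y)"
  have "?r \<in> urel" using assms by (auto simp: urel_def)
  then have "tmul (tmul (bv []) ?r) t \<in> LM" using assms by (intro LM_urel) auto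
  then show ?thesis using assms by (simp add: tmul_diff tmul_assoc)
qed

lemma commutator_bv_LM:
  assumes "fins t"
  shows "tmul (bv [x]) (tmul (bv [y]) t) - tmul (bv [y]) (tmul (bv [x]) t)
    - tmul (iota (bbr x y)) t \<in> LM"
  using commutator_LM[of "bv x" "bv y" t] assms by simp

lemma commute_memI:
  assumes "fins t" "LM \<subseteq> J" "vec.subspace J"
    and "tmul (bv [y]) (tmul (bv [x]) t) \<in> J" "tmul (iota (bbr x y)) t \<in> J"
  shows "tmul (bv [x]) (tmul (bv [y]) t) \<in> J"
proof -
  have "tmul (bv [x]) (tmul (bv [y]) t) - tmul (bv [y]) (tmul (bv [x]) t) \<in> J"
    using assms(5) subspace_diff_iff[OF assms(3) subsetD[OF assms(2) commutator_bv_LM[OF assms(1)]]]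
    by simp
  from subspace_diff_iff[OF assms(3) this] assms(4) show ?thesis by simp
qed

lemma commute_mem_iff:
  assumes "fins t" "bbr x y = 0" "LM \<subseteq> J" "vec.subspace J"
  shows "tmul (bv [x]) (tmul (bv [y]) t) \<in> J \<longleftrightarrow> tmul (bv [y]) (tmul (bv [x]) t) \<in> J"
  using commutator_bv_LM[OF assms(1), of x y] assms(2,3)
  by (intro subspace_diff_iff[OF assms(4)]) auto

lemma nonpos_LM:
  assumes "gidx g \<le> 0" shows "bv [g] \<in> LM"
proof -
  have "bv g \<in> Hminus" using assms by (simp add: Hminus_def) (simp add: bv_def)
  then have "tmul (bv []) (iota (bv g)) \<in> LM" by (intro LM_Hminus) auto
  then show ?thesis by simp
qed

lemma central_nonpos_LM:
  assumes "k \<le> 0" "fins t" shows "tmul (bv [Hh k]) t \<in> LM"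
proof -
  have word: "bv (Hh k # w) \<in> LM" for w
  proof (induct w)
    case (Cons g w)
    then have "tmul (bv [g]) (bv (Hh k # w)) \<in> LM" by (rule LM_left_ideal) simp
    then show ?case using commute_mem_iff[of "bv w" g "Hh k" LM] subspace_LM by simp
  qed (use assms in \<open>simp add: nonpos_LM\<close>)
  show ?thesis
    by (rule tmul_mem_if_span[OF assms(2)[unfolded fins_iff_span] subspace_LM]) (use word in auto)
qed

lemma bracket_nonpos_LM:
  assumes "gidx x + gidx y \<le> 0" "fins t" shows "tmul (iota (bbr x y)) t \<in> LM"
  using central_nonpos_LM[OF assms] subspace_LM
  by (cases x y rule: bbr_cases)
    (simp_all only: iota_zero iota_bv iota_sc tmul_zero tmul_sc vec.subspace_0 vec.subspace_scale)

lemma eventually_annihilates_word: "\<exists>k. \<forall>g. gidx g \<le> k \<longrightarrow> bv (g # w) \<in> LM"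
proof (induct w)
  case Nil
  then show ?case using nonpos_LM by blast
next
  case (Cons x w)
  then obtain k where annihilates: "\<And>g. gidx g \<le> k \<Longrightarrow> bv (g # w) \<in> LM" by blast
  have "bv (g # x # w) \<in> LM" if gidx_le: "gidx g \<le> min k (- gidx x)" for g
  proof -
    have "tmul (bv [x]) (bv (g # w)) \<in> LM" using gidx_le by (intro LM_left_ideal annihilates) auto
    moreover have "tmul (iota (bbr g x)) (bv w) \<in> LM"
      using gidx_le by (intro bracket_nonpos_LM) auto
    ultimately show ?thesis using commute_memI[of "bv w" LM x g] subspace_LM by simp
  qed
  then show ?case by blast
qed

lemma eventually_annihilates:
  assumes "fins t" shows "\<exists>k. \<forall>g. gidx g \<le> k \<longrightarrow> tmul (bv [g]) t \<in> LM"
  using assms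
proof (induct t rule: fins_induct)
  case (bv w)
  then show ?case using eventually_annihilates_word[of w] by simp
next
  case (add p q)
  then obtain k l where "\<forall>g. gidx g \<le> k \<longrightarrow> tmul (bv [g]) p \<in> LM"
    "\<forall>g. gidx g \<le> l \<longrightarrow> tmul (bv [g]) q \<in> LM" by blast
  then have "\<forall>g. gidx g \<le> min k l \<longrightarrow> tmul (bv [g]) (p + q) \<in> LM"
    by (simp add: tmul_add vec.subspace_add[OF subspace_LM])
  then show ?case by blast
qed (auto simp: tmul_sc vec.subspace_0[OF subspace_LM] intro: vec.subspace_scale[OF subspace_LM])

definition absorbs :: "(gen list \<Rightarrow> complex) set \<Rightarrow> gen \<Rightarrow> bool" where
  "absorbs J g \<longleftrightarrow> (\<forall>t. fins t \<longrightarrow> tmul (bv [g]) t \<in> J)"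

lemma absorbsD: "absorbs J g \<Longrightarrow> fins t \<Longrightarrow> tmul (bv [g]) t \<in> J"
  by (simp add: absorbs_def)

lemma absorbs_bracket:
  assumes "absorbs J (Ee i)" "absorbs J (Ff j)" "LM \<subseteq> J" "vec.subspace J"
  shows "absorbs J (Hh (i + j))"
  unfolding absorbs_def
proof (intro allI impI)
  fix t :: "gen list \<Rightarrow> complex" assume fins_t: "fins t"
  let ?ef = "tmul (bv [Ee i]) (tmul (bv [Ff j]) t)"
    and ?fe = "tmul (bv [Ff j]) (tmul (bv [Ee i]) t)"
  have "?ef - ?fe \<in> J" using assms fins_t by (intro vec.subspace_diff absorbsD) auto
  moreover have "?ef - ?fe - tmul (bv [Hh (i + j)]) t \<in> J"
    using assms(3) commutator_bv_LM[OF fins_t, of "Ee i" "Ff j"] by (auto simp: bbr_Ee_Ff)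
  from subspace_diff_iff[OF assms(4) this] calculation show "tmul (bv [Hh (i + j)]) t \<in> J" by simp
qed

lemma nonpos_Cons_span:
  assumes "gidx g \<le> 0"
  shows "bv (g # w) \<in> vec.span (LM \<union> {tmul (bv [Hh k]) t |k t. 0 < k \<and> fins t})"
    (is "_ \<in> vec.span (LM \<union> ?H)")
proof (induct w)
  case Nil
  then show ?case using nonpos_LM[OF assms] by (simp add: vec.span_base)
next
  case (Cons x w)
  have LM_subset: "LM \<subseteq> vec.span (LM \<union> ?H)" by (auto intro: vec.span_base)
  have "tmul (bv [x]) a \<in> vec.span (LM \<union> ?H)" if "a \<in> LM \<union> ?H" for a
    using that
  proof
    assume "a \<in> ?H"
    then obtain k t where a_eq: "a = tmul (bv [Hh k]) t" "0 < k" "fins t" by blast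
    then have "tmul (bv [Hh k]) (tmul (bv [x]) t) \<in> ?H"
      by (intro CollectI exI[of _ k] exI[of _ "tmul (bv [x]) t"]) simp
    then have "tmul (bv [Hh k]) (tmul (bv [x]) t) \<in> vec.span (LM \<union> ?H)" by (simp add: vec.span_base)
    then show ?thesis
      unfolding a_eq(1) using commute_mem_iff[OF a_eq(3) _ LM_subset, of x "Hh k"] by simp
  qed (use LM_subset LM_left_ideal[of a "bv [x]"] in auto)
  then have "tmul (bv [x]) (bv (g # w)) \<in> vec.span (LM \<union> ?H)"
    by (rule tmul_mem_if_span[OF Cons vec.subspace_span])
  then have "tmul (bv [x]) (tmul (bv [g]) (bv w)) \<in> vec.span (LM \<union> ?H)" by simp
  moreover have "tmul (iota (bbr g x)) (bv w) \<in> vec.span (LM \<union> ?H)"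
  proof (cases "gidx g + gidx x \<le> 0")
    case True
    then show ?thesis using bracket_nonpos_LM[of g x "bv w"] LM_subset by auto
  next
    case False
    then have "tmul (bv [Hh (gidx g + gidx x)]) (bv w) \<in> vec.span (LM \<union> ?H)"
      by (intro vec.span_base UnI2 CollectI exI[of _ "gidx g + gidx x"] exI[of _ "bv w"]) simp
    then show ?thesis
      by (cases g x rule: bbr_cases)
        (simp_all only: iota_zero iota_bv iota_sc tmul_zero tmul_sc vec.span_zero vec.span_scale)
  qed
  ultimately have "tmul (bv [g]) (tmul (bv [x]) (bv w)) \<in> vec.span (LM \<union> ?H)"
    by - (rule commute_memI[OF fins_bv LM_subset vec.subspace_span])
  then show ?case by simp
qed

lemma vacuum_spans:
  assumes J_superspace: "vec.subspace J" "LM \<subseteq> J" and absorbs_pos: "\<And>g. 0 < gidx g \<Longrightarrow> absorbs J g"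
    and fins_t: "fins t"
  shows "t \<in> vec.span ({bv []} \<union> J)"
proof -
  have central_pos_subset: "{tmul (bv [Hh k]) t |k t. 0 < k \<and> fins t} \<subseteq> J"
    by (auto intro!: absorbsD[OF absorbs_pos])
  have "bv (g # w) \<in> J" for g w
  proof (cases "gidx g \<le> 0")
    case True
    show ?thesis
      by (rule subsetD[OF vec.span_minimal[OF Un_least[OF J_superspace(2) central_pos_subset]
          J_superspace(1)] nonpos_Cons_span[OF True]])
  next
    case False
    then have "tmul (bv [g]) (bv w) \<in> J" by (intro absorbsD absorbs_pos) auto
    then show ?thesis by simp
  qed
  then have "bv w \<in> {bv []} \<union> J" for w by (cases w) auto
  then have "vec.span (range bv) \<subseteq> vec.span ({bv []} \<union> J)" by (intro vec.span_mono) auto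
  then show ?thesis using fins_t by (auto simp: fins_iff_span)
qed

section \<open>The quadratic relations generate a left ideal\<close>

lemma LM_JW: "LM \<subseteq> JW"
  unfolding JW_def using lspan_base by blast

lemma eventually_window:
  assumes "\<forall>\<^sub>F I in finite_subsets_at_top UNIV. P I"
  shows "\<forall>\<^sub>F K in sequentially. P {- int K..int K}"
proof -
  obtain J where J_large: "finite J" "\<And>I. finite I \<Longrightarrow> J \<subseteq> I \<Longrightarrow> P I"
    using assms by (auto simp: eventually_finite_subsets_at_top)
  have "J \<subseteq> {- int K..int K}" if "(\<Sum>j\<in>J. nat \<bar>j\<bar>) \<le> K" for K
  proof
    fix j assume "j \<in> J"
    then have "nat \<bar>j\<bar> \<le> K" using member_le_sum[of j J "\<lambda>j. nat \<bar>j\<bar>"] J_large(1) that by simp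
    then show "j \<in> {- int K..int K}" by auto
  qed
  then show ?thesis by (intro eventually_sequentiallyI[of "\<Sum>j\<in>J. nat \<bar>j\<bar>"] J_large(2)) auto
qed

definition null_sum :: "(int \<Rightarrow> gen list \<Rightarrow> complex) \<Rightarrow> bool" where
  "null_sum u \<longleftrightarrow> (\<forall>\<^sub>F I in finite_subsets_at_top UNIV. sum u I \<in> JW)"

lemma null_sum_zero: "null_sum (\<lambda>i. 0)"
  by (simp add: null_sum_def vec.subspace_0[OF subspace_JW])

lemma null_sum_add: "null_sum u \<Longrightarrow> null_sum v \<Longrightarrow> null_sum (\<lambda>i. u i + v i)"
  unfolding null_sum_def
  by (erule (1) eventually_elim2) (simp add: sum.distrib vec.subspace_add[OF subspace_JW])

lemma null_sum_scale: "null_sum u \<Longrightarrow> null_sum (\<lambda>i. sc c (u i))"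
  unfolding null_sum_def
  by (elim eventually_mono) (simp add: vec.subspace_scale[OF subspace_JW] flip: vec.scale_sum_right)

lemma null_sum_cong:
  assumes "null_sum v" "\<And>i. u i - v i \<in> JW" shows "null_sum u"
  using assms(1) unfolding null_sum_def
proof eventually_elim
  case (elim I)
  have "(\<Sum>i\<in>I. u i - v i) \<in> JW" using assms(2) by (intro vec.subspace_sum[OF subspace_JW])
  then have "sum u I - sum v I \<in> JW" by (simp add: sum_subtractf)
  from subspace_diff_iff[OF subspace_JW this] elim show ?case by simp
qed

lemma null_sum_reindex:
  assumes "bij h" "null_sum u" shows "null_sum (\<lambda>i. u (h i))"
proof -
  obtain J where J_large: "finite J" "\<And>I. finite I \<Longrightarrow> J \<subseteq> I \<Longrightarrow> sum u I \<in> JW"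
    using assms(2) by (auto simp: null_sum_def eventually_finite_subsets_at_top)
  have "sum (\<lambda>i. u (h i)) I \<in> JW" if "finite I" "h -` J \<subseteq> I" for I
  proof -
    have "J = h ` (h -` J)" using bij_is_surj[OF assms(1)] by (simp add: surj_image_vimage_eq)
    then have "J \<subseteq> h ` I" using that(2) by blast
    then have "sum u (h ` I) \<in> JW" using that(1) by (intro J_large(2)) auto
    then show ?thesis using bij_is_inj[OF assms(1)] by (simp add: sum.reindex inj_on_subset)
  qed
  moreover have "finite (h -` J)" using J_large(1) bij_is_inj[OF assms(1)] by (rule finite_vimageI)
  ultimately show ?thesis unfolding null_sum_def eventually_finite_subsets_at_top
    by (intro exI[of _ "h -` J"]) auto
qed

lemma rpairsD:
  assumes "(X, Y) \<in> rpairs"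
  shows "bbr (X i) (Y j) = 0" "gidx (X i) = i" "gidx (Y j) = j"
  using assms by (auto simp: rpairs_def)

lemma product_eventually_LM:
  assumes "(X, Y) \<in> rpairs" "fins t"
  shows "\<exists>k. \<forall>i. k < \<bar>i\<bar> \<longrightarrow> tmul (bv [X i, Y (n - i)]) t \<in> LM"
proof -
  obtain k where annihilates: "\<And>g. gidx g \<le> k \<Longrightarrow> tmul (bv [g]) t \<in> LM"
    using eventually_annihilates[OF assms(2)] by blast
  have "tmul (bv [X i, Y (n - i)]) t \<in> LM" if i_large: "\<bar>k\<bar> + \<bar>n\<bar> < \<bar>i\<bar>" for i
  proof (cases "i > 0")
    case True
    then have "tmul (bv [Y (n - i)]) t \<in> LM"
      using i_large rpairsD[OF assms(1)] by (intro annihilates) auto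
    then show ?thesis by (simp add: tmul_bv_Cons assms LM_left_ideal)
  next
    case False
    then have "tmul (bv [X i]) t \<in> LM"
      using i_large rpairsD[OF assms(1)] by (intro annihilates) auto
    then have "tmul (bv [Y (n - i)]) (tmul (bv [X i]) t) \<in> LM" by (simp add: LM_left_ideal)
    then show ?thesis
      using commute_mem_iff[OF assms(2) rpairsD(1)[OF assms(1)] order_refl subspace_LM]
      by (simp add: tmul_bv_Cons assms(2))
  qed
  then show ?thesis by blast
qed

lemma null_sum_rpairs:
  assumes "(X, Y) \<in> rpairs" "fins t"
  shows "null_sum (\<lambda>i. tmul (bv [X i, Y (n - i)]) t)"
proof -
  let ?u = "\<lambda>i. tmul (bv [X i, Y (n - i)]) t"
  obtain k where terms_LM: "\<And>i. k < \<bar>i\<bar> \<Longrightarrow> ?u i \<in> LM"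
    using product_eventually_LM[OF assms] by blast
  define c where "c = psum X Y n t (nat k)"
  have partial_sum_LM: "sum ?u I - c \<in> LM" if "finite I" "{-int (nat k)..int (nat k)} \<subseteq> I" for I
  proof -
    have "sum ?u I - c = sum ?u (I - {-int (nat k)..int (nat k)})"
      unfolding c_def psum_def using that by (simp add: sum_diff)
    also have "\<dots> \<in> LM"
      by (intro vec.subspace_sum[OF subspace_LM] terms_LM) (auto split: if_splits)
    finally show ?thesis .
  qed
  have "psum X Y n t K - c \<in> LM" if "K \<ge> nat k" for K
    unfolding psum_def by (rule partial_sum_LM) (use that in auto)
  moreover have "fins c" unfolding c_def psum_def using assms(2) by (intro fins_sum) auto
  ultimately have "c \<in> Rco" unfolding Rco_def using assms
    by (intro CollectI conjI bexI[of _ "(X, Y)"]) auto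
  then have "c \<in> JW" unfolding JW_def by (auto intro: lspan_base)
  then have "sum ?u I \<in> JW" if "finite I" "{-int (nat k)..int (nat k)} \<subseteq> I" for I
    using subspace_diff_iff[OF subspace_JW subsetD[OF LM_JW partial_sum_LM[OF that]]] by simp
  then show ?thesis unfolding null_sum_def eventually_finite_subsets_at_top
    by (intro exI[of _ "{-int (nat k)..int (nat k)}"]) auto
qed

definition quad_pair :: "(int \<Rightarrow> gen) \<Rightarrow> (int \<Rightarrow> gen) \<Rightarrow> bool" where
  "quad_pair X Y \<longleftrightarrow> (X, Y) \<in> rpairs \<or> (Y, X) \<in> rpairs"

lemma null_sum_quad_pair:
  assumes "quad_pair X Y" "fins t"
  shows "null_sum (\<lambda>i. tmul (bv [X (s + i), Y (n - i)]) t)"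
  using assms(1) unfolding quad_pair_def
proof
  assume "(X, Y) \<in> rpairs"
  then have "null_sum (\<lambda>i. tmul (bv [X i, Y (n + s - i)]) t)"
    using assms(2) by (rule null_sum_rpairs)
  moreover have "bij ((+) s)" by (rule o_bij[of "\<lambda>i. i - s"]) (auto simp: fun_eq_iff)
  ultimately have "null_sum (\<lambda>i. tmul (bv [X (s + i), Y (n + s - (s + i))]) t)"
    by (rule null_sum_reindex[rotated])
  then show ?thesis by (simp add: algebra_simps)
next
  assume YX_rpairs: "(Y, X) \<in> rpairs"
  then have "null_sum (\<lambda>i. tmul (bv [Y i, X (n + s - i)]) t)"
    using assms(2) by (rule null_sum_rpairs)
  moreover have "bij (\<lambda>i. n - i)" by (rule involuntory_imp_bij) simp
  ultimately have "null_sum (\<lambda>i. tmul (bv [Y (n - i), X (n + s - (n - i))]) t)"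
    by (rule null_sum_reindex[rotated])
  then have "null_sum (\<lambda>i. tmul (bv [Y (n - i), X (s + i)]) t)" by (simp add: algebra_simps)
  then show ?thesis
  proof (rule null_sum_cong)
    fix i
    have "bbr (X (s + i)) (Y (n - i)) = 0" using YX_rpairs by (auto simp: rpairs_def)
    then show "tmul (bv [X (s + i), Y (n - i)]) t - tmul (bv [Y (n - i), X (s + i)]) t \<in> JW"
      using commutator_bv_LM[OF assms(2), of "X (s + i)" "Y (n - i)"] LM_JW assms(2)
      by (auto simp: tmul_bv_Cons)
  qed
qed

lemma bbr_quad_pair:
  assumes "quad_pair X Y"
  shows "\<exists>c. (\<forall>i. bbr g (X i) = sc c (bv (Hh (gidx g + i)))) \<and> (c = 0 \<or> quad_pair Hh Y)"
proof (cases "\<forall>i. bbr g (X i) = 0")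
  case True
  then show ?thesis by (intro exI[of _ 0]) simp
next
  case False
  with assms consider (E) s where "X = Ff" "g = Ee s" | (F) s where "X = Ee" "g = Ff s"
    by (cases g) (auto simp: quad_pair_def rpairs_def fun_eq_iff pointwise)
  then show ?thesis
  proof cases
    case E
    then show ?thesis
      using assms by (intro exI[of _ 1]) (auto simp: bbr_Ee_Ff quad_pair_def rpairs_def)
  next
    case F
    then show ?thesis
      using assms
      by (intro exI[of _ "-1"]) (auto simp: bbr_Ff_Ee add.commute quad_pair_def rpairs_def)
  qed
qed

lemma null_sum_bracket_left:
  assumes "quad_pair X Y" "fins t"
  shows "null_sum (\<lambda>i. tmul (iota (bbr g (X i))) (tmul (bv [Y (n - i)]) t))"
proof -
  obtain c where bracket: "\<forall>i. bbr g (X i) = sc c (bv (Hh (gidx g + i)))" "c = 0 \<or> quad_pair Hh Y"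
    using bbr_quad_pair[OF assms(1)] by blast
  have "null_sum (\<lambda>i. sc c (tmul (bv [Hh (gidx g + i), Y (n - i)]) t))"
    using bracket(2) null_sum_zero null_sum_scale[OF null_sum_quad_pair[OF _ assms(2)], of Hh Y c]
    by auto
  then show ?thesis using assms(2) by (simp add: bracket(1) iota_sc tmul_sc tmul_bv_Cons)
qed

lemma null_sum_bracket_right:
  assumes "quad_pair X Y" "fins t"
  shows "null_sum (\<lambda>i. tmul (bv [X i]) (tmul (iota (bbr g (Y (n - i)))) t))"
proof -
  obtain c where bracket: "\<forall>i. bbr g (Y i) = sc c (bv (Hh (gidx g + i)))" "c = 0 \<or> quad_pair X Hh"
    using bbr_quad_pair[of Y X g] assms(1) by (auto simp: quad_pair_def)
  have "null_sum (\<lambda>i. sc c (tmul (bv [X i, Hh (gidx g + n - i)]) t))"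
    using bracket(2) null_sum_zero null_sum_scale[OF null_sum_quad_pair[OF _ assms(2)], of X Hh c 0]
    by auto
  then show ?thesis
    using assms(2) by (simp add: bracket(1) iota_sc tmul_sc tmul_bv_Cons add_diff_eq)
qed

lemma commute_past_product_LM:
  assumes "fins t"
  shows "tmul (bv [g]) (tmul (bv [x, y]) t) - (tmul (bv [x, y]) (tmul (bv [g]) t)
      + tmul (iota (bbr g x)) (tmul (bv [y]) t) + tmul (bv [x]) (tmul (iota (bbr g y)) t)) \<in> LM"
proof -
  have "tmul (bv [g]) (tmul (bv [x]) (tmul (bv [y]) t))
      - tmul (bv [x]) (tmul (bv [g]) (tmul (bv [y]) t))
      - tmul (iota (bbr g x)) (tmul (bv [y]) t) \<in> LM" (is "?a \<in> _")
    using assms by (intro commutator_bv_LM) auto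
  moreover have "tmul (bv [x]) (tmul (bv [g]) (tmul (bv [y]) t) - tmul (bv [y]) (tmul (bv [g]) t)
      - tmul (iota (bbr g y)) t) \<in> LM" (is "?b \<in> _")
    using assms by (intro LM_left_ideal commutator_bv_LM) auto
  ultimately have "?a + ?b \<in> LM" by (rule vec.subspace_add[OF subspace_LM])
  then show ?thesis using assms
    by (simp add: tmul_diff tmul_add tmul_bv_Cons algebra_simps)
qed

lemma null_sum_left_mult:
  assumes "quad_pair X Y" "fins t"
  shows "null_sum (\<lambda>i. tmul (bv [g]) (tmul (bv [X i, Y (n - i)]) t))"
proof (rule null_sum_cong)
  have "fins (tmul (bv [g]) t)" using assms(2) by simp
  from null_sum_quad_pair[OF assms(1) this, of 0 n]
  show "null_sum (\<lambda>i. tmul (bv [X i, Y (n - i)]) (tmul (bv [g]) t)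
    + tmul (iota (bbr g (X i))) (tmul (bv [Y (n - i)]) t)
    + tmul (bv [X i]) (tmul (iota (bbr g (Y (n - i)))) t))"
    by (intro null_sum_add null_sum_bracket_left null_sum_bracket_right assms) simp
qed (use commute_past_product_LM[OF assms(2)] LM_JW in blast)

lemma Rco_left_JW:
  assumes "c \<in> Rco" shows "tmul (bv [g]) c \<in> JW"
proof -
  from assms obtain X Y n t K0 where XY_rpairs: "(X, Y) \<in> rpairs" and fins_t: "fins t"
    and partial_sums_LM: "\<And>K. K \<ge> K0 \<Longrightarrow> psum X Y n t K - c \<in> LM"
    unfolding Rco_def by blast
  have "quad_pair X Y" using XY_rpairs by (simp add: quad_pair_def)
  from eventually_window[OF null_sum_left_mult[OF this fins_t, unfolded null_sum_def]]
  obtain K where K_large: "K \<ge> K0"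
    "(\<Sum>i\<in>{- int K..int K}. tmul (bv [g]) (tmul (bv [X i, Y (n - i)]) t)) \<in> JW"
    unfolding eventually_sequentially by (meson max.cobounded1 max.cobounded2)
  have "tmul (bv [g]) (psum X Y n t K - c) \<in> JW"
    using LM_left_ideal[OF partial_sums_LM[OF K_large(1)]] LM_JW by auto
  then have diff_JW: "tmul (bv [g]) (psum X Y n t K) - tmul (bv [g]) c \<in> JW"
    by (simp add: tmul_diff)
  have "tmul (bv [g]) (psum X Y n t K) \<in> JW" using K_large(2) by (simp add: psum_def tmul_sum)
  then show ?thesis using subspace_diff_iff[OF subspace_JW diff_JW] by simp
qed

lemma JW_left_ideal:
  assumes "x \<in> JW" shows "tmul (bv [g]) x \<in> JW"
proof (rule tmul_mem_if_span[OF assms[unfolded JW_def lspan_eq_span] subspace_JW])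
  fix a assume "a \<in> LM \<union> Rco"
  then show "tmul (bv [g]) a \<in> JW"
    using Rco_left_JW LM_left_ideal[of a "bv [g]"] LM_JW by auto
qed

section \<open>Upper bound for the dimension\<close>

lemma JW_Jbar: "JW \<subseteq> Jbar M N"
  unfolding Jbar_def using lspan_base by blast

lemma LM_Jbar: "LM \<subseteq> Jbar M N"
  using LM_JW JW_Jbar by (rule subset_trans)

lemma Jbar_JMN: "Jbar M N \<subseteq> JMN M N"
  by (auto simp: JMN_def intro: lspan_base)

lemma absorbs_Jbar_if_gsub: "bv g \<in> gsub M N \<Longrightarrow> absorbs (Jbar M N) g"
  unfolding absorbs_def Jbar_def by (intro allI impI lspan_base UnI2 CollectI exI[of _ "bv g"]) auto

lemma absorbs_Jbar_Ee: "M \<le> i \<Longrightarrow> absorbs (Jbar M N) (Ee i)"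
  by (intro absorbs_Jbar_if_gsub gsub_e)

lemma absorbs_Jbar_Ff: "N \<le> j \<Longrightarrow> absorbs (Jbar M N) (Ff j)"
  by (intro absorbs_Jbar_if_gsub gsub_f)

lemma absorbs_Jbar_Hh:
  assumes "M + N \<le> k" shows "absorbs (Jbar M N) (Hh k)"
  using absorbs_bracket[OF absorbs_Jbar_Ee[of M M N] absorbs_Jbar_Ff[of N "k - M" M] LM_Jbar
    subspace_Jbar]
    assms by simp

lemma Jbar_least:
  assumes Z_superspace: "vec.subspace Z" "JW \<subseteq> Z"
    and absorbs_Ee: "\<And>i. M \<le> i \<Longrightarrow> absorbs Z (Ee i)" and absorbs_Ff: "\<And>j. N \<le> j \<Longrightarrow> absorbs Z (Ff j)"
  shows "Jbar M N \<subseteq> Z"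
proof -
  have gsub_absorbed: "fins x \<and> (\<forall>t. fins t \<longrightarrow> tmul (iota x) t \<in> Z)" if "x \<in> gsub M N" for x
    using that
  proof induct
    case (gsub_br x y)
    have "tmul (iota (lbr x y)) t \<in> Z" if fins_t: "fins t" for t
    proof -
      let ?c = "tmul (iota x) (tmul (iota y) t) - tmul (iota y) (tmul (iota x) t)"
      have "?c - tmul (iota (lbr x y)) t \<in> Z"
        using commutator_LM[of x y t] gsub_br fins_t LM_JW Z_superspace(2) by blast
      moreover have "?c \<in> Z"
        using gsub_br fins_t by (intro vec.subspace_diff[OF Z_superspace(1)]) auto
      ultimately show ?thesis using subspace_diff_iff[OF Z_superspace(1)] by blast
    qed
    then show ?case by simp
  qed (use Z_superspace absorbs_Ee absorbs_Ff in
    \<open>auto simp: absorbs_def iota_add iota_sc tmul_add tmul_sc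
      intro: vec.subspace_0 vec.subspace_add vec.subspace_scale\<close>)
  show ?thesis
    unfolding Jbar_def lspan_eq_span
    by (rule vec.span_minimal[OF _ Z_superspace(1)]) (use Z_superspace(2) gsub_absorbed in auto)
qed

lemma Jbar_step:
  fixes g :: gen and M N :: int
  defines "Z \<equiv> vec.span ({tmul (bv [g]) t |t. fins t} \<union> Jbar M N)"
  assumes new_Ee: "\<And>i. M' \<le> i \<Longrightarrow> Ee i = g \<or> M \<le> i" and new_Ff: "\<And>j. N' \<le> j \<Longrightarrow> Ff j = g \<or> N \<le> j"
  shows "Jbar M' N' \<subseteq> Z"
proof (rule Jbar_least)
  have "absorbs Z g" by (auto simp: Z_def absorbs_def intro: vec.span_base)
  moreover have "absorbs Z h" if "absorbs (Jbar M N) h" for h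
    using that by (auto simp: Z_def absorbs_def intro: vec.span_base)
  ultimately show "\<And>i. M' \<le> i \<Longrightarrow> absorbs Z (Ee i)" "\<And>j. N' \<le> j \<Longrightarrow> absorbs Z (Ff j)"
    using new_Ee new_Ff absorbs_Jbar_Ee absorbs_Jbar_Ff by metis+
  show "JW \<subseteq> Z"
    using JW_Jbar[of M N] vec.span_superset[of "{tmul (bv [g]) t |t. fins t} \<union> Jbar M N"]
    unfolding Z_def by blast
qed (simp add: Z_def)

lemma Jbar_Ee_step: "Jbar (M - 1) N \<subseteq> vec.span ({tmul (bv [Ee (M - 1)]) t |t. fins t} \<union> Jbar M N)"
  by (rule Jbar_step) auto

lemma Jbar_Ff_step: "Jbar M (N - 1) \<subseteq> vec.span ({tmul (bv [Ff (N - 1)]) t |t. fins t} \<union> Jbar M N)"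
  by (rule Jbar_step) auto

lemma null_sum_dominant_terms:
  assumes null: "null_sum v" and J_superspace: "vec.subspace J" "JW \<subseteq> J"
    and dominant: "finite A" "A \<noteq> {}" "\<And>i. i \<in> A \<Longrightarrow> v i - u \<in> J" and other: "\<And>i. i \<notin> A \<Longrightarrow> v i \<in> J"
  shows "u \<in> J"
proof -
  obtain I where I_window: "finite I" "A \<subseteq> I" "sum v I \<in> J"
  proof -
    obtain I0 where "finite I0" "\<And>I. finite I \<Longrightarrow> I0 \<subseteq> I \<Longrightarrow> sum v I \<in> JW"
      using null by (auto simp: null_sum_def eventually_finite_subsets_at_top)
    then show thesis using dominant(1) J_superspace(2) by (intro that[of "I0 \<union> A"]) auto
  qed
  have "sum v I = sum v (I - A) + sum v A" by (rule sum.subset_diff[OF I_window(2,1)])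
  moreover have "sum v (I - A) \<in> J" using other by (intro vec.subspace_sum[OF J_superspace(1)]) auto
  ultimately have "sum v A \<in> J"
    using vec.subspace_diff[OF J_superspace(1) I_window(3)] by (metis add_diff_cancel_left')
  moreover have "(\<Sum>i\<in>A. v i - u) \<in> J"
    using dominant(3) by (intro vec.subspace_sum[OF J_superspace(1)])
  ultimately have "sum v A - (\<Sum>i\<in>A. v i - u) \<in> J" by (rule vec.subspace_diff[OF J_superspace(1)])
  moreover have "sum v A - (\<Sum>i\<in>A. v i - u) = sc (of_nat (card A)) u"
    by (simp add: fun_eq_iff sum_fun_apply sc_def pointwise sum_subtractf)
  ultimately have "sc (of_nat (card A)) u \<in> J" by simp
  from vec.subspace_scale[OF J_superspace(1) this, of "inverse (of_nat (card A))"] show ?thesis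
    using dominant by simp
qed

lemma commuting_product_mem:
  assumes "bbr x y = 0" "absorbs J x \<or> absorbs J y" "fins t" "LM \<subseteq> J" "vec.subspace J"
  shows "tmul (bv [x]) (tmul (bv [y]) t) \<in> J"
proof -
  have "tmul (bv [x]) (tmul (bv [y]) t) \<in> J \<or> tmul (bv [y]) (tmul (bv [x]) t) \<in> J"
    using assms(2,3) by (auto intro: absorbsD)
  then show ?thesis using commute_mem_iff[OF assms(3,1,4,5)] by blast
qed

lemma extremal_product_mem:
  assumes XX_rpairs: "(X, X) \<in> rpairs" and J_superspace: "vec.subspace J" "JW \<subseteq> J"
    and absorbs_X: "\<And>i. p \<le> i \<Longrightarrow> absorbs J (X i)" and j_ge: "p - 2 \<le> j" and fins_t: "fins t"
  shows "tmul (bv [X (p - 1)]) (tmul (bv [X j]) t) \<in> J"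
proof -
  have LM_subset: "LM \<subseteq> J" using LM_JW J_superspace(2) by (rule subset_trans)
  have large: "tmul (bv [X i]) (tmul (bv [X k]) t) \<in> J" if "p \<le> i \<or> p \<le> k" for i k
    using that absorbs_X fins_t
    by (intro commuting_product_mem[OF rpairsD(1)[OF XX_rpairs] _ _ LM_subset J_superspace(1)]) auto
  show ?thesis
  proof (cases "p \<le> j")
    case False
    then have j_cases: "j = p - 1 \<or> j = p - 2" using j_ge by auto
    show ?thesis
    proof (rule null_sum_dominant_terms[OF null_sum_rpairs[OF XX_rpairs fins_t] J_superspace,
          of "{p - 1, j}" "p - 1 + j"])
      fix i assume "i \<in> {p - 1, j}"
      then consider (first) "i = p - 1" | (second) "i = j" by blast
      then show "tmul (bv [X i, X (p - 1 + j - i)]) t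
        - tmul (bv [X (p - 1)]) (tmul (bv [X j]) t) \<in> J"
      proof cases
        case first
        then show ?thesis
          using fins_t vec.subspace_0[OF J_superspace(1)] by (simp add: tmul_bv_Cons)
      next
        case second
        then show ?thesis
          using subsetD[OF LM_subset commutator_bv_LM[OF fins_t, of "X j" "X (p - 1)"]] fins_t
          by (simp add: tmul_bv_Cons rpairsD(1)[OF XX_rpairs])
      qed
    next
      fix i assume "i \<notin> {p - 1, j}"
      then have "p \<le> i \<or> p \<le> p - 1 + j - i" using j_cases by auto
      then show "tmul (bv [X i, X (p - 1 + j - i)]) t \<in> J"
        using large fins_t by (simp add: tmul_bv_Cons)
    qed auto
  qed (use large in blast)
qed

lemma left_mult_Jbar:
  assumes Ee_case: "\<And>i t. M' \<le> i \<Longrightarrow> fins t \<Longrightarrow> tmul (bv [g]) (tmul (bv [Ee i]) t) \<in> Jbar M N"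
    and Ff_case: "\<And>j t. N' \<le> j \<Longrightarrow> fins t \<Longrightarrow> tmul (bv [g]) (tmul (bv [Ff j]) t) \<in> Jbar M N"
    and x_Jbar: "x \<in> Jbar M' N'"
  shows "tmul (bv [g]) x \<in> Jbar M N"
proof -
  have "Jbar M' N' \<subseteq> {x. tmul (bv [g]) x \<in> Jbar M N}"
  proof (rule Jbar_least)
    show "vec.subspace {x. tmul (bv [g]) x \<in> Jbar M N}"
      using subspace_Jbar[of M N] by (simp add: vec.subspace_def tmul_add tmul_sc)
    show "JW \<subseteq> {x. tmul (bv [g]) x \<in> Jbar M N}" using JW_left_ideal JW_Jbar by blast
  qed (use Ee_case Ff_case in \<open>simp_all add: absorbs_def\<close>)
  then show ?thesis using x_Jbar by blast
qed

lemma Ff_mult_Jbar: "x \<in> Jbar (M + 1) (N - 2) \<Longrightarrow> tmul (bv [Ff (N - 1)]) x \<in> Jbar M N"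
proof (erule left_mult_Jbar[rotated 2])
  fix i and t :: "gen list \<Rightarrow> complex" assume i_ge: "M + 1 \<le> i" and fins_t: "fins t"
  show "tmul (bv [Ff (N - 1)]) (tmul (bv [Ee i]) t) \<in> Jbar M N"
  proof (rule commute_memI[OF fins_t LM_Jbar subspace_Jbar])
    show "tmul (bv [Ee i]) (tmul (bv [Ff (N - 1)]) t) \<in> Jbar M N"
      using i_ge fins_t by (intro absorbsD[OF absorbs_Jbar_Ee]) auto
    have "tmul (bv [Hh (i + (N - 1))]) t \<in> Jbar M N"
      using i_ge fins_t by (intro absorbsD[OF absorbs_Jbar_Hh]) auto
    then show "tmul (iota (bbr (Ff (N - 1)) (Ee i))) t \<in> Jbar M N"
      unfolding bbr_Ff_Ee iota_sc iota_bv tmul_sc by (rule vec.subspace_scale[OF subspace_Jbar])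
  qed
qed (rule extremal_product_mem[OF _ subspace_Jbar JW_Jbar absorbs_Jbar_Ff],
    simp_all add: rpairs_def)

lemma Ee_mult_Jbar: "x \<in> Jbar (M - 2) (N + 1) \<Longrightarrow> tmul (bv [Ee (M - 1)]) x \<in> Jbar M N"
proof (erule left_mult_Jbar[rotated 2])
  fix j and t :: "gen list \<Rightarrow> complex" assume j_ge: "N + 1 \<le> j" and fins_t: "fins t"
  show "tmul (bv [Ee (M - 1)]) (tmul (bv [Ff j]) t) \<in> Jbar M N"
  proof (rule commute_memI[OF fins_t LM_Jbar subspace_Jbar])
    show "tmul (bv [Ff j]) (tmul (bv [Ee (M - 1)]) t) \<in> Jbar M N"
      using j_ge fins_t by (intro absorbsD[OF absorbs_Jbar_Ff]) auto
    have "tmul (bv [Hh (M - 1 + j)]) t \<in> Jbar M N"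
      using j_ge fins_t by (intro absorbsD[OF absorbs_Jbar_Hh]) auto
    then show "tmul (iota (bbr (Ee (M - 1)) (Ff j))) t \<in> Jbar M N" by (simp add: bbr_Ee_Ff)
  qed
qed (rule extremal_product_mem[OF _ subspace_Jbar JW_Jbar absorbs_Jbar_Ee],
    simp_all add: rpairs_def)

definition codim_le :: "('a \<Rightarrow> complex) set \<Rightarrow> nat \<Rightarrow> bool" where
  "codim_le J n \<longleftrightarrow> (\<exists>B. finite B \<and> card B \<le> n \<and> (\<forall>b\<in>B. fins b)
    \<and> (\<forall>t. fins t \<longrightarrow> t \<in> vec.span (B \<union> J)))"

text \<open>Multiplication by \<open>g\<close> induces a surjection from the quotient by \<open>J2\<close> onto the kernel of the
  projection from the quotient by \<open>J\<close> to that by \<open>J1\<close>.\<close>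

lemma codim_le_add:
  assumes "codim_le J1 m" "codim_le J2 n"
    and kernel_J1: "J1 \<subseteq> vec.span ({tmul (bv [g]) t |t. fins t} \<union> J)"
    and image_J2: "\<And>t. t \<in> J2 \<Longrightarrow> tmul (bv [g]) t \<in> J"
  shows "codim_le J (m + n)"
proof -
  obtain B1 where B1_spans:
      "finite B1" "card B1 \<le> m" "\<And>b. b \<in> B1 \<Longrightarrow> fins b"
      "\<And>t. fins t \<Longrightarrow> t \<in> vec.span (B1 \<union> J1)"
    using assms(1) unfolding codim_le_def by blast
  obtain B2 where B2_spans:
      "finite B2" "card B2 \<le> n" "\<And>b. b \<in> B2 \<Longrightarrow> fins b"
      "\<And>t. fins t \<Longrightarrow> t \<in> vec.span (B2 \<union> J2)"
    using assms(2) unfolding codim_le_def by blast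
  let ?B = "B1 \<union> tmul (bv [g]) ` B2"
  have "tmul (bv [g]) t \<in> vec.span (?B \<union> J)" if "fins t" for t
    by (rule tmul_mem_if_span[OF B2_spans(4)[OF that]]) (auto intro: vec.span_base image_J2)
  then have "vec.span ({tmul (bv [g]) t |t. fins t} \<union> J) \<subseteq> vec.span (?B \<union> J)"
    by (intro vec.span_minimal) (auto intro: vec.span_base)
  then have "J1 \<subseteq> vec.span (?B \<union> J)" using kernel_J1 by (rule order_trans[rotated])
  then have "vec.span (B1 \<union> J1) \<subseteq> vec.span (?B \<union> J)"
    by (intro vec.span_minimal) (auto intro: vec.span_base)
  then have "\<forall>t. fins t \<longrightarrow> t \<in> vec.span (?B \<union> J)" using B1_spans(4) by blast
  moreover have "card ?B \<le> m + n"
    using card_Un_le[of B1 "tmul (bv [g]) ` B2"] card_image_le[OF B2_spans(1), of "tmul (bv [g])"]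
      B1_spans B2_spans
    by linarith
  ultimately show ?thesis unfolding codim_le_def using B1_spans B2_spans
    by (intro exI[of _ ?B]) auto
qed

lemma vacuum_spans_Jbar:
  assumes "M \<le> 1" "N \<le> 1" "M + N \<le> 1" "fins t"
  shows "t \<in> vec.span ({bv []} \<union> Jbar M N)"
proof (rule vacuum_spans[OF subspace_Jbar LM_Jbar _ assms(4)])
  show "absorbs (Jbar M N) g" if "0 < gidx g" for g
    using that assms by (cases g) (auto intro: absorbs_Jbar_Ee absorbs_Jbar_Ff absorbs_Jbar_Hh)
qed

lemma codim_le_Jbar_small: "M \<le> 1 \<Longrightarrow> N \<le> 1 \<Longrightarrow> M + N \<le> 1 \<Longrightarrow> codim_le (Jbar M N) 1"
  unfolding codim_le_def using vacuum_spans_Jbar by (intro exI[of _ "{bv []}"]) auto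

lemma JMN_minus_one: "JMN (-1) N = vec.span (Jbar (-1) N \<union> {bv []})"
  by (simp add: JMN_def lspan_eq_span)

lemma codim_le_JMN_small: "N \<le> 1 \<Longrightarrow> codim_le (JMN (-1) N) 0"
  unfolding codim_le_def using vacuum_spans_Jbar[of "-1" N]
  by (intro exI[of _ "{}"]) (auto simp: JMN_minus_one vec.span_span Un_commute)

lemma codim_le_Jbar_Ff:
  assumes "codim_le (Jbar M (N - 1)) m" "codim_le (Jbar (M + 1) (N - 2)) n"
  shows "codim_le (Jbar M N) (m + n)"
  using assms Jbar_Ff_step Ff_mult_Jbar by (rule codim_le_add)

lemma codim_le_JMN_Ff:
  assumes "codim_le (JMN (-1) (N - 1)) m" "codim_le (Jbar 0 (N - 2)) n"
  shows "codim_le (JMN (-1) N) (m + n)"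
proof (rule codim_le_add[OF assms])
  let ?Z = "vec.span ({tmul (bv [Ff (N - 1)]) t |t. fins t} \<union> JMN (-1) N)"
  have "Jbar (-1) (N - 1) \<subseteq> ?Z"
    using Jbar_Ff_step vec.span_mono[OF Un_mono[OF order_refl Jbar_JMN]] by (rule order_trans)
  moreover have "bv [] \<in> JMN (-1) N" by (simp add: JMN_minus_one vec.span_base)
  ultimately show "JMN (-1) (N - 1) \<subseteq> ?Z"
    unfolding JMN_minus_one[of "N - 1"] by (intro vec.span_minimal) (auto intro: vec.span_base)
qed (use Ff_mult_Jbar[of _ "-1" N] Jbar_JMN in auto)

lemma codim_le_Jbar_Ee:
  assumes "codim_le (Jbar 0 N) m" "codim_le (JMN (-1) (N + 1)) n"
  shows "codim_le (Jbar 1 N) (m + n)"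
proof (rule codim_le_add[OF assms])
  show "Jbar 0 N \<subseteq> vec.span ({tmul (bv [Ee 0]) t |t. fins t} \<union> Jbar 1 N)"
    using Jbar_Ee_step[of 1 N] by simp
  show "tmul (bv [Ee 0]) t \<in> Jbar 1 N" if "t \<in> JMN (-1) (N + 1)" for t
  proof (rule tmul_mem_if_span[OF that[unfolded JMN_minus_one] subspace_Jbar])
    have "bv [Ee 0] \<in> Jbar 1 N" using nonpos_LM[of "Ee 0"] LM_Jbar by auto
    then show "tmul (bv [Ee 0]) a \<in> Jbar 1 N" if "a \<in> Jbar (-1) (N + 1) \<union> {bv []}" for a
      using that Ee_mult_Jbar[of a 1 N] by auto
  qed
qed

lemma codim_le_power:
  "codim_le (Jbar 0 (int n + 1)) (2 ^ n) \<and> codim_le (Jbar 1 (int n)) (2 ^ n)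
    \<and> codim_le (JMN (-1) (int n + 2)) (2 ^ n)"
proof (induct n)
  case 0
  have small: "codim_le (Jbar M N) (Suc 0)" if "M \<le> 1" "N \<le> 1" "M + N \<le> 1" for M N
    using codim_le_Jbar_small[OF that] by simp
  have "codim_le (JMN (-1) 2) (0 + Suc 0)"
    by (rule codim_le_JMN_Ff) (simp_all add: codim_le_JMN_small small)
  then show ?case by (simp add: small)
next
  case (Suc n)
  have predecessors: "int n + 2 - 1 = int n + 1" "int n + 2 - 2 = int n" "int n + 3 - 1 = int n + 2"
    "int n + 3 - 2 = int n + 1" "int n + 1 + 1 = int n + 2" by simp_all
  have "codim_le (Jbar 0 (int n + 2)) (2 ^ n + 2 ^ n)"
    by (rule codim_le_Jbar_Ff) (use Suc in \<open>simp_all add: predecessors\<close>)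
  moreover have "codim_le (Jbar 1 (int n + 1)) (2 ^ n + 2 ^ n)"
    by (rule codim_le_Jbar_Ee) (use Suc in \<open>simp_all add: predecessors\<close>)
  moreover have "codim_le (JMN (-1) (int n + 3)) (2 ^ n + 2 ^ n)"
    by (rule codim_le_JMN_Ff) (use Suc in \<open>simp_all add: predecessors\<close>)
  ultimately show ?case by (simp add: add.commute mult_2)
qed

lemma codim_le_JMN:
  assumes "M \<in> {-1, 0, 1}" "M + N \<ge> 1"
  shows "codim_le (JMN M N) (2 ^ nat (M + N - 1))"
proof -
  define n where "n = nat (M + N - 1)"
  then have "N = int n + 1 - M" using assms(2) by simp
  then show ?thesis
    using assms(1) codim_le_power[of n] by (auto simp: n_def[symmetric] JMN_def add.commute)
qed

section \<open>Bases modulo a subspace\<close>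

lemma indep_mod_insertD:
  assumes "indep_mod J f (insert s S)" "s \<notin> S" "vec.subspace J"
  shows "f s \<notin> J" and "indep_mod (vec.span (insert (f s) J)) f S"
proof -
  have indep: "\<forall>x\<in>T. c x = 0"
    if "T \<subseteq> insert s S" "finite T" "(\<Sum>x\<in>T. sc (c x) (f x)) \<in> J" for c T
    using assms(1) that unfolding indep_mod_def by blast
  show "f s \<notin> J"
    using indep[of "{s}" "\<lambda>_. 1"] by auto
  show "indep_mod (vec.span (insert (f s) J)) f S"
    unfolding indep_mod_def
  proof (intro allI impI, elim conjE)
    fix c T assume T_subset: "T \<subseteq> S" "finite T"
      and "(\<Sum>x\<in>T. sc (c x) (f x)) \<in> vec.span (insert (f s) J)"
    then obtain k where scaled_diff: "(\<Sum>x\<in>T. sc (c x) (f x)) - sc k (f s) \<in> J"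
      using vec.span_breakdown_eq[of _ "f s" J] vec.span_minimal[OF order_refl assms(3)] by auto
    have "s \<notin> T" using T_subset(1) assms(2) by blast
    then have "(\<Sum>x\<in>insert s T. sc ((c(s := - k)) x) (f x)) = (\<Sum>x\<in>T. sc (c x) (f x)) - sc k (f s)"
      using T_subset(2) by (simp add: sum.insert cong: sum.cong) (auto intro!: sum.cong)
    then have "\<forall>x\<in>insert s T. (c(s := - k)) x = 0" using T_subset scaled_diff by (intro indep) auto
    then show "\<forall>x\<in>T. c x = 0" using \<open>s \<notin> T\<close> by (metis fun_upd_other insertCI)
  qed
qed

lemma exchange_element:
  assumes "finite B" "x \<in> vec.span (B \<union> J)" "x \<notin> vec.span J"
  shows "\<exists>b\<in>B. b \<in> vec.span (insert x (B - {b} \<union> J))"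
  using assms(1,2)
proof (induct B rule: finite_induct)
  case empty
  then show ?case using assms(3) by simp
next
  case (insert b B)
  show ?case
  proof (cases "x \<in> vec.span (B \<union> J)")
    case True
    then obtain b' where b'_exchange: "b' \<in> B" "b' \<in> vec.span (insert x (B - {b'} \<union> J))"
      using insert.hyps(3) by blast
    have "vec.span (insert x (B - {b'} \<union> J)) \<subseteq> vec.span (insert x (insert b B - {b'} \<union> J))"
      by (rule vec.span_mono) blast
    then show ?thesis using b'_exchange by blast
  next
    case False
    then have "b \<in> vec.span (insert x (B \<union> J))"
      using vec.in_span_insert[of x b "B \<union> J"] insert.prems by simp
    then show ?thesis using insert.hyps(2) by simp
  qed
qed

lemma steinitz_mod:
  assumes "finite S" "finite B" "vec.subspace J" "indep_mod J f S" "f ` S \<subseteq> vec.span (B \<union> J)"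
  shows "card S \<le> card B \<and> (card B \<le> card S \<longrightarrow> vec.span (B \<union> J) \<subseteq> vec.span (f ` S \<union> J))"
  using assms
proof (induct S arbitrary: B J rule: finite_induct)
  case empty
  then show ?case by simp
next
  case (insert s S)
  let ?J = "vec.span (insert (f s) J)"
  have s_not_span: "f s \<notin> vec.span J" and indep_S: "indep_mod ?J f S"
    using indep_mod_insertD[OF insert.prems(3) insert.hyps(2) insert.prems(2)]
      vec.span_minimal[OF order_refl insert.prems(2)] by blast+
  then obtain b where b_exchange: "b \<in> B" "b \<in> vec.span (insert (f s) (B - {b} \<union> J))"
    using exchange_element[OF insert.prems(1) _ s_not_span] insert.prems(4) by auto
  have J_subset: "insert (f s) J \<subseteq> ?J" by (rule vec.span_superset)
  have "vec.span (insert (f s) (B - {b} \<union> J)) \<subseteq> vec.span ((B - {b}) \<union> ?J)"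
    by (rule vec.span_mono) (use J_subset in auto)
  then have "b \<in> vec.span ((B - {b}) \<union> ?J)" using b_exchange(2) by blast
  moreover have "B - {b} \<union> J \<subseteq> vec.span ((B - {b}) \<union> ?J)"
    using J_subset by (auto intro: vec.span_base)
  ultimately have "B \<union> J \<subseteq> vec.span ((B - {b}) \<union> ?J)" by blast
  then have span_exchange: "vec.span (B \<union> J) \<subseteq> vec.span ((B - {b}) \<union> ?J)"
    by (simp add: vec.span_minimal)
  have "insert (f s) J \<subseteq> vec.span (f ` insert s S \<union> J)" by (auto intro: vec.span_base)
  then have "?J \<subseteq> vec.span (f ` insert s S \<union> J)" by (simp add: vec.span_minimal)
  then have "f ` S \<union> ?J \<subseteq> vec.span (f ` insert s S \<union> J)" by (auto intro: vec.span_base)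
  then have span_image: "vec.span (f ` S \<union> ?J) \<subseteq> vec.span (f ` insert s S \<union> J)"
    by (simp add: vec.span_minimal)
  have "f ` S \<subseteq> vec.span ((B - {b}) \<union> ?J)" using insert.prems(4) span_exchange by auto
  then have "card S \<le> card (B - {b}) \<and> (card (B - {b}) \<le> card S \<longrightarrow>
      vec.span ((B - {b}) \<union> ?J) \<subseteq> vec.span (f ` S \<union> ?J))"
    using insert.prems(1) indep_S by (intro insert.hyps(3)) auto
  moreover have "card B = Suc (card (B - {b}))"
    using b_exchange(1) insert.prems(1) by (rule card.remove[rotated])
  moreover have "card (insert s S) = Suc (card S)" using insert.hyps by simp
  ultimately show ?case using span_exchange span_image by auto
qed

lemma span_mod_coeffs:
  assumes "finite C" "vec.subspace J" "t \<in> vec.span (f ` C \<union> J)"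
  shows "\<exists>c. t - (\<Sum>s\<in>C. sc (c s) (f s)) \<in> J"
proof -
  obtain u v where decomposition: "t = u + v" "u \<in> vec.span (f ` C)" "v \<in> vec.span J"
    using assms(3) by (auto simp: vec.span_Un)
  have "\<exists>c. u = (\<Sum>s\<in>C. sc (c s) (f s))"
    using assms(1) decomposition(2)
  proof (induct C arbitrary: u rule: finite_induct)
    case (insert s C)
    then obtain k where "u - sc k (f s) \<in> vec.span (f ` C)" by (auto simp: vec.span_breakdown_eq)
    then obtain c where coeffs: "u - sc k (f s) = (\<Sum>s\<in>C. sc (c s) (f s))"
      using insert.hyps(3) by blast
    have "(\<Sum>x\<in>C. sc ((c(s := k)) x) (f x)) = (\<Sum>x\<in>C. sc (c x) (f x))"
      using insert.hyps(2) by (intro sum.cong) auto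
    then have "u = (\<Sum>x\<in>insert s C. sc ((c(s := k)) x) (f x))"
      using insert.hyps(1,2) coeffs by (simp add: algebra_simps del: fun_upd_apply) simp
    then show ?case by blast
  qed simp
  then obtain c where "u = (\<Sum>s\<in>C. sc (c s) (f s))" by blast
  moreover have "v \<in> J" using decomposition(3) vec.span_minimal[OF order_refl assms(2)] by blast
  ultimately show ?thesis using decomposition(1) by (intro exI[of _ c]) simp
qed

lemma basis_mod_criterion:
  assumes J_codim: "vec.subspace J" "codim_le J n" and card_C: "finite C" "n \<le> card C"
    and fins_f: "\<And>s. fins (f s)" and indep: "indep_mod J f C"
  shows "spans_mod J f C" and "qdim J = n"
proof -
  have card_le: "card C \<le> card B \<and> (card B \<le> card C \<longrightarrow> vec.span (B \<union> J) \<subseteq> vec.span (f ` C \<union> J))"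
    if "finite B" "\<And>t. fins t \<Longrightarrow> t \<in> vec.span (B \<union> J)" for B
    using that fins_f by (intro steinitz_mod[OF card_C(1) _ J_codim(1) indep]) auto
  obtain B where B_spans: "finite B" "card B \<le> n" "\<forall>b\<in>B. fins b" "\<And>t. fins t \<Longrightarrow> t \<in> vec.span (B \<union> J)"
    using J_codim(2) unfolding codim_le_def by blast
  have card_B: "card B = n" and "card C = n"
    using card_le[OF B_spans(1,4)] B_spans(2) card_C(2) by auto
  then have "t \<in> vec.span (f ` C \<union> J)" if "fins t" for t
    using card_le[OF B_spans(1,4)] B_spans(4)[OF that] by auto
  then have "\<exists>c. t - (\<Sum>s\<in>C. sc (c s) (f s)) \<in> J" if "fins t" for t
    using that span_mod_coeffs[OF card_C(1) J_codim(1)] by simp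
  then show "spans_mod J f C"
    unfolding spans_mod_def using card_C(1) by (intro allI impI exI[of _ C]) simp
  show "qdim J = n"
    unfolding qdim_def
  proof (rule Least_equality)
    show "\<exists>B. finite B \<and> card B = n \<and> (\<forall>b\<in>B. fins b) \<and> (\<forall>t. fins t \<longrightarrow> t \<in> lspan (B \<union> J))"
      using B_spans card_B by (intro exI[of _ B]) (simp add: lspan_eq_span)
  next
    fix k assume "\<exists>B. finite B \<and> card B = k \<and> (\<forall>b\<in>B. fins b) \<and> (\<forall>t. fins t \<longrightarrow> t \<in> lspan (B \<union> J))"
    then show "n \<le> k" using card_le \<open>card C = n\<close> by (auto simp: lspan_eq_span)
  qed
qed

section \<open>Counting configurations\<close>

type_synonym config = "(int \<Rightarrow> nat) \<times> (int \<Rightarrow> nat)"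

lemma triangleD:
  assumes "triangle a b" shows "b (i + 1) + a (i + 1) + a i \<le> 1" "b (i + 1) + b i + a i \<le> 1"
  using assms by (auto simp: triangle_def)

lemma triangle_site: "triangle a b \<Longrightarrow> a i + b i \<le> 1"
  using triangleD(1)[of a b "i - 1"] by simp

lemma triangle_shift: "triangle a b \<Longrightarrow> triangle (\<lambda>i. a (i + d)) (\<lambda>i. b (i + d))"
  unfolding triangle_def by (metis add.assoc add.commute)

lemma rightnb_shift:
  assumes "rightnb a b" shows "rightnb (\<lambda>i. a (i + d)) (\<lambda>i. b (i + d))"
  unfolding rightnb_def
proof (intro allI impI)
  fix i assume "b (i + d) \<noteq> 0"
  then obtain j where "j > i + d" "a j \<noteq> 0" "\<forall>s. i + d + 1 \<le> s \<and> s \<le> j \<longrightarrow> b s = 0"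
    using assms unfolding rightnb_def by blast
  then show "\<exists>j>i. a (j + d) \<noteq> 0 \<and> (\<forall>s. i + 1 \<le> s \<and> s \<le> j \<longrightarrow> b (s + d) = 0)"
    by (intro exI[of _ "j - d"]) auto
qed

definition starts_with_a :: "(int \<Rightarrow> nat) \<Rightarrow> (int \<Rightarrow> nat) \<Rightarrow> bool" where
  "starts_with_a a b \<longleftrightarrow> (\<exists>j. a j \<noteq> 0 \<and> (\<forall>i\<le>j. b i = 0))"

lemma starts_with_a_shift: "starts_with_a a b \<Longrightarrow> starts_with_a (\<lambda>i. a (i + d)) (\<lambda>i. b (i + d))"
  unfolding starts_with_a_def by (metis diff_add_cancel le_diff_eq)

definition configs :: "int \<Rightarrow> config set" where
  "configs L = {(a, b). (\<forall>i. a i \<le> 1 \<and> b i \<le> 1) \<and> (\<forall>i. i < 1 \<or> L < i \<longrightarrow> a i = 0 \<and> b i = 0)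
     \<and> triangle a b \<and> rightnb a b}"

definition a_configs :: "int \<Rightarrow> config set" where
  "a_configs L = {(a, b) \<in> configs L. starts_with_a a b}"

lemma C0_eq_configs: "C0 N = configs (N - 1)"
proof -
  have "i < 1 \<longleftrightarrow> i < 0 \<or> i = 0" for i :: int by auto
  then show ?thesis unfolding C0_def configs_def by (intro Collect_cong) auto
qed

lemma finite_binary_sequences:
  fixes l u :: int
  shows "finite {a :: int \<Rightarrow> nat. (\<forall>i. a i \<le> 1) \<and> (\<forall>i. i < l \<or> u < i \<longrightarrow> a i = 0)}"
proof (rule finite_subset)
  show "finite {a :: int \<Rightarrow> nat. \<forall>i. (i \<in> {l..u} \<longrightarrow> a i \<in> {..1}) \<and> (i \<notin> {l..u} \<longrightarrow> a i = 0)}"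
    by (rule finite_set_of_finite_funs) auto
qed auto

lemma finite_configs: "finite (configs L)"
proof (rule finite_subset)
  let ?S = "{a :: int \<Rightarrow> nat. (\<forall>i. a i \<le> 1) \<and> (\<forall>i. i < 1 \<or> L < i \<longrightarrow> a i = 0)}"
  show "configs L \<subseteq> ?S \<times> ?S" by (auto simp: configs_def)
  show "finite (?S \<times> ?S)" by (intro finite_cartesian_product finite_binary_sequences)
qed

lemma finite_a_configs: "finite (a_configs L)"
  by (rule finite_subset[OF _ finite_configs[of L]]) (auto simp: a_configs_def)

lemma finite_C1: "finite (C1 N)"
proof (rule finite_subset)
  let ?S = "{a :: int \<Rightarrow> nat. (\<forall>i. a i \<le> 1) \<and> (\<forall>i. i < 0 \<or> N < i \<longrightarrow> a i = 0)}"
  show "C1 N \<subseteq> ?S \<times> ?S" by (auto simp: C1_def)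
  show "finite (?S \<times> ?S)" by (intro finite_cartesian_product finite_binary_sequences)
qed

lemma finite_Cset: "finite (Cset M N)"
  by (simp add: Cset_def C0_eq_configs finite_configs finite_C1)

definition shift_config :: "int \<Rightarrow> config \<Rightarrow> config" where
  "shift_config d = (\<lambda>(a, b). ((\<lambda>i. a (i + d)), (\<lambda>i. b (i + d))))"

lemma inj_shift_config: "inj (shift_config d)"
proof (rule injI)
  fix x y :: config assume shift_eq: "shift_config d x = shift_config d y"
  obtain a b a' b' where xy_eq: "x = (a, b)" "y = (a', b')" by (cases x, cases y)
  have "a (i - d + d) = a' (i - d + d)" "b (i - d + d) = b' (i - d + d)" for i
    using shift_eq by (auto simp: shift_config_def xy_eq dest: fun_cong[of _ _ "i - d"])
  then show "x = y" by (auto simp: xy_eq)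
qed

lemma shift_config_configs: "0 \<le> d \<Longrightarrow> x \<in> configs L \<Longrightarrow> shift_config (- d) x \<in> configs (L + d)"
  using triangle_shift[of _ _ "- d"] rightnb_shift[of _ _ "- d"]
  by (auto simp: configs_def shift_config_def)

lemma shift_config_a_configs: "0 \<le> d \<Longrightarrow> x \<in> a_configs L \<Longrightarrow> shift_config (- d) x \<in> a_configs (L + d)"
  using shift_config_configs[of d x L] starts_with_a_shift[of _ _ "- d"]
  by (auto simp: a_configs_def shift_config_def)

lemma starts_with_a_configs:
  assumes "(a, b) \<in> a_configs L"
  obtains j where "1 \<le> j" "j \<le> L" "a j \<noteq> 0" "\<forall>i\<le>j. b i = 0"
proof -
  obtain j where "a j \<noteq> 0" "\<forall>i\<le>j. b i = 0"
    using assms by (auto simp: a_configs_def starts_with_a_def)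
  moreover have "\<not> (j < 1 \<or> L < j)" using assms \<open>a j \<noteq> 0\<close> by (auto simp: a_configs_def configs_def)
  ultimately show thesis using that[of j] by simp
qed

definition fill_first_site :: "config \<Rightarrow> config" where
  "fill_first_site = (\<lambda>(a, b). if a 1 = 0 then (a, b(1 := 1)) else (a, b))"

lemma rightnb_fill_first_site:
  assumes "rightnb a b" "2 \<le> j" "a j \<noteq> 0" "\<forall>i\<le>j. b i = 0"
  shows "rightnb a (b(1 := 1))"
  unfolding rightnb_def
proof (intro allI impI)
  fix i assume b_i: "(b(1 := 1)) i \<noteq> 0"
  show "\<exists>k>i. a k \<noteq> 0 \<and> (\<forall>s. i + 1 \<le> s \<and> s \<le> k \<longrightarrow> (b(1 := 1)) s = 0)"
  proof (cases "i = 1")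
    case True
    then show ?thesis using assms(2-4) by (intro exI[of _ j]) auto
  next
    case False
    then have "b i \<noteq> 0" using b_i by simp
    then have "\<not> i \<le> j" using assms(4) by auto
    then have "1 < i" using assms(2) by simp
    obtain k where "k > i" "a k \<noteq> 0" "\<forall>s. i + 1 \<le> s \<and> s \<le> k \<longrightarrow> b s = 0"
      using assms(1) \<open>b i \<noteq> 0\<close> unfolding rightnb_def by blast
    then show ?thesis using \<open>1 < i\<close> by (intro exI[of _ k]) auto
  qed
qed

lemma fill_first_site_configs:
  assumes "x \<in> a_configs L" shows "fill_first_site x \<in> configs L"
proof -
  obtain a b where x_eq: "x = (a, b)" by (cases x)
  obtain j where first_a: "1 \<le> j" "j \<le> L" "a j \<noteq> 0" "\<forall>i\<le>j. b i = 0"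
    using starts_with_a_configs assms x_eq by blast
  have config: "\<forall>i. a i \<le> 1 \<and> b i \<le> 1" "\<forall>i. i < 1 \<or> L < i \<longrightarrow> a i = 0 \<and> b i = 0" "triangle a b"
    "rightnb a b"
    using assms by (auto simp: x_eq a_configs_def configs_def)
  show ?thesis
  proof (cases "a 1 = 0")
    case True
    then have j_ge: "2 \<le> j" using first_a by (cases "j = 1") auto
    have "triangle a (b(1 := 1))"
      unfolding triangle_def
    proof
      fix i
      show "(b(1 := 1)) (i + 1) + a (i + 1) + a i \<le> 1
        \<and> (b(1 := 1)) (i + 1) + (b(1 := 1)) i + a i \<le> 1"
        using triangleD[OF config(3), of i] True first_a(4)[rule_format, of 2] j_ge
          config(2)[rule_format, of 0]
        by auto
    qed
    moreover have "rightnb a (b(1 := 1))"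
      using config(4) j_ge first_a(3,4) by (rule rightnb_fill_first_site)
    ultimately show ?thesis
      using True config(1,2) first_a by (auto simp: x_eq fill_first_site_def configs_def)
  qed (use assms in \<open>simp add: x_eq fill_first_site_def a_configs_def\<close>)
qed

lemma inj_on_fill_first_site: "inj_on fill_first_site (a_configs L)"
proof (rule inj_onI)
  fix x y
  assume xy_a_configs: "x \<in> a_configs L" "y \<in> a_configs L" "fill_first_site x = fill_first_site y"
  obtain a b a' b' where x_eq: "x = (a, b)" and y_eq: "y = (a', b')" by (cases x, cases y)
  have "b 1 = 0" "b' 1 = 0"
    using xy_a_configs(1,2) starts_with_a_configs unfolding x_eq y_eq by metis+
  then have "b = b'" if "b(1 := 1) = b'(1 := 1)" using that by (metis fun_upd_triv fun_upd_upd)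
  then show "x = y"
    using xy_a_configs(3) by (auto simp: x_eq y_eq fill_first_site_def split: if_splits)
qed

definition prepend_a :: "config \<Rightarrow> config" where
  "prepend_a x = (case shift_config (-2) x of (a, b) \<Rightarrow> (a(1 := 1), b))"

lemma prepend_a_a_configs:
  assumes "x \<in> configs L" "0 \<le> L" shows "prepend_a x \<in> a_configs (L + 2)"
proof -
  obtain a b where shift_eq: "shift_config (-2) x = (a, b)" by fastforce
  have "(a, b) \<in> configs (L + 2)" using shift_config_configs[of 2 x L] assms(1) shift_eq by simp
  then have config: "\<forall>i. a i \<le> 1 \<and> b i \<le> 1" "\<forall>i. i < 1 \<or> L + 2 < i \<longrightarrow> a i = 0 \<and> b i = 0"
    "triangle a b" "rightnb a b" by (auto simp: configs_def)
  have low_sites: "a i = 0" "b i = 0" if "i \<le> 2" for i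
    using that assms(1) shift_eq by (auto simp: shift_config_def configs_def)
  have "triangle (a(1 := 1)) b"
    unfolding triangle_def
  proof
    fix i
    show "b (i + 1) + (a(1 := 1)) (i + 1) + (a(1 := 1)) i \<le> 1 \<and> b (i + 1) + b i + (a(1 := 1)) i \<le> 1"
      using triangleD[OF config(3), of i] low_sites[of 0] low_sites[of 1] low_sites[of 2] by auto
  qed
  moreover have "rightnb (a(1 := 1)) b"
    using config(4) unfolding rightnb_def by (metis fun_upd_apply zero_neq_one)
  moreover have "starts_with_a (a(1 := 1)) b"
    unfolding starts_with_a_def using low_sites by (intro exI[of _ 1]) simp
  ultimately show ?thesis
    using config(1,2) assms(2) by (auto simp: prepend_a_def shift_eq a_configs_def configs_def)
qed

lemma inj_on_prepend_a: "inj_on prepend_a (configs L)"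
proof (rule inj_onI)
  fix x y assume xy_configs: "x \<in> configs L" "y \<in> configs L" "prepend_a x = prepend_a y"
  obtain a b a' b' where shift_eq: "shift_config (-2) x = (a, b)" "shift_config (-2) y = (a', b')"
    by fastforce
  have "a 1 = 0" "a' 1 = 0"
    using xy_configs(1,2) shift_eq by (auto simp: shift_config_def configs_def)
  moreover have "a(1 := 1) = a'(1 := 1)" "b = b'"
    using xy_configs(3) by (auto simp: prepend_a_def shift_eq)
  ultimately have "shift_config (-2) x = shift_config (-2) y"
    unfolding shift_eq by (metis fun_upd_triv fun_upd_upd)
  then show "x = y" using inj_shift_config by (auto dest: injD)
qed

lemma card_add_le_disjoint_images:
  assumes "inj_on f A" "inj_on g B" "f ` A \<subseteq> C" "g ` B \<subseteq> C" "f ` A \<inter> g ` B = {}" "finite C"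
  shows "card A + card B \<le> card C"
proof -
  have "card A + card B = card (f ` A \<union> g ` B)"
    using assms by (simp add: card_Un_disjoint finite_subset card_image)
  also have "\<dots> \<le> card C" using assms by (intro card_mono) auto
  finally show ?thesis .
qed

lemma first_site_shift_config:
  assumes "x \<in> configs L" "shift_config (-1) x = (a, b)" shows "a 1 = 0 \<and> b 1 = 0"
  using assms by (auto simp: shift_config_def configs_def)

lemma card_configs_Suc: "card (configs L) + card (a_configs (L + 1)) \<le> card (configs (L + 1))"
proof (rule card_add_le_disjoint_images
    [OF inj_on_subset[OF inj_shift_config] inj_on_fill_first_site])
  show "shift_config (-1) ` configs L \<inter> fill_first_site ` a_configs (L + 1) = {}"
  proof (rule equals0I)
    fix y assume "y \<in> shift_config (-1) ` configs L \<inter> fill_first_site ` a_configs (L + 1)"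
    then obtain x z where y_images:
        "x \<in> configs L" "y = shift_config (-1) x" "y = fill_first_site z"
      by blast
    obtain a b where "y = (a, b)" by (cases y)
    then show False
      using first_site_shift_config[OF y_images(1), of a b] y_images(2,3)
      by (cases z) (auto simp: fill_first_site_def split: if_splits)
  qed
qed (use shift_config_configs[of 1] fill_first_site_configs finite_configs in auto)

lemma card_a_configs_Suc:
  assumes "0 \<le> L" shows "card (a_configs (L + 1)) + card (configs L) \<le> card (a_configs (L + 2))"
proof (rule card_add_le_disjoint_images[OF inj_on_subset[OF inj_shift_config] inj_on_prepend_a])
  show "shift_config (-1) ` a_configs (L + 1) \<inter> prepend_a ` configs L = {}"
  proof (rule equals0I)
    fix y assume "y \<in> shift_config (-1) ` a_configs (L + 1) \<inter> prepend_a ` configs L"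
    then obtain x z where y_images:
        "x \<in> configs (L + 1)" "y = shift_config (-1) x" "y = prepend_a z"
      by (auto simp: a_configs_def)
    obtain a b where "y = (a, b)" by (cases y)
    then show False
      using first_site_shift_config[OF y_images(1), of a b] y_images(2,3)
      by (auto simp: prepend_a_def split: prod.splits)
  qed
  show "shift_config (-1) ` a_configs (L + 1) \<subseteq> a_configs (L + 2)"
    using shift_config_a_configs[of 1 _ "L + 1"] by (auto simp: add.assoc)
qed (use assms prepend_a_a_configs finite_a_configs in auto)

lemma card_configs_ge: "2 ^ n \<le> card (configs (int n)) \<and> 2 ^ n \<le> card (a_configs (int n + 1))"
proof (induct n)
  case 0
  have "((\<lambda>_. 0), (\<lambda>_. 0)) \<in> configs 0" by (auto simp: configs_def triangle_def rightnb_def)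
  moreover have "((\<lambda>_. 0)(1 := 1), (\<lambda>_. 0)) \<in> a_configs 1"
    by (auto simp: a_configs_def configs_def triangle_def rightnb_def starts_with_a_def)
  ultimately show ?case
    using finite_configs[of 0] finite_a_configs[of 1] by (auto simp: Suc_le_eq card_gt_0_iff)
next
  case (Suc n)
  then show ?case
    using card_configs_Suc[of "int n"] card_a_configs_Suc[of "int n"] by (simp add: add.commute)
qed

lemma card_C1_ge: "2 ^ n \<le> card (C1 (int n))"
proof -
  have "shift_config 1 ` a_configs (int n + 1) \<subseteq> C1 (int n)"
  proof (rule image_subsetI)
    fix x :: config assume "x \<in> a_configs (int n + 1)"
    then obtain a b where x_eq: "x = (a, b)" and ab_a_configs: "(a, b) \<in> a_configs (int n + 1)"
      by (cases x) auto
    then obtain j where "1 \<le> j" "j \<le> int n + 1" "a j \<noteq> 0" and b_zero: "\<forall>i\<le>j. b i = 0"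
      using starts_with_a_configs by blast
    have "b (i + 1) = 0" if "i < 1 \<or> int n < i" for i
      using that b_zero \<open>1 \<le> j\<close> ab_a_configs
      by (cases "i < 1") (auto simp: a_configs_def configs_def)
    then show "shift_config 1 x \<in> C1 (int n)"
      unfolding x_eq
      using ab_a_configs triangle_shift[of a b 1] rightnb_shift[of a b 1]
        starts_with_a_shift[of a b 1]
      by (auto simp: shift_config_def C1_def a_configs_def configs_def starts_with_a_def)
  qed
  then have "card (a_configs (int n + 1)) \<le> card (C1 (int n))"
    using card_mono[OF finite_C1] card_image[OF inj_on_subset[OF inj_shift_config]]
    by (metis subset_UNIV)
  then show ?thesis using card_configs_ge[of n] by simp
qed

lemma card_Cset_ge:
  assumes "M \<in> {-1, 0, 1}" "M + N \<ge> 1" shows "2 ^ nat (M + N - 1) \<le> card (Cset M N)"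
proof -
  define n where "n = nat (M + N - 1)"
  then have "N = int n + 1 - M" using assms(2) by simp
  then show ?thesis
    using assms(1) card_configs_ge[of n] card_C1_ge[of n]
    by (auto simp: Cset_def C0_eq_configs n_def[symmetric])
qed

section \<open>Free fermions\<close>

type_synonym fock = "int set \<Rightarrow> complex"

text \<open>A state of the infinite wedge is the set of its occupied sites. The sign vanishes on sets
  unbounded above, so that distinct modes anticommute without side conditions.\<close>

definition wedge_sign :: "int \<Rightarrow> int set \<Rightarrow> complex" where
  "wedge_sign a S = (if bdd_above S then (-1) ^ card {x \<in> S. a < x} else 0)"

definition create :: "int \<Rightarrow> fock \<Rightarrow> fock" where
  "create a F S = (if a \<in> S then wedge_sign a S * F (S - {a}) else 0)"

definition annihilate :: "int \<Rightarrow> fock \<Rightarrow> fock" where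
  "annihilate a F S = (if a \<notin> S then wedge_sign a S * F (insert a S) else 0)"

lemma bdd_above_remove [simp]: "bdd_above (S - {b}) \<longleftrightarrow> bdd_above S" for b :: int
  by (metis bdd_above_insert insert_Diff_single)

lemma finite_above: "bdd_above S \<Longrightarrow> finite {x \<in> S. a < x}" for a :: int
proof -
  assume "bdd_above S"
  then obtain U where "\<And>x. x \<in> S \<Longrightarrow> x \<le> U" by (auto simp: bdd_above_def)
  then have "{x \<in> S. a < x} \<subseteq> {a..U}" by auto
  then show ?thesis by (rule finite_subset) simp
qed

lemma wedge_sign_insert:
  assumes "b \<notin> S"
  shows "wedge_sign a (insert b S) = (if a < b then - wedge_sign a S else wedge_sign a S)"
proof (cases "bdd_above S \<and> a < b")
  case True
  then have "{x \<in> insert b S. a < x} = insert b {x \<in> S. a < x}" by auto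
  then show ?thesis using True assms finite_above[of S a] by (simp add: wedge_sign_def)
next
  case False
  then have "bdd_above S \<Longrightarrow> {x \<in> insert b S. a < x} = {x \<in> S. a < x}" by auto
  then show ?thesis using False by (auto simp: wedge_sign_def)
qed

lemma wedge_sign_remove:
  "b \<in> S \<Longrightarrow> wedge_sign a (S - {b}) = (if a < b then - wedge_sign a S else wedge_sign a S)"
  using wedge_sign_insert[of b "S - {b}" a] by (simp add: insert_absorb split: if_splits)

lemma wedge_sign_square: "bdd_above S \<Longrightarrow> wedge_sign a S * wedge_sign a S = 1"
  by (simp add: wedge_sign_def flip: power_mult_distrib)

lemma wedge_sign_nonzero: "bdd_above S \<Longrightarrow> wedge_sign a S \<noteq> 0"
  by (simp add: wedge_sign_def)

lemma create_create: "create a (create b F) = - create b (create a F)"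
proof
  fix S
  have "S - {a} - {b} = S - {b} - {a}" by auto
  then show "create a (create b F) S = (- create b (create a F)) S"
    by (auto simp: create_def wedge_sign_remove)
qed

lemma annihilate_annihilate: "annihilate a (annihilate b F) = - annihilate b (annihilate a F)"
proof
  fix S
  have "insert a (insert b S) = insert b (insert a S)" by auto
  then show "annihilate a (annihilate b F) S = (- annihilate b (annihilate a F)) S"
    by (auto simp: annihilate_def wedge_sign_insert)
qed

lemma create_annihilate:
  assumes "a \<noteq> b" shows "create a (annihilate b F) = - annihilate b (create a F)"
proof
  fix S
  have "insert b (S - {a}) = insert b S - {a}" using assms by auto
  then show "create a (annihilate b F) S = (- annihilate b (create a F)) S"
    using assms by (auto simp: annihilate_def create_def wedge_sign_insert wedge_sign_remove)
qed

lemma annihilate_create_same: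
  assumes "bdd_above S" shows "annihilate b (create b F) S + create b (annihilate b F) S = F S"
  using assms wedge_sign_square[of S b]
  by (cases "b \<in> S")
    (simp_all add: create_def annihilate_def wedge_sign_insert wedge_sign_remove insert_absorb
      flip: mult.assoc)

lemma create_linear:
    "create a (F + G) = create a F + create a G" "create a (sc c F) = sc c (create a F)"
    "create a (- F) = - create a F"
  and annihilate_linear:
    "annihilate a (F + G) = annihilate a F + annihilate a G"
    "annihilate a (sc c F) = sc c (annihilate a F)"
    "annihilate a (- F) = - annihilate a F"
  by (auto simp: create_def annihilate_def fun_eq_iff sc_def pointwise algebra_simps)

definition hop :: "int \<Rightarrow> int \<Rightarrow> fock \<Rightarrow> fock" where
  "hop a b F = create a (annihilate b F)"

lemma hop_eval:
  "a \<noteq> b \<Longrightarrow> hop a b F S =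
    (if a \<in> S \<and> b \<notin> S then wedge_sign a S * wedge_sign b (S - {a}) * F (insert b (S - {a})) else 0)"
  by (auto simp: hop_def create_def annihilate_def)

lemma hop_linear: "hop a b (F + G) = hop a b F + hop a b G" "hop a b (sc c F) = sc c (hop a b F)"
  by (simp_all add: hop_def create_linear annihilate_linear)

lemma hop_hop_normal_ordered:
  assumes "a' \<noteq> b"
  shows "hop a b (hop a' b' F) = - create a (create a' (annihilate b (annihilate b' F)))"
  using create_annihilate[of a' b "annihilate b' F"] assms by (simp add: hop_def create_linear)

lemma hop_hop_exchange_create:
  assumes "a \<noteq> b" "a' \<noteq> b" shows "hop a b (hop a' b' F) = - hop a' b (hop a b' F)"
  using assms create_create[of a a'] by (simp add: hop_hop_normal_ordered)

lemma hop_hop_exchange_annihilate: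
  assumes "a' \<noteq> b" "a' \<noteq> b'" shows "hop a b (hop a' b' F) = - hop a b' (hop a' b F)"
  using assms annihilate_annihilate[of b b' F] by (simp add: hop_hop_normal_ordered create_linear)

lemma hop_commute:
  assumes "a \<noteq> b'" "b \<noteq> a'" shows "hop a b (hop a' b' F) = hop a' b' (hop a b F)"
proof -
  have "hop a b (hop a' b' F) = create a' (create a (annihilate b (annihilate b' F)))"
    using assms(2) create_create[of a a'] by (simp add: hop_hop_normal_ordered)
  also have "\<dots> = - create a' (create a (annihilate b' (annihilate b F)))"
    using annihilate_annihilate[of b b' F] by (simp add: create_linear)
  also have "\<dots> = hop a' b' (hop a b F)" using assms(1) by (simp add: hop_hop_normal_ordered)
  finally show ?thesis .
qed

lemma hop_contract:
  assumes "a \<noteq> d"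
  shows "hop a b (hop b d F) - hop b d (hop a b F) = hop a d F"
proof
  fix S
  have "hop b d (hop a b F) = create a (create b (annihilate d (annihilate b F)))"
    using assms create_create[of b a] by (simp add: hop_hop_normal_ordered)
  also have "\<dots> = - create a (create b (annihilate b (annihilate d F)))"
    using annihilate_annihilate[of d b F] by (simp add: create_linear)
  finally have hop_swapped:
    "hop b d (hop a b F) = - create a (create b (annihilate b (annihilate d F)))" .
  have "create a (annihilate b (create b (annihilate d F))
      + create b (annihilate b (annihilate d F))) S = create a (annihilate d F) S"
  proof (cases "bdd_above S")
    case True
    then show ?thesis unfolding create_def[of a] by (simp add: pointwise annihilate_create_same)
  qed (simp add: create_def wedge_sign_def)
  then show "(hop a b (hop b d F) - hop b d (hop a b F)) S = hop a d F S"
    unfolding hop_swapped by (simp add: hop_def create_linear pointwise)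
qed

datatype colour = Red | Green | Blue

fun site :: "colour \<Rightarrow> int \<Rightarrow> int" where
  "site Red k = 3 * k + 1"
| "site Green k = 3 * k + 2"
| "site Blue k = 3 * k + 3"

declare site.simps [simp del]

lemma site_eq_iff [simp]: "site c k = site d l \<longleftrightarrow> c = d \<and> k = l"
  by (cases c; cases d; simp add: site.simps; presburger)

lemma site_surj: obtains c k where "x = site c k"
proof -
  have "x = 3 * ((x - 1) div 3) + 1 \<or> x = 3 * ((x - 1) div 3) + 2 \<or> x = 3 * ((x - 1) div 3) + 3"
    by presburger
  then show thesis using that[of Red] that[of Green] that[of Blue] by (force simp: site.simps)
qed

lemma set_eq_by_sites: "(\<And>c k. site c k \<in> A \<longleftrightarrow> site c k \<in> B) \<Longrightarrow> A = B"
  by (metis site_surj set_eqI)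

definition semi_infinite :: "int set \<Rightarrow> bool" where
  "semi_infinite S \<longleftrightarrow> (\<exists>n. \<forall>c k. (k < - n \<longrightarrow> site c k \<in> S) \<and> (n < k \<longrightarrow> site c k \<notin> S))"

lemma semi_infinite_bdd_above:
  assumes "semi_infinite S" shows "bdd_above S"
proof -
  obtain n where empty_above: "\<And>c k. n < k \<Longrightarrow> site c k \<notin> S"
    using assms by (auto simp: semi_infinite_def)
  have "x \<le> 3 * n + 3" if "x \<in> S" for x
  proof -
    obtain c k where x_eq: "x = site c k" by (rule site_surj)
    then have "k \<le> n" using that empty_above by force
    then show ?thesis unfolding x_eq by (cases c) (auto simp: site.simps)
  qed
  then show ?thesis by (auto simp: bdd_above_def)
qed

lemma semi_infinite_insert:
  assumes "semi_infinite S" shows "semi_infinite (insert (site c k) S)"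
proof -
  obtain n where "\<And>c k. k < - n \<Longrightarrow> site c k \<in> S" "\<And>c k. n < k \<Longrightarrow> site c k \<notin> S"
    using assms by (auto simp: semi_infinite_def)
  then show ?thesis unfolding semi_infinite_def by (intro exI[of _ "max n \<bar>k\<bar>"]) auto
qed

lemma semi_infinite_remove:
  assumes "semi_infinite S" shows "semi_infinite (S - {site c k})"
proof -
  obtain n where "\<And>c k. k < - n \<Longrightarrow> site c k \<in> S" "\<And>c k. n < k \<Longrightarrow> site c k \<notin> S"
    using assms by (auto simp: semi_infinite_def)
  then show ?thesis unfolding semi_infinite_def by (intro exI[of _ "max n \<bar>k\<bar>"]) auto
qed

definition hop_modes :: "colour \<Rightarrow> colour \<Rightarrow> int \<Rightarrow> int set \<Rightarrow> int set" where
  "hop_modes c d i S = {k. semi_infinite S \<and> site c (k + i) \<in> S \<and> site d k \<notin> S}"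

lemma finite_hop_modes: "finite (hop_modes c d i S)"
proof (cases "semi_infinite S")
  case True
  then obtain n where "\<And>c k. k < - n \<Longrightarrow> site c k \<in> S" "\<And>c k. n < k \<Longrightarrow> site c k \<notin> S"
    by (auto simp: semi_infinite_def)
  then have "hop_modes c d i S \<subseteq> {- n..n - i}" by (force simp: hop_modes_def)
  then show ?thesis by (rule finite_subset) simp
qed (simp add: hop_modes_def)

text \<open>The \<open>i\<close>-th mode of the field \<open>\<psi>\<^sub>c(z) \<psi>\<^sub>d\<^sup>*(z)\<close>. On semi-infinite states only finitely many
  hops contribute; all other coefficients are set to \<open>0\<close>, which keeps the identities below
  unconditional.\<close>

definition current :: "colour \<Rightarrow> colour \<Rightarrow> int \<Rightarrow> fock \<Rightarrow> fock" where
  "current c d i F S = (\<Sum>k\<in>hop_modes c d i S. hop (site c (k + i)) (site d k) F S)"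

lemma current_linear:
  "current c d i (F + G) = current c d i F + current c d i G"
  "current c d i (sc r F) = sc r (current c d i F)"
  by (simp_all add: current_def fun_eq_iff hop_linear pointwise sum.distrib sum_distrib_left
      sc_apply)

lemma current_not_semi_infinite: "\<not> semi_infinite S \<Longrightarrow> current c d i F S = 0"
  by (simp add: current_def hop_modes_def)

lemma current_eq_sum:
  assumes "c \<noteq> d" "semi_infinite S" "finite K" "hop_modes c d i S \<subseteq> K"
  shows "current c d i F S = (\<Sum>k\<in>K. hop (site c (k + i)) (site d k) F S)"
  unfolding current_def using assms
  by (intro sum.mono_neutral_left) (auto simp: hop_modes_def hop_eval)

definition double_hop ::
  "colour \<Rightarrow> colour \<Rightarrow> int \<Rightarrow> colour \<Rightarrow> colour \<Rightarrow> int \<Rightarrow> fock \<Rightarrow> int set \<Rightarrow> int \<times> int \<Rightarrow> complex" where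
  "double_hop c d i c' d' j F S =
    (\<lambda>(k, l). hop (site c (k + i)) (site d k) (hop (site c' (l + j)) (site d' l) F) S)"

lemma double_hop_support:
  assumes "c \<noteq> d" "c' \<noteq> d'" "semi_infinite S"
  shows "{p. double_hop c d i c' d' j F S p \<noteq> 0} \<subseteq>
    Sigma (hop_modes c d i S) (\<lambda>k. hop_modes c' d' j (insert (site d k) (S - {site c (k + i)})))"
  using assms semi_infinite_insert[OF semi_infinite_remove[OF assms(3)]]
  by (auto simp: double_hop_def hop_eval hop_modes_def split: if_splits)

lemma finite_double_hop_support:
  assumes "c \<noteq> d" "c' \<noteq> d'" "semi_infinite S" shows "finite {p. double_hop c d i c' d' j F S p \<noteq> 0}"
  by (rule finite_subset[OF double_hop_support[OF assms]]) (intro finite_SigmaI finite_hop_modes)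

lemma current_current:
  assumes colours: "c \<noteq> d" "c' \<noteq> d'" and S_semi_infinite: "semi_infinite S"
    and D_support: "finite D" "{p. double_hop c d i c' d' j F S p \<noteq> 0} \<subseteq> D"
  shows "current c d i (current c' d' j F) S = sum (double_hop c d i c' d' j F S) D"
proof -
  let ?L = "\<lambda>k. hop_modes c' d' j (insert (site d k) (S - {site c (k + i)}))"
  have "hop (site c (k + i)) (site d k) (current c' d' j F) S
      = (\<Sum>l\<in>?L k. double_hop c d i c' d' j F S (k, l))" if "k \<in> hop_modes c d i S" for k
    using that colours
    by (simp add: double_hop_def hop_eval[of "site c (k + i)"] hop_modes_def[of c] current_def
        sum_distrib_left)
  then have "current c d i (current c' d' j F) S
      = (\<Sum>k\<in>hop_modes c d i S. \<Sum>l\<in>?L k. double_hop c d i c' d' j F S (k, l))"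
    unfolding current_def[of c] by (rule sum.cong[OF refl])
  also have "\<dots> = sum (double_hop c d i c' d' j F S) (Sigma (hop_modes c d i S) ?L)"
    by (simp add: sum.Sigma finite_hop_modes)
  also have "\<dots> = sum (double_hop c d i c' d' j F S) {p. double_hop c d i c' d' j F S p \<noteq> 0}"
    using double_hop_support[OF colours S_semi_infinite]
    by (intro sum.mono_neutral_right) (auto simp: finite_hop_modes)
  also have "\<dots> = sum (double_hop c d i c' d' j F S) D"
    using D_support by (intro sum.mono_neutral_left) auto
  finally show ?thesis .
qed

lemma current_commutator_sum:
  assumes "c \<noteq> d" "c' \<noteq> d'" "semi_infinite S" "finite D"
    and "{p. double_hop c d i c' d' j F S p \<noteq> 0} \<subseteq> D"
      "prod.swap ` {p. double_hop c' d' j c d i F S p \<noteq> 0} \<subseteq> D"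
  shows "current c d i (current c' d' j F) S - current c' d' j (current c d i F) S
    = (\<Sum>p\<in>D. double_hop c d i c' d' j F S p - double_hop c' d' j c d i F S (prod.swap p))"
proof -
  have "{p. double_hop c' d' j c d i F S p \<noteq> 0} \<subseteq> prod.swap ` D"
    using image_mono[OF assms(6), of prod.swap] by (simp add: image_image)
  then have "current c' d' j (current c d i F) S
      = sum (double_hop c' d' j c d i F S) (prod.swap ` D)"
    using assms(1-4) by (intro current_current) auto
  also have "\<dots> = (\<Sum>p\<in>D. double_hop c' d' j c d i F S (prod.swap p))"
    by (simp add: sum.reindex)
  finally show ?thesis using current_current[OF assms(1-5)] by (simp add: sum_subtractf)
qed

lemma current_commute:
  assumes "c \<noteq> d" "c' \<noteq> d'" "c \<noteq> d'" "d \<noteq> c'"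
  shows "current c d i (current c' d' j F) = current c' d' j (current c d i F)"
proof
  fix S
  show "current c d i (current c' d' j F) S = current c' d' j (current c d i F) S"
  proof (cases "semi_infinite S")
    case True
    let ?D = "{p. double_hop c d i c' d' j F S p \<noteq> 0}
      \<union> prod.swap ` {p. double_hop c' d' j c d i F S p \<noteq> 0}"
    have "double_hop c d i c' d' j F S p = double_hop c' d' j c d i F S (prod.swap p)" for p
      using assms hop_commute[of "site c (fst p + i)" "site d' (snd p)" "site d (fst p)"
        "site c' (snd p + j)" F]
      by (simp add: double_hop_def case_prod_unfold)
    moreover have "finite ?D" using assms True by (simp add: finite_double_hop_support)
    ultimately show ?thesis using current_commutator_sum[of c d c' d' S ?D i j F] assms True by simp
  qed (simp add: current_not_semi_infinite)
qed

lemma double_hop_contract: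
  assumes "c \<noteq> m" "m \<noteq> d" "c \<noteq> d"
  shows "double_hop c m i m d j F S p - double_hop m d j c m i F S (prod.swap p)
    = (if fst p = snd p + j then hop (site c (snd p + (i + j))) (site d (snd p)) F S else 0)"
proof (cases "fst p = snd p + j")
  case True
  then show ?thesis
    using hop_contract[of "site c (snd p + (i + j))" "site d (snd p)" "site m (snd p + j)" F] assms
    by (simp add: double_hop_def case_prod_unfold fun_eq_iff pointwise algebra_simps)
next
  case False
  then show ?thesis
    using hop_commute[of "site c (fst p + i)" "site d (snd p)" "site m (fst p)" "site m (snd p + j)"
      F] assms
    by (simp add: double_hop_def case_prod_unfold)
qed

lemma current_bracket:
  assumes "c \<noteq> m" "m \<noteq> d" "c \<noteq> d"
  shows "current c m i (current m d j F) - current m d j (current c m i F) = current c d (i + j) F"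
proof
  fix S
  show "(current c m i (current m d j F) - current m d j (current c m i F)) S
      = current c d (i + j) F S"
  proof (cases "semi_infinite S")
    case True
    let ?h = "\<lambda>l. hop (site c (l + (i + j))) (site d l) F S" and ?L = "hop_modes c d (i + j) S"
    define D where "D = {p. double_hop c m i m d j F S p \<noteq> 0} \<union>
      prod.swap ` {p. double_hop m d j c m i F S p \<noteq> 0} \<union> (\<lambda>l. (l + j, l)) ` ?L"
    have D_support: "finite D" "{p. double_hop c m i m d j F S p \<noteq> 0} \<subseteq> D"
      "prod.swap ` {p. double_hop m d j c m i F S p \<noteq> 0} \<subseteq> D"
      using assms True by (auto simp: D_def finite_double_hop_support finite_hop_modes)
    have "(current c m i (current m d j F) - current m d j (current c m i F)) S
        = (\<Sum>p\<in>D. if fst p = snd p + j then ?h (snd p) else 0)"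
      using current_commutator_sum[OF assms(1,2) True D_support]
      by (simp add: pointwise double_hop_contract[OF assms])
    also have "\<dots> = (\<Sum>p\<in>(\<lambda>l. (l + j, l)) ` ?L. ?h (snd p))"
      using D_support True assms(3)
      by (intro sum.mono_neutral_cong_right)
          (auto simp: D_def hop_modes_def hop_eval split: if_splits)
    also have "\<dots> = current c d (i + j) F S" by (simp add: current_def sum.reindex inj_on_def)
    finally show ?thesis .
  qed (simp add: current_not_semi_infinite pointwise)
qed

definition product_term ::
  "colour \<Rightarrow> colour \<Rightarrow> colour \<Rightarrow> colour \<Rightarrow> int \<Rightarrow> fock \<Rightarrow> int set \<Rightarrow> int \<times> int \<times> int \<Rightarrow> complex" where
  "product_term c d c' d' n F S = (\<lambda>(i, p). double_hop c d i c' d' (n - i) F S p)"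

lemma finite_product_term_support:
  assumes colours: "c \<noteq> d" "c' \<noteq> d'" "c \<noteq> d'" "d \<noteq> c'" and S_semi_infinite: "semi_infinite S"
  shows "finite {x. product_term c d c' d' n F S x \<noteq> 0}"
proof -
  obtain m where bounds: "\<And>c k. k < - m \<Longrightarrow> site c k \<in> S" "\<And>c k. m < k \<Longrightarrow> site c k \<notin> S"
    using S_semi_infinite by (auto simp: semi_infinite_def)
  have "{x. product_term c d c' d' n F S x \<noteq> 0}
      \<subseteq> {n - 2 * m..2 * m} \<times> {- m..3 * m - n} \<times> {- m..3 * m - n}"
  proof clarify
    fix i k l assume "product_term c d c' d' n F S (i, k, l) \<noteq> 0"
    then have "site c (k + i) \<in> S" "site d k \<notin> S" "site c' (l + (n - i)) \<in> S" "site d' l \<notin> S"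
      using colours by (auto simp: product_term_def double_hop_def hop_eval split: if_splits)
    then have "k + i \<le> m" "- m \<le> k" "l + (n - i) \<le> m" "- m \<le> l" using bounds by force+
    then show "i \<in> {n - 2 * m..2 * m} \<and> (k, l) \<in> {- m..3 * m - n} \<times> {- m..3 * m - n}" by auto
  qed
  then show ?thesis by (rule finite_subset) blast
qed

text \<open>The occupied modes \<open>k + i\<close> and \<open>l + n - i\<close> of equal colour, or the empty modes \<open>k\<close> and \<open>l\<close>,
  are exchanged; this reverses the sign.\<close>

lemma sum_product_term_zero:
  assumes colours: "c \<noteq> d" "c' \<noteq> d'" "c \<noteq> d'" "d \<noteq> c'" "c = c' \<or> d = d'"
  shows "sum (product_term c d c' d' n F S) {x. product_term c d c' d' n F S x \<noteq> 0} = 0"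
proof -
  let ?t = "product_term c d c' d' n F S"
  obtain \<sigma> where \<sigma>: "\<And>x. \<sigma> (\<sigma> x) = x" "\<And>x. ?t (\<sigma> x) = - ?t x"
  proof (cases "c = c'")
    case True
    let ?\<sigma> = "\<lambda>(i, k, l). (l + n - i - k, k, l)"
    show thesis
    proof (rule that[of ?\<sigma>])
      fix x :: "int \<times> int \<times> int"
      obtain i k l where x_eq: "x = (i, k, l)" by (cases x)
      show "?t (?\<sigma> x) = - ?t x"
        using hop_hop_exchange_create[of "site c (l + n - i)" "site d k" "site c (k + i)"
          "site d' l" F] colours True
        by (simp add: x_eq product_term_def double_hop_def pointwise algebra_simps)
    qed auto
  next
    case False
    let ?\<sigma> = "\<lambda>(i, k, l). (k + i - l, l, k)"
    show thesis
    proof (rule that[of ?\<sigma>])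
      fix x :: "int \<times> int \<times> int"
      obtain i k l where x_eq: "x = (i, k, l)" by (cases x)
      show "?t (?\<sigma> x) = - ?t x"
        using hop_hop_exchange_annihilate[of "site c' (l + n - i)" "site d l" "site d k"
          "site c (k + i)" F] colours False
        by (simp add: x_eq product_term_def double_hop_def pointwise algebra_simps)
    qed auto
  qed
  have "sum ?t {x. ?t x \<noteq> 0} = (\<Sum>x | ?t x \<noteq> 0. - ?t x)"
    using \<sigma> by (intro sum.reindex_bij_witness[of _ \<sigma> \<sigma>]) auto
  then show ?thesis by (simp add: sum_negf)
qed

lemma current_product_coefficient_zero:
  assumes colours: "c \<noteq> d" "c' \<noteq> d'" "c \<noteq> d'" "d \<noteq> c'" "c = c' \<or> d = d'"
  shows "\<forall>\<^sub>F I in finite_subsets_at_top UNIV. (\<Sum>i\<in>I. current c d i (current c' d' (n - i) F) S) = 0"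
proof (cases "semi_infinite S")
  case True
  let ?T = "{x. product_term c d c' d' n F S x \<noteq> 0}"
  let ?P = "\<lambda>i. {p. double_hop c d i c' d' (n - i) F S p \<noteq> 0}"
  have finite_T: "finite ?T" by (rule finite_product_term_support[OF colours(1-4) True])
  have "(\<Sum>i\<in>I. current c d i (current c' d' (n - i) F) S) = 0"
    if I_large: "finite I" "fst ` ?T \<subseteq> I" for I
  proof -
    have "(\<Sum>i\<in>I. current c d i (current c' d' (n - i) F) S)
        = (\<Sum>i\<in>I. \<Sum>p\<in>?P i. product_term c d c' d' n F S (i, p))"
      using current_current[OF colours(1,2) True finite_double_hop_support[OF colours(1,2) True]
        order_refl]
      by (simp add: product_term_def)
    also have "\<dots> = sum (product_term c d c' d' n F S) (Sigma I ?P)"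
      using finite_double_hop_support[OF colours(1,2) True] I_large(1) by (simp add: sum.Sigma)
    also have "Sigma I ?P = ?T" using I_large(2) by (auto simp: product_term_def image_subset_iff)
    finally show ?thesis using sum_product_term_zero[OF colours] by simp
  qed
  then show ?thesis
    unfolding eventually_finite_subsets_at_top using finite_T by (intro exI[of _ "fst ` ?T"]) auto
qed (simp add: current_not_semi_infinite)

section \<open>The Fock space representation\<close>

fun gen_op :: "gen \<Rightarrow> fock \<Rightarrow> fock" where
  "gen_op (Ee i) = current Red Green i"
| "gen_op (Ff i) = current Green Blue i"
| "gen_op (Hh i) = current Red Blue i"

fun word_op :: "gen list \<Rightarrow> fock \<Rightarrow> fock" where
  "word_op [] F = F"
| "word_op (g # w) F = gen_op g (word_op w F)"

lemma gen_op_linear: "gen_op g (F + G) = gen_op g F + gen_op g G"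
  "gen_op g (sc r F) = sc r (gen_op g F)"
  by (cases g; simp add: current_linear)+

lemma gen_op_zero [simp]: "gen_op g 0 = 0"
  using gen_op_linear(2)[of g 0 0] by simp

lemma gen_op_sum: "gen_op g (sum F I) = (\<Sum>i\<in>I. gen_op g (F i))" for F :: "'i \<Rightarrow> fock"
  by (induct I rule: infinite_finite_induct) (simp_all add: gen_op_linear)

lemma word_op_linear: "word_op w (F + G) = word_op w F + word_op w G"
  "word_op w (sc r F) = sc r (word_op w F)"
  by (induct w) (simp_all add: gen_op_linear)

lemma word_op_zero [simp]: "word_op w 0 = 0"
  using word_op_linear(2)[of w 0 0] by simp

lemma word_op_append: "word_op (u @ v) F = word_op u (word_op v F)"
  by (induct u) simp_all

definition tensor_op :: "(gen list \<Rightarrow> complex) \<Rightarrow> fock \<Rightarrow> fock" where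
  "tensor_op t F = (\<Sum>w | t w \<noteq> 0. sc (t w) (word_op w F))"

lemma tensor_op_superset:
  "finite W \<Longrightarrow> {w. t w \<noteq> 0} \<subseteq> W \<Longrightarrow> tensor_op t F = (\<Sum>w\<in>W. sc (t w) (word_op w F))"
  unfolding tensor_op_def by (intro sum.mono_neutral_left) auto

lemma tensor_op_add: "fins p \<Longrightarrow> fins q \<Longrightarrow> tensor_op (p + q) F = tensor_op p F + tensor_op q F"
proof -
  assume "fins p" "fins q"
  then have finite_W: "finite ({w. p w \<noteq> 0} \<union> {w. q w \<noteq> 0})" (is "finite ?W")
    by (simp add: fins_def)
  have "tensor_op r F = (\<Sum>w\<in>?W. sc (r w) (word_op w F))" if "r \<in> {p, q, p + q}" for r
    using that by (intro tensor_op_superset[OF finite_W]) (auto simp: pointwise)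
  then show ?thesis by (simp add: vec.scale_left_distrib sum.distrib pointwise)
qed

lemma tensor_op_sc: "fins p \<Longrightarrow> tensor_op (sc c p) F = sc c (tensor_op p F)"
proof -
  assume "fins p"
  then have "tensor_op (sc c p) F = (\<Sum>w | p w \<noteq> 0. sc (sc c p w) (word_op w F))"
    by (intro tensor_op_superset) (auto simp: fins_def sc_apply)
  then show ?thesis by (simp add: tensor_op_def vec.scale_sum_right sc_apply)
qed

lemma tensor_op_bv [simp]: "tensor_op (bv w) F = word_op w F"
proof -
  have "{u. bv w u \<noteq> 0} = {w}" by (auto simp: bv_def)
  then show ?thesis by (simp add: tensor_op_def bv_def)
qed

lemma tensor_op_zero [simp]: "tensor_op 0 F = 0" "tensor_op t 0 = 0"
  by (simp_all add: tensor_op_def pointwise)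

lemma tensor_op_diff: "fins p \<Longrightarrow> fins q \<Longrightarrow> tensor_op (p - q) F = tensor_op p F - tensor_op q F"
  using tensor_op_add[of "p - q" q F] by simp

lemma tensor_op_sum: "(\<And>i. i \<in> I \<Longrightarrow> fins (p i)) \<Longrightarrow> tensor_op (sum p I) F = (\<Sum>i\<in>I. tensor_op (p i) F)"
  by (induct I rule: infinite_finite_induct) (simp_all add: tensor_op_add fins_sum)

lemma tensor_op_tmul: "fins p \<Longrightarrow> fins q \<Longrightarrow> tensor_op (tmul p q) F = tensor_op p (tensor_op q F)"
proof (induct p rule: fins_induct)
  case (bv u)
  then show ?case
    by (induct q rule: fins_induct)
      (simp_all add: tmul_add tmul_sc tensor_op_add tensor_op_sc word_op_append word_op_linear)
qed (simp_all add: tmul_add tmul_sc tensor_op_add tensor_op_sc)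

lemma tensor_op_iota: "fins x \<Longrightarrow> tensor_op (iota x) F = (\<Sum>g | x g \<noteq> 0. sc (x g) (gen_op g F))"
  by (simp add: iota_expand tensor_op_sum tensor_op_sc)

lemma gen_op_commutator:
  "gen_op x (gen_op y F) - gen_op y (gen_op x F) = tensor_op (iota (bbr x y)) F"
proof (cases "bbr x y = 0")
  case True
  have "bbr (Ee i) (Ff j) \<noteq> 0" "bbr (Ff j) (Ee i) \<noteq> 0" for i j
    by (auto simp: fun_eq_iff pointwise)
  then have "gen_op x (gen_op y F) = gen_op y (gen_op x F)"
    using True by (cases x; cases y) (auto intro!: current_commute)
  then show ?thesis using True by simp
next
  case False
  then consider (Ee_Ff) i j where "x = Ee i" "y = Ff j" | (Ff_Ee) i j where "x = Ff j" "y = Ee i"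
    by (cases x; cases y) auto
  then show ?thesis
  proof cases
    case Ee_Ff
    then show ?thesis by (simp add: bbr_Ee_Ff current_bracket)
  next
    case Ff_Ee
    have "current Green Blue j (current Red Green i F)
        - current Red Green i (current Green Blue j F) = sc (- 1) (current Red Blue (i + j) F)"
      using current_bracket[of Red Green Blue i j F] by (simp add: algebra_simps)
    then show ?thesis
      using Ff_Ee by (simp add: bbr_Ff_Ee iota_sc tensor_op_sc del: vec.scale_minus_left)
  qed
qed

lemma tensor_op_urel: "r \<in> urel \<Longrightarrow> tensor_op r F = 0"
proof -
  assume "r \<in> urel"
  then obtain x y where fins_xy: "fins x" "fins y"
    and r_eq: "r = tmul (iota x) (iota y) - tmul (iota y) (iota x) - iota (lbr x y)"
      by (auto simp: urel_def)
  let ?A = "{a. x a \<noteq> 0}" and ?B = "{b. y b \<noteq> 0}"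
  have "tensor_op (iota x) (tensor_op (iota y) F)
      = (\<Sum>a\<in>?A. \<Sum>b\<in>?B. sc (x a * y b) (gen_op a (gen_op b F)))"
    using fins_xy by (simp add: tensor_op_iota gen_op_sum gen_op_linear vec.scale_sum_right)
  moreover have "tensor_op (iota y) (tensor_op (iota x) F)
      = (\<Sum>a\<in>?A. \<Sum>b\<in>?B. sc (x a * y b) (gen_op b (gen_op a F)))"
    using fins_xy by (subst sum.swap)
      (simp add: tensor_op_iota gen_op_sum gen_op_linear vec.scale_sum_right mult.commute)
  moreover have "tensor_op (iota (lbr x y)) F
      = (\<Sum>a\<in>?A. \<Sum>b\<in>?B. sc (x a * y b) (tensor_op (iota (bbr a b)) F))"
    by (simp add: lbr_expand iota_sum iota_sc tensor_op_sum tensor_op_sc fins_sum)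
  ultimately show ?thesis
    unfolding r_eq using fins_xy
    by (simp add: tensor_op_diff tensor_op_tmul flip: gen_op_commutator)
      (simp add: vec.scale_right_diff_distrib sum_subtractf)
qed

definition vac :: fock where
  "vac = bv {..3}"

lemma site_vacuum [simp]: "site c k \<le> 3 \<longleftrightarrow> k \<le> 0"
  by (cases c) (auto simp: site.simps)

lemma vac_apply: "vac S = (if S = {..3} then 1 else 0)"
  by (simp add: vac_def bv_def)

lemma current_nonzeroE:
  assumes "current c d i F S \<noteq> 0" "c \<noteq> d"
  obtains k where "semi_infinite S" "site c (k + i) \<in> S" "site d k \<notin> S"
    "F (insert (site d k) (S - {site c (k + i)})) \<noteq> 0"
proof -
  obtain k where "k \<in> hop_modes c d i S" "hop (site c (k + i)) (site d k) F S \<noteq> 0"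
    using assms(1) unfolding current_def by (meson sum.neutral)
  then show thesis using that[of k] assms(2) by (simp add: hop_eval hop_modes_def)
qed

lemma current_vac_nonpos:
  assumes "i \<le> 0" "c \<noteq> d" shows "current c d i vac = 0"
proof (rule ext, rule ccontr)
  fix S assume "current c d i vac S \<noteq> 0 S"
  then have "current c d i vac S \<noteq> 0" by (simp add: pointwise)
  then obtain k where "vac (insert (site d k) (S - {site c (k + i)})) \<noteq> 0"
    using current_nonzeroE assms(2) by metis
  then have hopped_eq: "insert (site d k) (S - {site c (k + i)}) = {..3}"
    by (simp add: vac_apply split: if_splits)
  then have "site d k \<in> {..3}" by blast
  then have "site c (k + i) \<in> {..3}" using assms(1) by simp
  then show False unfolding hopped_eq[symmetric] using assms(2) by simp
qed

lemma gen_op_vac_nonpos: "gidx g \<le> 0 \<Longrightarrow> gen_op g vac = 0"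
  by (cases g) (simp_all add: current_vac_nonpos)

definition coeff_kernel :: "int set \<Rightarrow> (gen list \<Rightarrow> complex) set" where
  "coeff_kernel S = {t. fins t \<and> tensor_op t vac S = 0}"

lemma subspace_coeff_kernel: "vec.subspace (coeff_kernel S)"
  by (auto simp: vec.subspace_def coeff_kernel_def tensor_op_add tensor_op_sc pointwise sc_apply)

lemma LM_coeff_kernel: "LM \<subseteq> coeff_kernel S"
  unfolding LM_def lspan_eq_span
proof (rule vec.span_minimal[OF _ subspace_coeff_kernel], intro Un_least subsetI)
  fix z assume "z \<in> {tmul (tmul a r) b |a r b. fins a \<and> r \<in> urel \<and> fins b}"
  then obtain a r b where "z = tmul (tmul a r) b" "fins a" "r \<in> urel" "fins b" by blast
  then show "z \<in> coeff_kernel S"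
    by (simp add: coeff_kernel_def fins_urel tensor_op_tmul tensor_op_urel pointwise)
next
  fix z assume "z \<in> {tmul a (iota x) |a x. fins a \<and> x \<in> Hminus}"
  then obtain a x where z_eq: "z = tmul a (iota x)" "fins a" "x \<in> Hminus" by blast
  then have "tensor_op (iota x) vac = 0" by (simp add: Hminus_def tensor_op_iota gen_op_vac_nonpos)
  then show "z \<in> coeff_kernel S"
    using z_eq by (simp add: coeff_kernel_def Hminus_def tensor_op_tmul pointwise)
qed

lemma gen_op_product_coefficient_zero:
  assumes "(X, Y) \<in> rpairs"
  shows "\<forall>\<^sub>F I in finite_subsets_at_top UNIV. (\<Sum>i\<in>I. gen_op (X i) (gen_op (Y (n - i)) F) S) = 0"
  using assms
  unfolding rpairs_def by (elim insertE emptyE) (simp_all add: current_product_coefficient_zero)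

lemma JW_coeff_kernel: "JW \<subseteq> coeff_kernel S"
  unfolding JW_def lspan_eq_span
proof (rule vec.span_minimal[OF _ subspace_coeff_kernel], intro Un_least LM_coeff_kernel subsetI)
  fix c assume "c \<in> Rco"
  then obtain X Y n t K0 where XY_rpairs: "(X, Y) \<in> rpairs" and fins_t: "fins t"
   
    and partial_sums_LM: "\<And>K. K \<ge> K0 \<Longrightarrow> psum X Y n t K - c \<in> LM" unfolding Rco_def by blast
  from eventually_window[OF gen_op_product_coefficient_zero[OF XY_rpairs]]
  obtain K where K_large: "K \<ge> K0"
    "(\<Sum>i\<in>{- int K..int K}. gen_op (X i) (gen_op (Y (n - i)) (tensor_op t vac)) S) = 0"
    unfolding eventually_sequentially by (meson max.cobounded1 max.cobounded2)
  have "psum X Y n t K \<in> coeff_kernel S"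
    using K_large(2) fins_t
    by (simp add: coeff_kernel_def psum_def fins_sum tensor_op_sum tensor_op_tmul sum_fun_apply)
  moreover have "psum X Y n t K - c \<in> coeff_kernel S"
    using partial_sums_LM[OF K_large(1)] LM_coeff_kernel by blast
  ultimately show "c \<in> coeff_kernel S" using subspace_diff_iff[OF subspace_coeff_kernel] by blast
qed

lemma Jbar_coeff_kernel:
  assumes "\<And>i F. M \<le> i \<Longrightarrow> gen_op (Ee i) F S = 0" "\<And>j F. N \<le> j \<Longrightarrow> gen_op (Ff j) F S = 0"
  shows "Jbar M N \<subseteq> coeff_kernel S"
  by (rule Jbar_least[OF subspace_coeff_kernel JW_coeff_kernel])
    (use assms in \<open>simp_all add: absorbs_def coeff_kernel_def tensor_op_tmul\<close>)

lemma JMN_coeff_kernel: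
  assumes "\<And>i F. M \<le> i \<Longrightarrow> gen_op (Ee i) F S = 0" "\<And>j F. N \<le> j \<Longrightarrow> gen_op (Ff j) F S = 0"
    and not_vacuum: "M = -1 \<or> N = -1 \<Longrightarrow> S \<noteq> {..3}"
  shows "JMN M N \<subseteq> coeff_kernel S"
proof (cases "M = -1 \<or> N = -1")
  case True
  have "bv [] \<in> coeff_kernel S" using not_vacuum[OF True] by (simp add: coeff_kernel_def vac_apply)
  then have "vec.span (Jbar M N \<union> {bv []}) \<subseteq> coeff_kernel S"
    using Jbar_coeff_kernel[OF assms(1,2)]
    by (intro vec.span_minimal[OF _ subspace_coeff_kernel]) simp
  then show ?thesis using True by (simp add: JMN_def lspan_eq_span)
qed (use Jbar_coeff_kernel[OF assms(1,2)] in \<open>simp add: JMN_def\<close>)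

section \<open>Test states\<close>

text \<open>\<open>Q\<close> lists the red particles above the vacuum, \<open>- R\<close> the blue holes, and \<open>m\<close> is the green
  charge.\<close>

definition test_state :: "int set \<Rightarrow> int set \<Rightarrow> int \<Rightarrow> int set" where
  "test_state Q R m = {site Red k |k. k \<le> 0 \<or> k \<in> Q} \<union> {site Green k |k. k \<le> m}
    \<union> {site Blue k |k. k \<le> 0 \<and> - k \<notin> R}"

lemma test_state_mem [simp]:
  "site Red k \<in> test_state Q R m \<longleftrightarrow> k \<le> 0 \<or> k \<in> Q"
  "site Green k \<in> test_state Q R m \<longleftrightarrow> k \<le> m"
  "site Blue k \<in> test_state Q R m \<longleftrightarrow> k \<le> 0 \<and> - k \<notin> R"
  by (auto simp: test_state_def)

lemma test_state_vacuum: "test_state {} {} 0 = {..3}"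
proof (rule set_eq_by_sites)
  show "site c k \<in> test_state {} {} 0 \<longleftrightarrow> site c k \<in> {..3}" for c k
    by (cases c) (simp_all only: test_state_mem atMost_iff site_vacuum, simp_all)
qed

lemma semi_infinite_test_state:
  assumes "finite Q" "finite R" shows "semi_infinite (test_state Q R m)"
proof -
  have "finite (insert m (Q \<union> R))" using assms by simp
  then obtain n where bound: "\<forall>x\<in>insert m (Q \<union> R). \<bar>x\<bar> \<le> n"
    using bdd_above_finite[of "abs ` insert m (Q \<union> R)"] by (auto simp: bdd_above_def)
  have "(k < - n \<longrightarrow> site c k \<in> test_state Q R m) \<and> (n < k \<longrightarrow> site c k \<notin> test_state Q R m)" for c k
    using bound by (cases c) force+
  then show ?thesis unfolding semi_infinite_def by blast
qed

lemma current_nonzero_iff: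
  assumes "c \<noteq> d" "semi_infinite S" "\<And>k. site c (k + i) \<in> S \<Longrightarrow> site d k \<notin> S \<Longrightarrow> k = k0"
  shows "current c d i F S \<noteq> 0 \<longleftrightarrow>
    site c (k0 + i) \<in> S \<and> site d k0 \<notin> S \<and> F (insert (site d k0) (S - {site c (k0 + i)})) \<noteq> 0"
proof -
  have "current c d i F S = (\<Sum>k\<in>{k0}. hop (site c (k + i)) (site d k) F S)"
    using assms by (intro current_eq_sum) (auto simp: hop_modes_def)
  then show ?thesis
    using assms(1,2) semi_infinite_bdd_above by (simp add: hop_eval wedge_sign_nonzero)
qed

lemma current_zero_if_no_hop:
  assumes "c \<noteq> d" "\<And>k. site c (k + i) \<in> S \<Longrightarrow> site d k \<in> S" shows "current c d i F S = 0"
  using assms by (metis current_nonzeroE)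

lemma Ff_test_state:
  assumes "finite Q" "R \<subseteq> {0..r}" "0 \<le> r"
  shows "gen_op (Ff (m + r)) F (test_state Q R m) \<noteq> 0
    \<longleftrightarrow> r \<in> R \<and> F (test_state Q (R - {r}) (m - 1)) \<noteq> 0"
proof -
  let ?S = "test_state Q R m"
  have "finite R" using assms(2) by (rule finite_subset) simp
  then have "semi_infinite ?S" by (rule semi_infinite_test_state[OF assms(1)])
  moreover have "k = - r" if "site Green (k + (m + r)) \<in> ?S" "site Blue k \<notin> ?S" for k
    using that assms(2,3) by (auto dest!: subsetD)
  moreover have "insert (site Blue (- r)) (?S - {site Green m}) = test_state Q (R - {r}) (m - 1)"
  proof (rule set_eq_by_sites)
    show "site c k \<in> insert (site Blue (- r)) (?S - {site Green m}) \<longleftrightarrow>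
        site c k \<in> test_state Q (R - {r}) (m - 1)" for c k
      using assms(3) by (cases c) auto
  qed
  ultimately show ?thesis
    using current_nonzero_iff[of Green Blue ?S "m + r" "- r" F] assms(3) by simp
qed

lemma Hh_test_state:
  assumes "finite Q" "Q \<subseteq> {..q}" "1 \<le> q" "R \<subseteq> {0..r}" "0 \<le> r"
  shows "gen_op (Hh (q + r)) F (test_state Q R m) \<noteq> 0 \<longleftrightarrow>
    r \<in> R \<and> q \<in> Q \<and> F (test_state (Q - {q}) (R - {r}) m) \<noteq> 0"
proof -
  let ?S = "test_state Q R m"
  have "finite R" using assms(4) by (rule finite_subset) simp
  then have "semi_infinite ?S" by (rule semi_infinite_test_state[OF assms(1)])
  moreover have "k = - r" if "site Red (k + (q + r)) \<in> ?S" "site Blue k \<notin> ?S" for k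
  proof -
    have "k + (q + r) \<le> q" using that(1) assms(2,3) by auto
    moreover from this have "- k \<in> R" using that(2) assms(5) by auto
    ultimately show "k = - r" using assms(4) by (auto dest!: subsetD)
  qed
  moreover have "insert (site Blue (- r)) (?S - {site Red q}) = test_state (Q - {q}) (R - {r}) m"
  proof (rule set_eq_by_sites)
    show "site c k \<in> insert (site Blue (- r)) (?S - {site Red q}) \<longleftrightarrow>
        site c k \<in> test_state (Q - {q}) (R - {r}) m" for c k
      using assms(3,5) by (cases c) auto
  qed
  ultimately show ?thesis
    using current_nonzero_iff[of Red Blue ?S "q + r" "- r" F] assms(3,5) by auto
qed

lemma JMN_coeff_kernel_test_state:
  assumes Q_bounds: "Q \<subseteq> {..m + M}" "0 \<le> m + M" and R_bounds: "R \<subseteq> {0..<N - m}" "m \<le> N"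
    and charged: "M = -1 \<or> N = -1 \<Longrightarrow> m \<noteq> 0"
  shows "JMN M N \<subseteq> coeff_kernel (test_state Q R m)"
proof (rule JMN_coeff_kernel)
  show "gen_op (Ee i) F (test_state Q R m) = 0" if "M \<le> i" for i F
    unfolding gen_op.simps
    by (rule current_zero_if_no_hop) (use that Q_bounds in \<open>auto dest!: subsetD\<close>)
  show "gen_op (Ff j) F (test_state Q R m) = 0" if "N \<le> j" for j F
    unfolding gen_op.simps
    by (rule current_zero_if_no_hop) (use that R_bounds in \<open>auto dest!: subsetD\<close>)
  show "test_state Q R m \<noteq> {..3}" if "M = -1 \<or> N = -1"
  proof
    assume "test_state Q R m = {..3}"
    then have "k \<le> m \<longleftrightarrow> k \<le> 0" for k
      using test_state_mem(2)[of k Q R m] site_vacuum[of Green k] by simp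
    then show False using charged[OF that] by (metis order_antisym order_refl)
  qed
qed

fun charge :: "gen list \<Rightarrow> int" where
  "charge [] = 0"
| "charge (Ff i # w) = charge w + 1"
| "charge (Ee i # w) = charge w - 1"
| "charge (Hh i # w) = charge w"

lemma charge_append: "charge (u @ v) = charge u + charge v"
  by (induct u rule: charge.induct) auto

definition green_charge :: "int set \<Rightarrow> int" where
  "green_charge S =
    int (card {k. 0 < k \<and> site Green k \<in> S}) - int (card {k. k \<le> 0 \<and> site Green k \<notin> S})"

lemma green_charge_insert:
  assumes "semi_infinite S" "site c l \<notin> S"
  shows "green_charge (insert (site c l) S) = green_charge S + (if c = Green then 1 else 0)"
proof (cases "c = Green")
  case True
  let ?P = "\<lambda>S. {k. 0 < k \<and> site Green k \<in> S}" and ?H = "\<lambda>S. {k. k \<le> 0 \<and> site Green k \<notin> S}"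
  obtain n where bounds: "\<And>c k. k < - n \<Longrightarrow> site c k \<in> S" "\<And>c k. n < k \<Longrightarrow> site c k \<notin> S"
    using assms(1) by (auto simp: semi_infinite_def)
  have "?P S \<subseteq> {0..n}" "?H S \<subseteq> {- n..0}" using bounds by force+
  then have finite_PH: "finite (?P S)" "finite (?H S)" by (auto intro: finite_subset)
  show ?thesis
  proof (cases "0 < l")
    case True
    then have "?P (insert (site Green l) S) = insert l (?P S)" "?H (insert (site Green l) S) = ?H S"
      by auto
    then show ?thesis using \<open>c = Green\<close> assms(2) finite_PH by (simp add: green_charge_def)
  next
    case False
    then have "?P (insert (site Green l) S) = ?P S" "?H S = insert l (?H (insert (site Green l) S))"
      using assms(2) \<open>c = Green\<close> by auto
    moreover from this finite_PH have "card (?H S) = Suc (card (?H (insert (site Green l) S)))"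
      by (metis (mono_tags, lifting) card_insert_disjoint finite_insert insertI1 mem_Collect_eq)
    ultimately show ?thesis using \<open>c = Green\<close> by (simp add: green_charge_def)
  qed
qed (simp add: green_charge_def)

lemma green_charge_hop:
  assumes "semi_infinite S" "site c k \<in> S" "site d l \<notin> S"
  shows "green_charge S = green_charge (insert (site d l) (S - {site c k}))
    + (if c = Green then 1 else 0) - (if d = Green then 1 else 0)"
  using green_charge_insert[of "S - {site c k}" c k] green_charge_insert[of "S - {site c k}" d l]
    semi_infinite_remove[OF assms(1), of c k] assms(2,3) by (simp add: insert_absorb)

lemma word_op_vac_charge: "word_op w vac S \<noteq> 0 \<Longrightarrow> green_charge S = charge w"
proof (induct w arbitrary: S)
  case Nil
  then have "S = {..3}" by (simp add: vac_apply split: if_splits)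
  then show ?case by (simp add: green_charge_def)
next
  case (Cons g w)
  have charge_hop:
    "green_charge S = charge w + (if c = Green then 1 else 0) - (if d = Green then 1 else 0)"
    if "current c d i (word_op w vac) S \<noteq> 0" "c \<noteq> d" for c d i
    using that Cons.hyps by (metis current_nonzeroE green_charge_hop)
  show ?case using Cons.prems charge_hop by (cases g) fastforce+
qed

lemma green_charge_test_state: "green_charge (test_state Q R m) = m"
proof -
  have "{k. 0 < k \<and> k \<le> m} = {0<..m}" "{k. k \<le> 0 \<and> \<not> k \<le> m} = {m<..0}" by auto
  then show ?thesis by (simp add: green_charge_def)
qed

lemma Ee1_vac_red_unoccupied: "site Red 1 \<notin> S \<Longrightarrow> gen_op (Ee 1) vac S = 0"
proof (rule ccontr)
  assume unoccupied: "site Red 1 \<notin> S" and "gen_op (Ee 1) vac S \<noteq> 0"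
  then have "current Red Green 1 vac S \<noteq> 0" by simp
  then obtain k where k_hop:
      "site Red (k + 1) \<in> S" "vac (insert (site Green k) (S - {site Red (k + 1)})) \<noteq> 0"
    by (rule current_nonzeroE) simp_all
  from k_hop(2) have hopped_eq: "insert (site Green k) (S - {site Red (k + 1)}) = {..3}"
    by (simp add: vac_apply split: if_splits)
  then have "site Green k \<in> {..3}" by blast
  moreover have "site Red (k + 1) \<notin> {..3}" unfolding hopped_eq[symmetric] by simp
  ultimately have "k = 0" by simp
  then show False using unoccupied k_hop(1) by simp
qed

lemma word_op_Ee1_vac_red_unoccupied:
  "site Red 1 \<notin> S \<Longrightarrow> word_op w (gen_op (Ee 1) vac) S = 0"
proof (induct w arbitrary: S)
  case Nil
  then show ?case by (simp add: Ee1_vac_red_unoccupied del: gen_op.simps)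
next
  case (Cons g w)
  have "current c d i (word_op w (gen_op (Ee 1) vac)) S = 0" if colours: "c \<noteq> d" "d \<noteq> Red" for c d i
  proof (rule ccontr)
    assume "current c d i (word_op w (gen_op (Ee 1) vac)) S \<noteq> 0"
    then obtain k where
      "word_op w (gen_op (Ee 1) vac) (insert (site d k) (S - {site c (k + i)})) \<noteq> 0"
      using colours(1) by (metis current_nonzeroE)
    moreover have "site Red 1 \<notin> insert (site d k) (S - {site c (k + i)})"
      using Cons.prems colours(2) by simp
    then have "word_op w (gen_op (Ee 1) vac) (insert (site d k) (S - {site c (k + i)})) = 0"
      by (rule Cons.hyps)
    ultimately show False by simp
  qed
  then show ?case by (cases g) simp_all
qed

lemma Ee1_vac_test_state: "gen_op (Ee 1) vac (test_state {1} {} (-1)) \<noteq> 0"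
proof -
  let ?S = "test_state {1} {} (-1)"
  have "insert (site Green 0) (?S - {site Red (0 + 1)}) = {..3}"
    unfolding test_state_vacuum[symmetric]
  proof (rule set_eq_by_sites)
    show "site c k \<in> insert (site Green 0) (?S - {site Red (0 + 1)})
        \<longleftrightarrow> site c k \<in> test_state {} {} 0" for c k
      by (cases c) auto
  qed
  moreover have "semi_infinite ?S" by (simp add: semi_infinite_test_state)
  moreover have "k = 0" if "site Red (k + 1) \<in> ?S" "site Green k \<notin> ?S" for k
    using that by auto
  ultimately show ?thesis
    using current_nonzero_iff[of Red Green ?S 1 0 vac] by (simp add: vac_apply)
qed

section \<open>Triangularity\<close>

text \<open>A step \<open>(r, h)\<close> is a letter \<open>Hh\<close> (if \<open>h\<close>) or \<open>Ff\<close> which, evaluated at the test state of the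
  remaining word, fills the blue hole \<open>- r\<close>; the index of the letter follows from the number of
  letters \<open>Ff\<close> after it.\<close>

type_synonym step = "int \<times> bool"

fun f_steps :: "step list \<Rightarrow> int" where
  "f_steps [] = 0"
| "f_steps ((r, h) # x) = (if h then f_steps x else f_steps x + 1)"

fun step_word :: "int \<Rightarrow> int \<Rightarrow> step list \<Rightarrow> gen list" where
  "step_word s m [] = []"
| "step_word s m ((r, h) # x) =
    (if h then Hh (f_steps x + m + r) else Ff (f_steps x + 1 + s + r)) # step_word s m x"

fun red_modes :: "int \<Rightarrow> step list \<Rightarrow> int set" where
  "red_modes m [] = {}"
| "red_modes m ((r, h) # x) = (if h then insert (f_steps x + m) (red_modes m x) else red_modes m x)"

definition h_leads :: "step list \<Rightarrow> bool" where
  "h_leads x \<longleftrightarrow> x \<noteq> [] \<and> snd (hd x)"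

lemma h_leads_simps [simp]: "\<not> h_leads []" "h_leads ((r, h) # x) \<longleftrightarrow> h"
  by (simp_all add: h_leads_def)

fun peelable :: "int \<Rightarrow> step list \<Rightarrow> bool" where
  "peelable b [] \<longleftrightarrow> True"
| "peelable b ((r, h) # x) \<longleftrightarrow>
    0 \<le> r \<and> (\<forall>r'\<in>fst ` set x. r' < r) \<and> (h \<longrightarrow> b \<le> f_steps x \<and> \<not> h_leads x) \<and> peelable b x"

lemma f_steps_nonneg: "0 \<le> f_steps x"
  by (induct x rule: f_steps.induct) auto

lemma charge_step_word: "charge (step_word s m x) = f_steps x"
  by (induct x rule: f_steps.induct) auto

lemma finite_red_modes: "finite (red_modes m x)"
  by (induct x rule: f_steps.induct) auto

lemma red_modes_bounds:
  assumes "peelable b x"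
  shows "red_modes m x \<subseteq> {b + m..f_steps x + m - (if h_leads x then 0 else 1)}"
proof -
  have "b + m \<le> q \<and> q \<le> f_steps x + m - (if h_leads x then 0 else 1)" if "q \<in> red_modes m x" for q
    using assms that by (induct x rule: f_steps.induct) (auto split: if_splits)
  then show ?thesis by auto
qed

lemma peelable_holes: "peelable b ((r, h) # x) \<Longrightarrow> fst ` set ((r, h) # x) \<subseteq> {0..r}"
proof -
  assume peelable_Cons: "peelable b ((r, h) # x)"
  have "0 \<le> r'" if "r' \<in> fst ` set y" "peelable b y" for r' y
    using that by (induct y rule: f_steps.induct) auto
  then show ?thesis using peelable_Cons by force
qed

lemma peelable_less_Cons:
  assumes "peelable b x" "x < (r, h) # y" "\<nexists>x'. x = (r, h) # x'"
  shows "fst ` set x \<subseteq> {0..r}" "r \<notin> fst ` set x \<or> h \<and> \<not> h_leads x"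
proof -
  have "fst ` set x \<subseteq> {0..r} \<and> (r \<notin> fst ` set x \<or> h \<and> \<not> h_leads x)"
  proof (cases x)
    case (Cons g x')
    obtain r' h' where g_eq: "g = (r', h')" by (cases g)
    have "fst ` set x \<subseteq> {0..r'}" using peelable_holes assms(1) unfolding Cons g_eq by blast
    moreover have "r' < r \<or> r' = r \<and> \<not> h' \<and> h" using assms(2,3) Cons g_eq by auto
    ultimately show ?thesis using Cons g_eq by auto
  qed simp
  then show "fst ` set x \<subseteq> {0..r}" "r \<notin> fst ` set x \<or> h \<and> \<not> h_leads x" by blast+
qed

locale peeling =
  fixes s m b :: int and P :: "int set" and v :: fock
  assumes base: "v (test_state P {} s) \<noteq> 0" and finite_P: "finite P" and P_bound: "P \<subseteq> {..<b + m}"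
    and bound_pos: "1 \<le> b + m"
begin

definition step_state :: "step list \<Rightarrow> int set" where
  "step_state x = test_state (P \<union> red_modes m x) (fst ` set x) (f_steps x + s)"

lemma Ff_step_zero:
  assumes "finite Q" "R \<subseteq> {0..r}" "0 \<le> r" "r \<notin> R"
  shows "word_op (step_word s m ((r, False) # y)) v (test_state Q R (f_steps y + 1 + s)) = 0"
  using Ff_test_state[OF assms(1-3), of "f_steps y + 1 + s"] assms(4) by (simp del: gen_op.simps)

lemma Hh_step_zero:
  assumes "finite Q" "Q \<subseteq> {..f_steps y + m}" "b \<le> f_steps y" "R \<subseteq> {0..r}" "0 \<le> r"
    and "r \<notin> R \<or> f_steps y + m \<notin> Q"
  shows "word_op (step_word s m ((r, True) # y)) v (test_state Q R c) = 0"
  using Hh_test_state[OF assms(1,2) _ assms(4,5)] assms(3,6) bound_pos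
  by (auto simp del: gen_op.simps)

lemma step_state_Cons:
  assumes peelable_x: "peelable b ((r, h) # x)" and f_steps_y: "f_steps y = f_steps x"
  shows "word_op (step_word s m ((r, h) # y)) v (step_state ((r, h) # x)) \<noteq> 0
    \<longleftrightarrow> word_op (step_word s m y) v (step_state x) \<noteq> 0"
proof -
  let ?R = "fst ` set ((r, h) # x)" and ?Q = "P \<union> red_modes m ((r, h) # x)"
  have holes: "?R \<subseteq> {0..r}" "0 \<le> r" "r \<in> ?R" using peelable_holes[OF peelable_x] peelable_x by auto
  have "r \<notin> fst ` set x" using peelable_x by auto
  then have holes_tail: "?R - {r} = fst ` set x" by auto
  have finite_Q: "finite ?Q" using finite_P finite_red_modes[of m "(r, h) # x"] by simp
  show ?thesis
  proof (cases h)
    case False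
    then show ?thesis
      using Ff_test_state[OF finite_Q holes(1,2), of "f_steps x + 1 + s"] holes(3) holes_tail
        f_steps_y
      by (simp add: step_state_def add.commute add.left_commute del: gen_op.simps)
  next
    case True
    let ?q = "f_steps x + m"
    have tail: "b \<le> f_steps x" "\<not> h_leads x" "peelable b x" using peelable_x True by auto
    have "P \<subseteq> {..<?q}" "red_modes m x \<subseteq> {..<?q}"
      using P_bound tail red_modes_bounds[OF tail(3), of m] by auto
    then have red: "?Q \<subseteq> {..?q}" "?q \<in> ?Q" "?Q - {?q} = P \<union> red_modes m x" using True by auto
    have "1 \<le> ?q" using bound_pos tail(1) by simp
    then show ?thesis
      using Hh_test_state[OF finite_Q red(1) _ holes(1,2)] holes(3) holes_tail red(2,3) f_steps_y
        True
      by (simp add: step_state_def del: gen_op.simps)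
  qed
qed

lemma step_state_diagonal:
  "peelable b x \<Longrightarrow> word_op (step_word s m x) v (step_state x) \<noteq> 0"
proof (induct x)
  case Nil
  then show ?case using base by (simp add: step_state_def)
next
  case (Cons g x)
  then show ?case using step_state_Cons[of "fst g" "snd g" x x] by (cases g) auto
qed

lemma step_state_first_less:
  assumes peelable_x: "peelable b x" and peelable_y: "peelable b ((r, h) # y)"
    and f_steps_eq: "f_steps x = f_steps ((r, h) # y)"
    and less: "x < (r, h) # y" "\<nexists>x'. x = (r, h) # x'"
  shows "word_op (step_word s m ((r, h) # y)) v (step_state x) = 0"
proof -
  let ?R = "fst ` set x" and ?Q = "P \<union> red_modes m x"
  have r_bounds: "0 \<le> r" "?R \<subseteq> {0..r}" "r \<notin> ?R \<or> h \<and> \<not> h_leads x"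
    using peelable_y peelable_less_Cons[OF peelable_x less] by auto
  have finite_Q: "finite ?Q" using finite_P finite_red_modes by simp
  show ?thesis
  proof (cases h)
    case False
    then show ?thesis
      using Ff_step_zero[OF finite_Q r_bounds(2,1), of y] r_bounds(3) f_steps_eq
      by (simp add: step_state_def)
  next
    case True
    have b_le: "b \<le> f_steps y" using peelable_y True by simp
    then have "P \<subseteq> {..<f_steps y + m}" using P_bound by auto
    then have "?Q \<subseteq> {..f_steps y + m}" "r \<notin> ?R \<or> f_steps y + m \<notin> ?Q"
      using red_modes_bounds[OF peelable_x, of m] f_steps_eq r_bounds(3) True
      by (auto split: if_splits)
    then show ?thesis
      using Hh_step_zero[OF finite_Q _ b_le r_bounds(2,1)] True by (simp add: step_state_def)
  qed
qed

lemma step_state_triangular: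
  "peelable b x \<Longrightarrow> peelable b y \<Longrightarrow> f_steps x = f_steps y \<Longrightarrow> x < y
    \<Longrightarrow> word_op (step_word s m y) v (step_state x) = 0"
proof (induct y arbitrary: x)
  case (Cons g y)
  obtain r h where g_eq: "g = (r, h)" by (cases g)
  show ?case
  proof (cases "\<exists>x'. x = (r, h) # x'")
    case True
    then obtain x' where x_eq: "x = (r, h) # x'" by blast
    have f_steps_eq: "f_steps y = f_steps x'"
      using Cons.prems(3) x_eq g_eq by (simp split: if_splits)
    have "word_op (step_word s m y) v (step_state x') = 0"
      using Cons.prems f_steps_eq x_eq g_eq by (intro Cons.hyps) auto
    then show ?thesis using step_state_Cons[OF _ f_steps_eq] Cons.prems(1) x_eq g_eq by blast
  next
    case False
    then show ?thesis using step_state_first_less Cons.prems g_eq by blast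
  qed
qed simp

end

lemma triangular_coeffs_zero:
  fixes p :: "'i \<Rightarrow> 'i \<Rightarrow> 'a::semiring_no_zero_divisors" and k :: "'i \<Rightarrow> 'k::linorder"
  assumes "finite S" "inj_on k S" "\<And>x. x \<in> S \<Longrightarrow> p x x \<noteq> 0"
    and "\<And>x y. x \<in> S \<Longrightarrow> y \<in> S \<Longrightarrow> k x < k y \<Longrightarrow> p y x = 0"
    and "\<And>x. x \<in> S \<Longrightarrow> (\<Sum>y\<in>S. c y * p y x) = 0"
  shows "\<forall>x\<in>S. c x = 0"
proof (rule ccontr)
  assume "\<not> (\<forall>x\<in>S. c x = 0)"
  then have nonzero: "finite {x \<in> S. c x \<noteq> 0}" "{x \<in> S. c x \<noteq> 0} \<noteq> {}" using assms(1) by auto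
  obtain x where x_least: "x \<in> S" "c x \<noteq> 0" "\<And>y. y \<in> S \<Longrightarrow> c y \<noteq> 0 \<Longrightarrow> k x \<le> k y"
    using ex_min_if_finite[of "k ` {x \<in> S. c x \<noteq> 0}"] nonzero by (auto simp: not_less)
  have "c y * p y x = 0" if "y \<in> S - {x}" for y
  proof (cases "c y = 0")
    case False
    then have "k x < k y"
      using x_least that assms(2) by (metis DiffE inj_onD insertI1 order_neq_le_trans)
    then show ?thesis using assms(4) x_least(1) that by simp
  qed simp
  then have "(\<Sum>y\<in>S - {x}. c y * p y x) = 0" by (intro sum.neutral) blast
  then have "(\<Sum>y\<in>S. c y * p y x) = c x * p x x" using assms(1) x_least(1) by (simp add: sum.remove)
  then show False using assms(3,5) x_least(1,2) by simp
qed

section \<open>Linear independence\<close>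

fun steps :: "(int \<Rightarrow> nat) \<Rightarrow> (int \<Rightarrow> nat) \<Rightarrow> nat \<Rightarrow> step list" where
  "steps a b 0 = []"
| "steps a b (Suc n) =
    (if a (int n + 1) \<noteq> 0 then [(int n - f_steps (steps a b n), False)]
     else if b (int n + 1) \<noteq> 0 then [(int n - f_steps (steps a b n), True)]
     else []) @ steps a b n"

lemma steps_site_cases:
  assumes "triangle a b"
  obtains (a) "a (int n + 1) = 1" "b (int n + 1) = 0" "a (int n) = 0"
  | (b) "a (int n + 1) = 0" "b (int n + 1) = 1" "a (int n) = 0"
  | (empty) "a (int n + 1) = 0" "b (int n + 1) = 0" "a (int n) \<le> 1"
  using triangleD(1)[OF assms, of "int n"] by linarith

lemma f_steps_steps_le: "f_steps (steps a b n) \<le> int n"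
  by (induct n) auto

lemma steps_holes_bounds:
  assumes "triangle a b"
  shows "\<forall>r\<in>fst ` set (steps a b n). 0 \<le> r \<and> r < int n - f_steps (steps a b n) + int (a (int n))"
proof (induct n)
  case (Suc n)
  from assms show ?case
    using Suc f_steps_steps_le[of a b n]
    by (cases rule: steps_site_cases[of a b n]) (force simp: add.commute)+
qed simp

lemma f_steps_steps_pos:
  assumes "1 \<le> j" "j \<le> int n" "a j \<noteq> 0" shows "1 \<le> f_steps (steps a b n)"
  using assms(2)
proof (induct n)
  case 0
  then show ?case using assms(1) by simp
next
  case (Suc n)
  then show ?case
    using assms(3) f_steps_nonneg[of "steps a b n"] by (cases "j = int n + 1") auto
qed

lemma h_leads_steps:
  assumes "rightnb a b" "h_leads (steps a b n)"
  shows "\<exists>j>int n. a j \<noteq> 0 \<and> (\<forall>i. int n < i \<and> i \<le> j \<longrightarrow> b i = 0)"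
proof -
  have "\<exists>k\<le>int n. b k \<noteq> 0 \<and> (\<forall>i. k < i \<and> i \<le> int n \<longrightarrow> a i = 0)"
    using assms(2)
  proof (induct n)
    case (Suc n)
    show ?case
    proof (cases "b (int n + 1) \<noteq> 0")
      case True
      then show ?thesis by (intro exI[of _ "int n + 1"]) auto
    next
      case False
      then have a_top: "a (int n + 1) = 0" and "h_leads (steps a b n)"
        using Suc.prems by (auto split: if_splits)
      then obtain k where last_b: "k \<le> int n" "b k \<noteq> 0" "\<forall>i. k < i \<and> i \<le> int n \<longrightarrow> a i = 0"
        using Suc.hyps by blast
      have "a i = 0" if "k < i" "i \<le> int n + 1" for i
        using last_b(3) a_top that by (cases "i = int n + 1") auto
      then show ?thesis using last_b by (intro exI[of _ k]) auto
    qed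
  qed simp
  then obtain k where last_b: "k \<le> int n" "b k \<noteq> 0" "\<forall>i. k < i \<and> i \<le> int n \<longrightarrow> a i = 0" by blast
  then obtain j where next_a: "j > k" "a j \<noteq> 0" "\<forall>i. k + 1 \<le> i \<and> i \<le> j \<longrightarrow> b i = 0"
    using assms(1) unfolding rightnb_def by blast
  have "int n < j" using last_b(3) next_a(1,2) by (metis not_le)
  then show ?thesis using next_a last_b(1) by (intro exI[of _ j]) auto
qed

lemma peelable_steps:
  assumes triangle: "triangle a b" and rightnb: "rightnb a b"
    and first_a: "p = 0 \<or> p = 1 \<and> (\<exists>j\<ge>1. a j \<noteq> 0 \<and> (\<forall>i\<le>j. b i = 0))"
  shows "peelable p (steps a b n)"
proof (induct n)
  case (Suc n)
  have f_steps_le: "0 \<le> int n - f_steps (steps a b n)" using f_steps_steps_le[of a b n] by simp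
  have holes: "\<forall>r\<in>fst ` set (steps a b n). r < int n - f_steps (steps a b n)" if "a (int n) = 0"
    using steps_holes_bounds[OF triangle, of n] that by auto
  from triangle show ?case
  proof (cases rule: steps_site_cases[of a b n])
    case b
    have "\<not> h_leads (steps a b n)"
    proof
      assume "h_leads (steps a b n)"
      then obtain j where "j > int n" "\<forall>i. int n < i \<and> i \<le> j \<longrightarrow> b i = 0"
        using h_leads_steps[OF rightnb] by blast
      then have "b (int n + 1) = 0" by auto
      then show False using b(2) by simp
    qed
    moreover have "p \<le> f_steps (steps a b n)"
      using first_a
    proof
      assume "p = 1 \<and> (\<exists>j\<ge>1. a j \<noteq> 0 \<and> (\<forall>i\<le>j. b i = 0))"
      then obtain j where j_first: "p = 1" "1 \<le> j" "a j \<noteq> 0" "\<forall>i\<le>j. b i = 0" by blast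
      have "j \<le> int n" using j_first(4) b(2) by (metis not_le zless_imp_add1_zle zero_neq_one)
      then show ?thesis using f_steps_steps_pos[of j n a b] j_first(1-3) by simp
    qed (simp add: f_steps_nonneg)
    ultimately show ?thesis using Suc f_steps_le holes b by auto
  qed (use Suc f_steps_le holes in auto)
qed simp

definition blocks :: "(int \<Rightarrow> gen list) \<Rightarrow> nat \<Rightarrow> gen list" where
  "blocks g n = concat (map g (rev [1..int n]))"

lemma blocks_0 [simp]: "blocks g 0 = []"
  by (simp add: blocks_def)

lemma blocks_Suc [simp]: "blocks g (Suc n) = g (int n + 1) @ blocks g n"
proof -
  have "[1..int (Suc n)] = [1..int n] @ [int n + 1]" using upto_rec2[of 1 "int (Suc n)"] by simp
  then show ?thesis by (simp add: blocks_def)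
qed

lemma blocks_cong: "(\<And>k. 1 \<le> k \<Longrightarrow> k \<le> int n \<Longrightarrow> g k = h k) \<Longrightarrow> blocks g n = blocks h n"
  unfolding blocks_def by (intro arg_cong[of _ _ concat] map_cong) auto

lemma blocks_shift: "blocks g (Suc n) = blocks (\<lambda>k. g (k + 1)) n @ g 1"
  by (induct n) (auto simp: algebra_simps)

definition site_word :: "int \<Rightarrow> int \<Rightarrow> (int \<Rightarrow> nat) \<Rightarrow> (int \<Rightarrow> nat) \<Rightarrow> int \<Rightarrow> gen list" where
  "site_word s m a b = (\<lambda>k. replicate (a k) (Ff (k + s)) @ replicate (b k) (Hh (k - 1 + m)))"

lemma replicate_swap:
  "p + q \<le> (1 :: nat) \<Longrightarrow> replicate p x @ replicate q y = replicate q y @ replicate p x"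
  by (cases p; cases q) auto

lemma step_word_steps:
  assumes "triangle a b" shows "step_word s m (steps a b n) = blocks (site_word s m a b) n"
proof (induct n)
  case (Suc n)
  from assms show ?case
    using Suc
    by (cases rule: steps_site_cases[of a b n]) (simp_all add: site_word_def algebra_simps)
qed simp

lemma steps_inj:
  assumes "triangle a b" "triangle a' b'" "steps a b n = steps a' b' n" "1 \<le> k" "k \<le> int n"
  shows "a k = a' k \<and> b k = b' k"
proof -
  have count: "length (filter ((=) (Ff k)) (blocks (site_word 0 1 a b) n))
      = (if k \<le> int n then a k else 0)"
    "length (filter ((=) (Hh k)) (blocks (site_word 0 1 a b) n))
      = (if k \<le> int n then b k else 0)" for a b
    using assms(4)
    by (induct n) (auto simp: site_word_def intro!: arg_cong[of _ _ a] arg_cong[of _ _ b])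
  have "blocks (site_word 0 1 a b) n = blocks (site_word 0 1 a' b') n"
    using step_word_steps[OF assms(1), of 0 1 n] step_word_steps[OF assms(2), of 0 1 n] assms(3)
    by simp
  then show ?thesis using count[of a b] count[of a' b'] assms(5) by simp
qed

lemma tw0_blocks: "N \<ge> 1 \<Longrightarrow> tw0 N a b = blocks (site_word 0 1 a b) (nat (N - 1))"
  by (simp add: tw0_def blocks_def site_word_def)

lemma tw1_blocks:
  assumes "triangle a b" "N \<ge> 0"
  shows "tw1 N a b = blocks (site_word (-1) 1 a b) (nat N) @ replicate (1 - a 0) (Ee 1)"
proof -
  have "tw1 N a b = blocks (\<lambda>k. replicate (b k) (Hh k) @ replicate (a k) (Ff (k - 1))) (nat N)
      @ replicate (1 - a 0) (Ee 1)"
    using assms(2) by (simp add: tw1_def blocks_def)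
  also have "blocks (\<lambda>k. replicate (b k) (Hh k) @ replicate (a k) (Ff (k - 1))) (nat N)
      = blocks (site_word (-1) 1 a b) (nat N)"
    unfolding site_word_def
    by (rule blocks_cong) (simp add: replicate_swap[OF triangle_site[OF assms(1)]])
  finally show ?thesis .
qed

lemma tw1_blocks_shift:
  assumes "triangle a b" "N \<ge> 0" "a 0 = 1"
  shows "tw1 N a b = blocks (site_word 0 2 (\<lambda>i. a (i + 1)) (\<lambda>i. b (i + 1))) (nat (N - 1))"
proof (cases "N = 0")
  case True
  then show ?thesis using assms by (simp add: tw1_blocks)
next
  case False
  then have nat_N: "nat N = Suc (nat (N - 1))" using assms(2) by simp
  have "a 1 = 0" "b 1 = 0" using triangleD(1)[OF assms(1), of 0] assms(3) by auto
  then have "blocks (site_word (-1) 1 a b) (nat N)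
      = blocks (\<lambda>k. site_word (-1) 1 a b (k + 1)) (nat (N - 1))"
    unfolding nat_N blocks_shift by (simp add: site_word_def)
  then show ?thesis using assms by (simp add: tw1_blocks site_word_def add.commute)
qed

lemma twm_blocks:
  assumes "triangle a b" "N \<ge> 2" "b 0 = 0" "b (N - 1) = 0"
  shows "twm N a b = blocks (site_word 0 0 (\<lambda>i. a (i - 1)) (\<lambda>i. b (i - 1))) (nat (N - 1))"
proof -
  let ?h = "\<lambda>k. replicate (b k) (Hh k)" and ?f = "\<lambda>k. replicate (a (k - 1)) (Ff k)"
  have "a (k - 1) + b k \<le> 1" for k using triangleD(1)[OF assms(1), of "k - 1"] by simp
  then have swap_site: "?f k @ ?h k = ?h k @ ?f k" for k by (rule replicate_swap)
  have "blocks (\<lambda>k. ?h k @ ?f k) n = ?h (int n) @ blocks (\<lambda>k. ?f k @ ?h (k - 1)) n" for n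
    using assms(3) by (induct n) (simp_all add: add.commute)
  then have "blocks (\<lambda>k. ?h k @ ?f k) (nat (N - 1)) = blocks (\<lambda>k. ?f k @ ?h (k - 1)) (nat (N - 1))"
    using assms(2,4) by simp
  moreover have "twm N a b = blocks (\<lambda>k. ?h k @ ?f k) (nat (N - 1))"
    using assms(2) by (simp add: twm_def blocks_def swap_site)
  ultimately show ?thesis by (simp add: site_word_def)
qed

text \<open>The green charge of the state from which the letters before a possible \<open>Ee 1\<close> start.\<close>

definition e_shift :: "int \<Rightarrow> config \<Rightarrow> int" where
  "e_shift M x = (if M = 1 \<and> fst x 0 = 0 then -1 else 0)"

lemma e_shift_cases: "e_shift M x = 0 \<or> e_shift M x = -1 \<and> M = 1"
  by (simp add: e_shift_def)

definition config_steps :: "int \<Rightarrow> int \<Rightarrow> config \<Rightarrow> step list" where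
  "config_steps M N x = (let s = e_shift M x in
    steps (\<lambda>i. fst x (i + (M + s))) (\<lambda>i. snd x (i + (M + s))) (nat (N - 1 - s)))"

lemma tau_eq_step_word:
  assumes M_range: "M \<in> {-1, 0, 1}" and MN_pos: "M + N \<ge> 1" and x_config: "x \<in> Cset M N"
  shows "tau M N x = bv (step_word (e_shift M x) (1 + M + e_shift M x) (config_steps M N x)
    @ replicate (nat (- e_shift M x)) (Ee 1))"
proof -
  obtain a b where x_eq: "x = (a, b)" by (cases x)
  have triangle: "triangle a b"
    using x_config by (auto simp: x_eq Cset_def C0_def C1_def split: if_splits)
  note shifted = step_word_steps[OF triangle_shift[OF triangle]]
  have "a 0 = 0 \<or> a 0 = 1" using triangle_site[OF triangle, of 0] by linarith
  then consider (zero) "M = 0" | (one_with_e) "M = 1" "a 0 = 0" | (one_without_e) "M = 1" "a 0 = 1"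
    | (minus_one) "M = -1" using M_range by auto
  then show ?thesis
  proof cases
    case zero
    then show ?thesis using MN_pos shifted[of 0 1 0]
      by (simp add: tau_def x_eq e_shift_def config_steps_def tw0_blocks)
  next
    case one_with_e
    then show ?thesis using MN_pos triangle shifted[of "-1" 1 0]
      by (simp add: tau_def x_eq e_shift_def config_steps_def tw1_blocks)
  next
    case one_without_e
    then show ?thesis using MN_pos triangle shifted[of 0 2 1]
      by (simp add: tau_def x_eq e_shift_def config_steps_def tw1_blocks_shift)
  next
    case minus_one
    then show ?thesis using MN_pos triangle shifted[of 0 0 "-1"] x_config
      by (simp add: tau_def x_eq e_shift_def config_steps_def twm_blocks Cset_def C1_def)
  qed
qed

lemma Cset_outside:
  assumes M_range: "M \<in> {-1, 0, 1}" and x_config: "(a, b) \<in> Cset M N"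
    and i_outside: "i \<le> M + e_shift M (a, b) \<or> M + N - 1 < i"
  shows "a i = (if M = 1 \<and> i = 0 then a 0 else 0) \<and> b i = 0"
proof -
  consider (zero) "M = 0" | (one_with_e) "M = 1" "a 0 = 0" | (one_without_e) "M = 1" "a 0 \<noteq> 0"
    | (minus_one) "M = -1" using M_range by auto
  then show ?thesis
  proof cases
    case zero
    then have "i < 0 \<or> i = 0 \<or> N - 1 < i" using i_outside by (auto simp: e_shift_def)
    then show ?thesis using zero x_config by (auto simp: Cset_def C0_def)
  next
    case one_with_e
    then have "i < 0 \<or> i = 0 \<or> N < i" using i_outside by (auto simp: e_shift_def)
    then show ?thesis using one_with_e x_config by (auto simp: Cset_def C1_def)
  next
    case one_without_e
    then have triangle: "triangle a b" using x_config by (simp add: Cset_def C1_def)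
    have "i < 0 \<or> i = 0 \<or> i = 1 \<or> N < i" using one_without_e i_outside by (auto simp: e_shift_def)
    then show ?thesis
      using one_without_e x_config triangleD(1)[OF triangle, of 0] by (auto simp: Cset_def C1_def)
  next
    case minus_one
    then have "i < 0 \<or> N - 2 < i" using i_outside by (auto simp: e_shift_def)
    then show ?thesis using minus_one x_config by (auto simp: Cset_def C1_def)
  qed
qed

lemma Cset_triangle: "(a, b) \<in> Cset M N \<Longrightarrow> triangle a b"
  and Cset_rightnb: "(a, b) \<in> Cset M N \<Longrightarrow> rightnb a b"
  by (auto simp: Cset_def C0_def C1_def split: if_splits)

lemma inj_on_config_steps:
  assumes M_range: "M \<in> {-1, 0, 1}"
  shows "inj_on (\<lambda>x. (e_shift M x = -1, config_steps M N x)) (Cset M N)"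
proof (rule inj_onI)
  fix x y assume x_config: "x \<in> Cset M N" and y_config: "y \<in> Cset M N"
    and key_eq: "(e_shift M x = -1, config_steps M N x) = (e_shift M y = -1, config_steps M N y)"
  obtain a b a' b' where xy_eq: "x = (a, b)" "y = (a', b')" by (cases x, cases y)
  define s where "s = e_shift M x"
  have e_shift_y: "e_shift M y = s" using key_eq by (auto simp: s_def e_shift_def split: if_splits)
  have steps_eq: "steps (\<lambda>i. a (i + (M + s))) (\<lambda>i. b (i + (M + s))) (nat (N - 1 - s))
      = steps (\<lambda>i. a' (i + (M + s))) (\<lambda>i. b' (i + (M + s))) (nat (N - 1 - s))"
    using key_eq e_shift_y unfolding s_def by (simp add: config_steps_def Let_def xy_eq)
  have "a i = a' i \<and> b i = b' i" for i
  proof (cases "i \<le> M + s \<or> M + N - 1 < i")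
    case True
    have "a 0 = a' 0" if "M = 1"
      using that key_eq triangle_site[OF Cset_triangle, of a b M N 0]
        triangle_site[OF Cset_triangle, of a' b' M N 0] x_config y_config
      by (auto simp: xy_eq e_shift_def split: if_splits)
    then show ?thesis
      using Cset_outside[OF M_range, of a b N i] Cset_outside[OF M_range, of a' b' N i] True
        x_config y_config e_shift_y
      by (simp add: xy_eq s_def)
  next
    case False
    then show ?thesis
      using steps_inj[OF triangle_shift triangle_shift steps_eq, of "i - (M + s)"] x_config y_config
        Cset_triangle
      by (simp add: xy_eq)
  qed
  then show "x = y" by (simp add: xy_eq fun_eq_iff)
qed

lemma C1_config_starts_with_a:
  assumes M_or_e_shift: "M = -1 \<or> e_shift M (a, b) = -1" and x_config: "(a, b) \<in> Cset M N"
  defines "d \<equiv> M + e_shift M (a, b)"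
  shows "\<exists>j\<ge>1. j \<le> N - 1 - e_shift M (a, b) \<and> a (j + d) \<noteq> 0 \<and> (\<forall>i\<le>j. b (i + d) = 0)"
proof -
  have M_cases: "M = -1 \<or> M = 1" using M_or_e_shift by (auto simp: e_shift_def split: if_splits)
  then obtain j where first_a: "a j \<noteq> 0" "\<forall>i\<le>j. b i = 0"
    using x_config by (auto simp: Cset_def C1_def)
  have "M = 1 \<Longrightarrow> a 0 = 0" using M_or_e_shift by (auto simp: e_shift_def split: if_splits)
  then have "\<not> (j \<le> d \<or> M + N - 1 < j)"
    using Cset_outside[OF _ x_config, of j] first_a(1) M_cases
    by (auto simp: d_def split: if_splits)
  then show ?thesis using first_a by (intro exI[of _ "j - d"]) (auto simp: d_def)
qed

definition min_charge :: "int \<Rightarrow> config \<Rightarrow> int" where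
  "min_charge M x = (if M = -1 \<or> e_shift M x = -1 then 1 else 0)"

lemma config_stepsE:
  assumes M_range: "M \<in> {-1, 0, 1}" and x_config: "x \<in> Cset M N"
  obtains a b n where "config_steps M N x = steps a b n" "triangle a b" "rightnb a b"
    "\<forall>j>int n. a j = 0" "n = 0 \<or> int n = N - 1 - e_shift M x"
    "min_charge M x = 1 \<longrightarrow> (\<exists>j\<ge>1. j \<le> int n \<and> a j \<noteq> 0 \<and> (\<forall>i\<le>j. b i = 0))"
proof -
  obtain a b where x_eq: "x = (a, b)" by (cases x)
  define s where "s = e_shift M x"
  define n where "n = nat (N - 1 - s)"
  define a' where "a' = (\<lambda>i. a (i + (M + s)))"
  define b' where "b' = (\<lambda>i. b (i + (M + s)))"
  show thesis
  proof (rule that[of a' b' n])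
    show "config_steps M N x = steps a' b' n"
      by (simp add: config_steps_def Let_def x_eq s_def n_def a'_def b'_def)
    show "triangle a' b'" "rightnb a' b'"
      using x_config x_eq Cset_triangle Cset_rightnb triangle_shift rightnb_shift
      unfolding a'_def b'_def by blast+
    show "n = 0 \<or> int n = N - 1 - e_shift M x" by (auto simp: n_def s_def)
    show "\<forall>j>int n. a' j = 0"
    proof (intro allI impI)
      fix j assume "int n < j"
      then have "M + N - 1 < j + (M + s)" unfolding n_def by linarith
      moreover have "\<not> (M = 1 \<and> j + (M + s) = 0)"
        using \<open>int n < j\<close> e_shift_cases[of M x] by (auto simp: s_def)
      ultimately show "a' j = 0"
        using Cset_outside[OF M_range, of a b N "j + (M + s)"] x_config by (auto simp: a'_def x_eq)
    qed
    show "min_charge M x = 1 \<longrightarrow> (\<exists>j\<ge>1. j \<le> int n \<and> a' j \<noteq> 0 \<and> (\<forall>i\<le>j. b' i = 0))"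
      using C1_config_starts_with_a[of M a b N] x_config
      by (auto simp: min_charge_def x_eq a'_def b'_def n_def s_def split: if_splits)
  qed
qed

lemma peelable_config_steps:
  assumes "M \<in> {-1, 0, 1}" "x \<in> Cset M N"
  shows "peelable (min_charge M x) (config_steps M N x)"
  using assms
proof (rule config_stepsE)
  fix a b n
  assume steps_eq: "config_steps M N x = steps a b n" "triangle a b" "rightnb a b"
    and first_a: "min_charge M x = 1 \<longrightarrow> (\<exists>j\<ge>1. j \<le> int n \<and> a j \<noteq> 0 \<and> (\<forall>i\<le>j. b i = 0))"
  have "min_charge M x = 0 \<or> min_charge M x = 1" by (simp add: min_charge_def)
  then show ?thesis
    unfolding steps_eq(1) using first_a by (intro peelable_steps[OF steps_eq(2,3)]) blast
qed

lemma not_h_leads_config_steps: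
  assumes "M \<in> {-1, 0, 1}" "x \<in> Cset M N" shows "\<not> h_leads (config_steps M N x)"
  using assms by (rule config_stepsE) (use h_leads_steps in fastforce)

lemma min_charge_le:
  assumes "M \<in> {-1, 0, 1}" "x \<in> Cset M N"
  shows "min_charge M x \<le> f_steps (config_steps M N x)"
  using assms
proof (rule config_stepsE)
  fix a b n
  assume steps_eq: "config_steps M N x = steps a b n"
    and first_a: "min_charge M x = 1 \<longrightarrow> (\<exists>j\<ge>1. j \<le> int n \<and> a j \<noteq> 0 \<and> (\<forall>i\<le>j. b i = 0))"
  show ?thesis
    unfolding steps_eq using first_a f_steps_steps_pos[of _ n a b] f_steps_nonneg[of "steps a b n"]
    by (cases "min_charge M x = 1") (auto simp: min_charge_def)
qed

lemma config_steps_holes: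
  assumes "M \<in> {-1, 0, 1}" "x \<in> Cset M N"
  shows "fst ` set (config_steps M N x) \<subseteq> {0..<N - (f_steps (config_steps M N x) + e_shift M x)}"
  using assms
proof (rule config_stepsE)
  fix a b n
  assume steps_eq: "config_steps M N x = steps a b n" "triangle a b"
    and n_eq: "n = 0 \<or> int n = N - 1 - e_shift M x"
  have "a (int n) \<le> 1" using triangle_site[OF steps_eq(2), of "int n"] by simp
  then have "fst ` set (steps a b n) \<subseteq> {0..<int n + 1 - f_steps (steps a b n)}"
    using steps_holes_bounds[OF steps_eq(2), of n] by fastforce
  then show ?thesis unfolding steps_eq(1) using n_eq by (elim disjE) auto
qed

lemma config_charge_le:
  assumes "M \<in> {-1, 0, 1}" "M + N \<ge> 1" "x \<in> Cset M N"
  shows "f_steps (config_steps M N x) + e_shift M x \<le> N"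
  using assms(1,3)
proof (rule config_stepsE)
  fix a b n
  assume steps_eq: "config_steps M N x = steps a b n"
    and n_eq: "n = 0 \<or> int n = N - 1 - e_shift M x"
  show ?thesis
    unfolding steps_eq
    using f_steps_steps_le[of a b n] n_eq e_shift_cases[of M x] assms(1,2) by auto
qed

text \<open>For the words ending in \<open>Ee 1\<close>, the range \<open>{1..- s}\<close> is the red mode \<open>1\<close> which \<open>Ee 1\<close> fills.\<close>

definition config_state :: "int \<Rightarrow> int \<Rightarrow> config \<Rightarrow> int set" where
  "config_state M N x = (let s = e_shift M x; y = config_steps M N x in
    test_state ({1..- s} \<union> red_modes (1 + M + s) y) (fst ` set y) (f_steps y + s))"

lemma JMN_coeff_kernel_config_state:
  assumes M_range: "M \<in> {-1, 0, 1}" and MN_pos: "M + N \<ge> 1" and x_config: "x \<in> Cset M N"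
  shows "JMN M N \<subseteq> coeff_kernel (config_state M N x)"
proof -
  define s where "s = e_shift M x"
  define y where "y = config_steps M N x"
  have s_cases: "s = 0 \<or> s = -1 \<and> M = 1" unfolding s_def by (rule e_shift_cases)
  have charge: "min_charge M x \<le> f_steps y" "M = -1 \<or> s = -1 \<Longrightarrow> min_charge M x = 1"
    using min_charge_le[OF M_range x_config] by (auto simp: y_def s_def min_charge_def)
  have red_le: "red_modes (1 + M + s) y \<subseteq> {..f_steps y + s + M}"
    using red_modes_bounds[OF peelable_config_steps[OF M_range x_config]] not_h_leads_config_steps[OF M_range x_config]
    by (fastforce simp: y_def)
  have nonneg: "0 \<le> f_steps y" by (rule f_steps_nonneg)
  have "JMN M N
    \<subseteq> coeff_kernel (test_state ({1..- s} \<union> red_modes (1 + M + s) y) (fst ` set y) (f_steps y + s))"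
  proof (rule JMN_coeff_kernel_test_state)
    show "{1..- s} \<union> red_modes (1 + M + s) y \<subseteq> {..f_steps y + s + M}"
      using red_le s_cases charge by auto
    show "0 \<le> f_steps y + s + M" using s_cases charge nonneg M_range by auto
    show "fst ` set y \<subseteq> {0..<N - (f_steps y + s)}" "f_steps y + s \<le> N"
      using config_steps_holes[OF M_range x_config] config_charge_le[OF assms] by (simp_all add: y_def s_def)
    show "f_steps y + s \<noteq> 0" if "M = -1 \<or> N = -1" using that s_cases charge M_range MN_pos by auto
  qed
  then show ?thesis by (simp add: config_state_def Let_def s_def y_def)
qed

lemma peeling_config:
  assumes "M \<in> {-1, 0, 1}"
  shows "peeling (e_shift M x) (1 + M + e_shift M x) (min_charge M x) {1..- e_shift M x}
    (word_op (replicate (nat (- e_shift M x)) (Ee 1)) vac)"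
proof -
  consider (without_e) "e_shift M x = 0" | (with_e) "e_shift M x = -1" "M = 1"
    using e_shift_cases by blast
  then show ?thesis
  proof cases
    case without_e
    then show ?thesis
      using assms by unfold_locales (auto simp: test_state_vacuum vac_apply min_charge_def)
  next
    case with_e
    then show ?thesis
      using Ee1_vac_test_state by unfold_locales (auto simp: min_charge_def)
  qed
qed

lemma tau_config_state_diagonal:
  assumes M_range: "M \<in> {-1, 0, 1}" and MN_pos: "M + N \<ge> 1" and x_config: "x \<in> Cset M N"
  shows "tensor_op (tau M N x) vac (config_state M N x) \<noteq> 0"
proof -
  interpret peeling "e_shift M x" "1 + M + e_shift M x" "min_charge M x" "{1..- e_shift M x}"
    "word_op (replicate (nat (- e_shift M x)) (Ee 1)) vac" by (rule peeling_config[OF M_range])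
  show ?thesis
    using step_state_diagonal[OF peelable_config_steps[OF M_range x_config]]
    by (simp add: tau_eq_step_word[OF assms] config_state_def Let_def step_state_def word_op_append)
qed

lemma tau_config_state_charge:
  assumes "M \<in> {-1, 0, 1}" "M + N \<ge> 1" "y \<in> Cset M N"
    and "tensor_op (tau M N y) vac (config_state M N x) \<noteq> 0"
  shows "f_steps (config_steps M N y) + e_shift M y = f_steps (config_steps M N x) + e_shift M x"
proof -
  have "charge (replicate n (Ee 1)) = - int n" for n by (induct n) auto
  moreover have "e_shift M y \<le> 0" by (simp add: e_shift_def)
  ultimately show ?thesis
    using assms(4) word_op_vac_charge[of _ "config_state M N x"]
    by (fastforce simp: tau_eq_step_word[OF assms(1-3)] config_state_def Let_def
        green_charge_test_state charge_append charge_step_word)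
qed

lemma tau_config_state_triangular:
  assumes M_range: "M \<in> {-1, 0, 1}" and MN_pos: "M + N \<ge> 1" and x_config: "x \<in> Cset M N"
    and y_config: "y \<in> Cset M N"
    and key_less: "(e_shift M x = -1, config_steps M N x) < (e_shift M y = -1, config_steps M N y)"
  shows "tensor_op (tau M N y) vac (config_state M N x) = 0"
proof (rule ccontr)
  assume nonzero: "tensor_op (tau M N y) vac (config_state M N x) \<noteq> 0"
  show False
  proof (cases "e_shift M x = e_shift M y")
    case True
    interpret peeling "e_shift M x" "1 + M + e_shift M x" "min_charge M x" "{1..- e_shift M x}"
      "word_op (replicate (nat (- e_shift M x)) (Ee 1)) vac" by (rule peeling_config[OF M_range])
    have state_eq: "step_state (config_steps M N x) = config_state M N x"
      by (simp add: step_state_def config_state_def Let_def)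
    have "peelable (min_charge M x) (config_steps M N y)"
      using peelable_config_steps[OF M_range y_config] True by (simp add: min_charge_def)
    moreover have "f_steps (config_steps M N x) = f_steps (config_steps M N y)"
      using tau_config_state_charge[OF M_range MN_pos y_config nonzero] True by simp
    moreover have "config_steps M N x < config_steps M N y" using key_less True by simp
    ultimately have "word_op (step_word (e_shift M x) (1 + M + e_shift M x) (config_steps M N y))
        (word_op (replicate (nat (- e_shift M x)) (Ee 1)) vac) (config_state M N x) = 0"
      using step_state_triangular[OF peelable_config_steps[OF M_range x_config]]
      by (simp only: state_eq)
    then show False
      using nonzero
      by (simp add: tau_eq_step_word[OF M_range MN_pos y_config] word_op_append flip: True)
  next
    case False
    then have M_shifts: "M = 1" "e_shift M x = 0" "e_shift M y = -1"
      using key_less by (auto simp: e_shift_def split: if_splits)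
    have "site Red 1 \<notin> config_state M N x"
      using red_modes_bounds[OF peelable_config_steps[OF M_range x_config], of "1 + M"]
        M_shifts(1,2)
      by (auto simp: config_state_def Let_def min_charge_def)
    then show False
      using nonzero word_op_Ee1_vac_red_unoccupied M_shifts(3)
      by (simp add: tau_eq_step_word[OF M_range MN_pos y_config] word_op_append)
  qed
qed

lemma tau_indep:
  assumes M_range: "M \<in> {-1, 0, 1}" and MN_pos: "M + N \<ge> 1"
  shows "indep_mod (JMN M N) (tau M N) (Cset M N)"
  unfolding indep_mod_def
proof (intro allI impI, elim conjE)
  fix c S assume S_subset: "S \<subseteq> Cset M N" "finite S"
    and sum_JMN: "(\<Sum>y\<in>S. sc (c y) (tau M N y)) \<in> JMN M N"
  show "\<forall>x\<in>S. c x = 0"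
  proof (rule triangular_coeffs_zero[where
        p = "\<lambda>y x. tensor_op (tau M N y) vac (config_state M N x)",
        OF S_subset(2) inj_on_subset[OF inj_on_config_steps[OF M_range] S_subset(1)]])
    fix x assume x_mem: "x \<in> S"
    then show "tensor_op (tau M N x) vac (config_state M N x) \<noteq> 0"
      using S_subset(1) by (intro tau_config_state_diagonal[OF M_range MN_pos]) auto
    show "tensor_op (tau M N y) vac (config_state M N x) = 0"
      if "y \<in> S"
        "(e_shift M x = -1, config_steps M N x) < (e_shift M y = -1, config_steps M N y)" for y
      using that x_mem S_subset(1) by (intro tau_config_state_triangular[OF M_range MN_pos]) auto
    have "tensor_op (\<Sum>y\<in>S. sc (c y) (tau M N y)) vac (config_state M N x) = 0"
      using JMN_coeff_kernel_config_state[OF M_range MN_pos, of x] x_mem S_subset(1) sum_JMN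
      by (auto simp: coeff_kernel_def)
    then show "(\<Sum>y\<in>S. c y * tensor_op (tau M N y) vac (config_state M N x)) = 0"
      by (simp add: tensor_op_sum tensor_op_sc tau_def sum_fun_apply sc_apply)
  qed
qed

theorem theorem5p2p1:
  fixes M N :: int
  assumes "M \<in> {-1, 0, 1}" and "N \<ge> -1" and "M + N \<ge> 1"
  shows "indep_mod (JMN M N) (tau M N) (Cset M N)
       \<and> spans_mod (JMN M N) (tau M N) (Cset M N)
       \<and> qdim (JMN M N) = 2 ^ nat (M + N - 1)"
proof -
  have indep: "indep_mod (JMN M N) (tau M N) (Cset M N)" using assms(1,3) by (rule tau_indep)
  have "fins (tau M N x)" for x by (simp add: tau_def)
  from basis_mod_criterion[OF subspace_JMN codim_le_JMN[OF assms(1,3)] finite_Cset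
      card_Cset_ge[OF assms(1,3)] this indep]
  show ?thesis using indep by blast
qed

end
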